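(* Let $k$ be a field and $H$ a finite dimensional Hopf algebra over $k$. Let $Z=(H^*\otimes H^{*op})\bowtie(H\otimes H^{op})$ be the diagonal crossed product. Then Hopf bimodules over $H^*$ coincide with left $Z$-modules, i.e. there is an isomorphism between the category of Hopf bimodules over $H^*$ and the category of left $Z$-modules, which is the identity on underlying vector spaces and linear maps, where the action of $Z$ on a Hopf bimodule $M$ is given by $$((p\otimes q)\bowtie(h\otimes g))\cdot m=\sum m_{(-1)}(g)\,m_{(1)}(h)\,p\cdot m_{(0)}\cdot q$$ for all $p,q\in H^*$, $h,g\in H$, $m\in M$.
   Context: Everything is over a fixed field $k$, $\otimes=\otimes_k$, and Sweedler notation is used. $H^*$ is the dual Hopf algebra, with $(pq)(h)=\sum p(h_1)q(h_2)$ and $\sum p_1(h)p_2(h')=p(hh')$. $H^{op}$, $H^{*op}$ denote opposite algebras. Regular actions of $H$ on $H^*$: $(h\rightharpoonup f)(h')=f(h'h)$ and $(f\leftharpoonup h')(h)=f(h'h)$. The antipode $S$ of $H$ is bijective. Diagonal crossed product: for a finite dimensional Hopf algebra $K$ and a $K$-bimodule algebra $C$, $C\bowtie K$ is the algebra on $C\otimes K$ with unit $1\bowtie1$ and multiplication $(c\bowtie x)(c'\bowtie x')=\sum c(x_1\cdot c'\cdot S_K^{-1}(x_3))\bowtie x_2x'$. Here $K=H\otimes H^{op}$ (antipode $S\otimes S^{-1}$) and $C=H^*\otimes H^{*op}$ with bimodule structure $x\cdot(p\otimes q)\cdot y=x\cdot p\otimes q\cdot y$, where $(h\otimes h')\cdot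 p=h\rightharpoonup p\leftharpoonup h'$ and $q\cdot(h\otimes h')=S(h)\rightharpoonup q\leftharpoonup S^{-1}(h')$. Explicitly the multiplication of $Z$ is $$((p\otimes q)\bowtie(h\otimes g))((p'\otimes q')\bowtie(h'\otimes g'))=\sum (p(h_1\rightharpoonup p'\leftharpoonup g_1)\otimes(h_3\rightharpoonup q'\leftharpoonup g_3)q)\bowtie(h_2h'\otimes g'g_2),$$ with products on the right taken in $H^*$ and $H$ (not in the opposite algebras). A Hopf bimodule over $H^*$ is a vector space $M$ that is an $H^*$-bimodule (actions $p\cdot m$, $m\cdot q$) and an $H^*$-bicomodule, with coaction $M\to H^*\otimes M\otimes H^*$, $m\mapsto\sum m_{(-1)}\otimes m_{(0)}\otimes m_{(1)}$, such that the left and right coactions are $H^*$-bimodule maps, i.e. $\sum (p\cdot m\cdot q)_{(-1)}\otimes (p\cdot m\cdot q)_{(0)}\otimes (p\cdot m\cdot q)_{(1)}=\sum p_1m_{(-1)}q_1\otimes p_2\cdot m_{(0)}\cdot q_2\otimes p_3m_{(1)}q_3$. Morphisms are linear maps that are both bimodule and bicomodule maps. *)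

theory Defs
  imports Complex_Main "HOL-Library.FuncSet" "HOL-Library.Function_Algebras"
begin

section \<open>Vector spaces, linear and bilinear maps\<close>

text \<open>
  A vector space over the field type \<open>'k\<close> is a subspace \<open>carrier V\<close> of an ambient vector space
  on a type \<open>'a\<close> with scalar multiplication \<open>smul V\<close>; its addition is that of \<open>'a\<close>. The carrier
  is needed because duals and tensor products do not fill a whole type. All conditions on maps
  are relative to carriers.
\<close>

record ('k, 'a) space =
  carrier :: "'a set"
  smul :: "'k \<Rightarrow> 'a \<Rightarrow> 'a"

definition is_space :: "('k::field, 'a::ab_group_add, 'x) space_scheme \<Rightarrow> bool" where
  "is_space V \<longleftrightarrow> vector_space (smul V) \<and> module.subspace (smul V) (carrier V)"

definition finite_dim :: "('k::field, 'a::ab_group_add, 'x) space_scheme \<Rightarrow> bool" where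
  "finite_dim V \<longleftrightarrow> (\<exists>B. finite B \<and> module.span (smul V) B = carrier V)"

definition field_space :: "('k::field, 'k) space" where
  "field_space = \<lparr>carrier = UNIV, smul = (*)\<rparr>"

definition lin :: "('k::field, 'a::ab_group_add, 'x) space_scheme \<Rightarrow>
    ('k, 'b::ab_group_add, 'y) space_scheme \<Rightarrow> ('a \<Rightarrow> 'b) \<Rightarrow> bool" where
  "lin V W f \<longleftrightarrow>
     (\<forall>x\<in>carrier V. f x \<in> carrier W) \<and>
     (\<forall>x\<in>carrier V. \<forall>y\<in>carrier V. f (x + y) = f x + f y) \<and>
     (\<forall>c. \<forall>x\<in>carrier V. f (smul V c x) = smul W c (f x))"

definition bilin :: "('k::field, 'a::ab_group_add, 'x) space_scheme \<Rightarrow>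
    ('k, 'b::ab_group_add, 'y) space_scheme \<Rightarrow> ('k, 'c::ab_group_add, 'z) space_scheme \<Rightarrow>
    ('a \<Rightarrow> 'b \<Rightarrow> 'c) \<Rightarrow> bool" where
  "bilin V W X \<beta> \<longleftrightarrow>
     (\<forall>w\<in>carrier W. lin V X (\<lambda>v. \<beta> v w)) \<and> (\<forall>v\<in>carrier V. lin W X (\<beta> v))"


section \<open>Tensor products\<close>

text \<open>
  \<open>tens V W v w\<close> is evaluation at \<open>(v, w)\<close> on the space of bilinear forms on \<open>V \<times> W\<close>; over a
  field, the span of these functionals is the tensor product (see \<open>tensor_universal\<close> below).
\<close>

type_synonym ('k, 'a, 'b) tensor = "('a \<Rightarrow> 'b \<Rightarrow> 'k) \<Rightarrow> 'k"

definition tens :: "('k::field, 'a::ab_group_add, 'x) space_scheme \<Rightarrow>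
    ('k, 'b::ab_group_add, 'y) space_scheme \<Rightarrow> 'a \<Rightarrow> 'b \<Rightarrow> ('k, 'a, 'b) tensor" where
  "tens V W v w = (\<lambda>\<beta>. if bilin V W field_space \<beta> then \<beta> v w else 0)"

definition tensor_space :: "('k::field, 'a::ab_group_add, 'x) space_scheme \<Rightarrow>
    ('k, 'b::ab_group_add, 'y) space_scheme \<Rightarrow> ('k, ('k, 'a, 'b) tensor) space" where
  "tensor_space V W =
     \<lparr>carrier = module.span (\<lambda>c t \<beta>. c * t \<beta>) {tens V W v w | v w. v \<in> carrier V \<and> w \<in> carrier W},
      smul = (\<lambda>c t \<beta>. c * t \<beta>)\<rparr>"

text \<open>
  \<open>lift V W \<beta> t\<close> is the sum of the \<open>\<beta> v\<^sub>i w\<^sub>i\<close> for any representation of \<open>t\<close> as the sum of the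
  \<open>v\<^sub>i \<otimes> w\<^sub>i\<close>; for bilinear \<open>\<beta>\<close> this is independent of the representation.
  All Sweedler-type notation below is expressed by it.
\<close>

definition lift :: "('k::field, 'a::ab_group_add, 'x) space_scheme \<Rightarrow>
    ('k, 'b::ab_group_add, 'y) space_scheme \<Rightarrow>
    ('a \<Rightarrow> 'b \<Rightarrow> 'c::ab_group_add) \<Rightarrow> ('k, 'a, 'b) tensor \<Rightarrow> 'c" where
  "lift V W \<beta> t = (THE x. \<exists>ps. set ps \<subseteq> carrier V \<times> carrier W \<and>
     t = (\<Sum>(v, w)\<leftarrow>ps. tens V W v w) \<and> x = (\<Sum>(v, w)\<leftarrow>ps. \<beta> v w))"

definition tmap :: "('k::field, 'a::ab_group_add, 'x) space_scheme \<Rightarrow>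
    ('k, 'b::ab_group_add, 'y) space_scheme \<Rightarrow> ('k, 'c::ab_group_add, 'z) space_scheme \<Rightarrow>
    ('k, 'd::ab_group_add, 'w) space_scheme \<Rightarrow> ('a \<Rightarrow> 'c) \<Rightarrow> ('b \<Rightarrow> 'd) \<Rightarrow>
    ('k, 'a, 'b) tensor \<Rightarrow> ('k, 'c, 'd) tensor" where
  "tmap V W V' W' f g = lift V W (\<lambda>v w. tens V' W' (f v) (g w))"

definition tassoc :: "('k::field, 'a::ab_group_add, 'x) space_scheme \<Rightarrow>
    ('k, 'b::ab_group_add, 'y) space_scheme \<Rightarrow> ('k, 'c::ab_group_add, 'z) space_scheme \<Rightarrow>
    ('k, ('k, 'a, 'b) tensor, 'c) tensor \<Rightarrow> ('k, 'a, ('k, 'b, 'c) tensor) tensor" where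
  "tassoc U V W = lift (tensor_space U V) W
     (\<lambda>t w. lift U V (\<lambda>u v. tens U (tensor_space V W) u (tens V W v w)) t)"


subsection \<open>Universal property\<close>

lemma vs_tensor: "vector_space (\<lambda>(c::'k::field) (t::'b \<Rightarrow> 'k) \<beta>. c * t \<beta>)"
  by unfold_locales (auto simp: fun_eq_iff algebra_simps)

lemma carrier_tensor_iff:
  fixes V :: "('k::field, 'a::ab_group_add, 'x) space_scheme"
    and W :: "('k, 'b::ab_group_add, 'y) space_scheme"
  assumes V: "is_space V"
  shows "t \<in> carrier (tensor_space V W) \<longleftrightarrow>
    (\<exists>ps. set ps \<subseteq> carrier V \<times> carrier W \<and> t = (\<Sum>(v, w)\<leftarrow>ps. tens V W v w))"
proof -
  interpret T: vector_space "\<lambda>(c::'k) (t::('k,'a,'b) tensor) \<beta>. c * t \<beta>" by (rule vs_tensor)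
  let ?S = "{tens V W v w | v w. v \<in> carrier V \<and> w \<in> carrier W}"
  let ?P = "\<lambda>t. \<exists>ps. set ps \<subseteq> carrier V \<times> carrier W \<and> t = (\<Sum>(v, w)\<leftarrow>ps. tens V W v w)"
  have scale: "(\<lambda>\<beta>. c * tens V W v w \<beta>) = tens V W (smul V c v) w"
    if "v \<in> carrier V" "w \<in> carrier W" for c v w
    using that by (auto simp: tens_def fun_eq_iff bilin_def lin_def field_space_def)
  have closed: "smul V c v \<in> carrier V" if "v \<in> carrier V" for c v
    using V that unfolding is_space_def
    by (auto simp: module.subspace_scale module_iff_vector_space)
  have "?P t" if "t \<in> T.span ?S"
    using that
  proof (induction rule: T.span_induct_alt)
    case base
    show ?case by (rule exI[of _ "[]"]) simp
  next
    case (step c x y)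
    then obtain v w ps where "v \<in> carrier V" "w \<in> carrier W" "x = tens V W v w"
      "set ps \<subseteq> carrier V \<times> carrier W" "y = (\<Sum>(v, w)\<leftarrow>ps. tens V W v w)" by auto
    then show ?case
      by (intro exI[of _ "(smul V c v, w) # ps"]) (auto simp: scale closed)
  qed
  moreover have "(\<Sum>(v, w)\<leftarrow>ps. tens V W v w) \<in> T.span ?S" if "set ps \<subseteq> carrier V \<times> carrier W" for ps
    using that
  proof (induction ps)
    case (Cons p ps)
    obtain v w where "p = (v, w)" by force
    moreover have "tens V W v w + (\<Sum>(v, w)\<leftarrow>ps. tens V W v w) \<in> T.span ?S"
      by (rule T.span_add[OF T.span_base]) (use Cons \<open>p = (v, w)\<close> in auto)
    ultimately show ?case by (simp add: plus_fun_def)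
  qed (simp add: T.span_zero)
  ultimately show ?thesis by (auto simp: tensor_space_def)
qed

lemma lift_eqI:
  fixes V :: "('k::field, 'a::ab_group_add, 'x) space_scheme"
    and W :: "('k, 'b::ab_group_add, 'y) space_scheme"
    and X :: "('k, 'c::ab_group_add, 'z) space_scheme"
  assumes X: "is_space X" and \<beta>: "bilin V W X \<beta>" and ps: "set ps \<subseteq> carrier V \<times> carrier W"
    and t: "t = (\<Sum>(v, w)\<leftarrow>ps. tens V W v w)"
  shows "lift V W \<beta> t = (\<Sum>(v, w)\<leftarrow>ps. \<beta> v w)"
proof -
  interpret X: vector_space "smul X" using X by (simp add: is_space_def)
  interpret K: vector_space "(*) :: 'k \<Rightarrow> 'k \<Rightarrow> 'k" by unfold_locales (auto simp: algebra_simps)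
  interpret XK: vector_space_pair "smul X" "(*) :: 'k \<Rightarrow> 'k \<Rightarrow> 'k" ..
  have uniq: "(\<Sum>(v, w)\<leftarrow>qs. \<beta> v w) = (\<Sum>(v, w)\<leftarrow>ps. \<beta> v w)"
    if qs: "set qs \<subseteq> carrier V \<times> carrier W" and e: "t = (\<Sum>(v, w)\<leftarrow>qs. tens V W v w)" for qs
  proof (rule ccontr)
    let ?d = "(\<Sum>(v, w)\<leftarrow>qs. \<beta> v w) - (\<Sum>(v, w)\<leftarrow>ps. \<beta> v w)"
    assume "\<not> ?thesis"
    then have "X.independent {?d}" by (simp add: X.dependent_single)
    from XK.linear_independent_extend[OF this, of "\<lambda>_. 1"]
    obtain \<phi> where lin: "Vector_Spaces.linear (smul X) (*) \<phi>" and \<phi>: "\<phi> ?d = 1" by auto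
    interpret \<phi>: Vector_Spaces.linear "smul X" "(*)" \<phi> by fact
    have b: "bilin V W field_space (\<lambda>v w. \<phi> (\<beta> v w))"
      using \<beta> by (auto simp: bilin_def lin_def field_space_def \<phi>.add \<phi>.scale)
    have ev: "(\<Sum>(v, w)\<leftarrow>rs. tens V W v w) (\<lambda>v w. \<phi> (\<beta> v w)) = \<phi> (\<Sum>(v, w)\<leftarrow>rs. \<beta> v w)" for rs
      by (induction rs) (auto simp: tens_def b \<phi>.zero \<phi>.add)
    have "\<phi> (\<Sum>(v, w)\<leftarrow>qs. \<beta> v w) = \<phi> (\<Sum>(v, w)\<leftarrow>ps. \<beta> v w)"
      using t e by (metis ev)
    with \<phi> show False by (simp add: \<phi>.diff)
  qed
  show ?thesis unfolding lift_def
    by (rule the_equality) (use ps t uniq in blast)+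
qed

theorem tensor_universal:
  fixes V :: "('k::field, 'a::ab_group_add, 'x) space_scheme"
    and W :: "('k, 'b::ab_group_add, 'y) space_scheme"
    and X :: "('k, 'c::ab_group_add, 'z) space_scheme"
  assumes V: "is_space V" and W: "is_space W" and X: "is_space X" and \<beta>: "bilin V W X \<beta>"
  shows "is_space (tensor_space V W)"
    and "bilin V W (tensor_space V W) (tens V W)"
    and "lin (tensor_space V W) X (lift V W \<beta>)"
    and "\<And>v w. v \<in> carrier V \<Longrightarrow> w \<in> carrier W \<Longrightarrow> lift V W \<beta> (tens V W v w) = \<beta> v w"
    and "\<And>f t. lin (tensor_space V W) X f \<Longrightarrow>
      (\<And>v w. v \<in> carrier V \<Longrightarrow> w \<in> carrier W \<Longrightarrow> f (tens V W v w) = \<beta> v w) \<Longrightarrow>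
      t \<in> carrier (tensor_space V W) \<Longrightarrow> f t = lift V W \<beta> t"
proof -
  interpret T: vector_space "\<lambda>(c::'k) (t::('k,'a,'b) tensor) \<beta>. c * t \<beta>" by (rule vs_tensor)
  interpret V: vector_space "smul V" using V by (simp add: is_space_def)
  interpret X: vector_space "smul X" using X by (simp add: is_space_def)
  have cV: "V.subspace (carrier V)" and cX: "X.subspace (carrier X)"
    using V X by (auto simp: is_space_def)
  note iff = carrier_tensor_iff[OF V, of _ W]
  show sp: "is_space (tensor_space V W)"
    by (simp add: is_space_def tensor_space_def vs_tensor T.subspace_span)
  have base: "tens V W v w \<in> carrier (tensor_space V W)" if "v \<in> carrier V" "w \<in> carrier W" for v w
    using that by (auto simp: tensor_space_def intro!: T.span_base)
  show "bilin V W (tensor_space V W) (tens V W)"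
    unfolding bilin_def
    by (auto simp: lin_def base) 
       (auto simp: fun_eq_iff tens_def tensor_space_def bilin_def lin_def field_space_def)
  show pure: "lift V W \<beta> (tens V W v w) = \<beta> v w" if "v \<in> carrier V" "w \<in> carrier W" for v w
    using lift_eqI[OF X \<beta>, of "[(v, w)]"] that by simp
  have bc: "\<beta> v w \<in> carrier X" "smul V c v \<in> carrier V" "\<beta> (smul V c v) w = smul X c (\<beta> v w)"
    "tens V W (smul V c v) w = (\<lambda>\<gamma>. c * tens V W v w \<gamma>)"
    if "v \<in> carrier V" "w \<in> carrier W" for v w c
    using that \<beta> V.subspace_scale[OF cV]
    by (auto simp: bilin_def lin_def tens_def fun_eq_iff field_space_def)
  have rep: "\<exists>ps. set ps \<subseteq> carrier V \<times> carrier W \<and> t = (\<Sum>(v, w)\<leftarrow>ps. tens V W v w) \<and>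
      lift V W \<beta> t = (\<Sum>(v, w)\<leftarrow>ps. \<beta> v w)" if "t \<in> carrier (tensor_space V W)" for t
    using that lift_eqI[OF X \<beta>] unfolding iff by blast
  have sumX: "(\<Sum>(v, w)\<leftarrow>ps. \<beta> v w) \<in> carrier X" if "set ps \<subseteq> carrier V \<times> carrier W" for ps
    using that by (induction ps) (auto intro!: X.subspace_add[OF cX] X.subspace_0[OF cX] simp: bc)
  show "lin (tensor_space V W) X (lift V W \<beta>)"
    unfolding lin_def
  proof (intro conjI ballI allI)
    fix s t assume s: "s \<in> carrier (tensor_space V W)"
    from rep[OF s] obtain ps where ps: "set ps \<subseteq> carrier V \<times> carrier W"
      "s = (\<Sum>(v, w)\<leftarrow>ps. tens V W v w)" "lift V W \<beta> s = (\<Sum>(v, w)\<leftarrow>ps. \<beta> v w)" by blast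
    show "lift V W \<beta> s \<in> carrier X" using ps sumX by simp
    { assume t: "t \<in> carrier (tensor_space V W)"
      from rep[OF t] obtain qs where qs: "set qs \<subseteq> carrier V \<times> carrier W"
        "t = (\<Sum>(v, w)\<leftarrow>qs. tens V W v w)" "lift V W \<beta> t = (\<Sum>(v, w)\<leftarrow>qs. \<beta> v w)" by blast
      show "lift V W \<beta> (s + t) = lift V W \<beta> s + lift V W \<beta> t"
        using ps qs lift_eqI[OF X \<beta>, of "ps @ qs" "s + t"] by simp }
    fix c
    let ?qs = "map (\<lambda>(v, w). (smul V c v, w)) ps"
    have "smul (tensor_space V W) c s = (\<Sum>(v, w)\<leftarrow>?qs. tens V W v w)"
      unfolding ps(2) using ps(1)
      by (induction ps) (auto simp: tensor_space_def bc fun_eq_iff distrib_left split: prod.splits)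
    moreover have "set ?qs \<subseteq> carrier V \<times> carrier W" using ps(1) bc(2) by auto
    moreover have "(\<Sum>(v, w)\<leftarrow>?qs. \<beta> v w) = smul X c (\<Sum>(v, w)\<leftarrow>ps. \<beta> v w)"
      using ps(1) by (induction ps) (auto simp: bc X.scale_right_distrib)
    ultimately show "lift V W \<beta> (smul (tensor_space V W) c s) = smul X c (lift V W \<beta> s)"
      using lift_eqI[OF X \<beta>] ps(3) by metis
  qed
  show "f t = lift V W \<beta> t"
    if f: "lin (tensor_space V W) X f"
      and fp: "\<And>v w. v \<in> carrier V \<Longrightarrow> w \<in> carrier W \<Longrightarrow> f (tens V W v w) = \<beta> v w"
      and t: "t \<in> carrier (tensor_space V W)" for f t
  proof -
    have z: "f 0 = 0"
    proof -
      have "0 \<in> carrier (tensor_space V W)" by (simp add: tensor_space_def T.span_zero)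
      then have "f (0 + 0) = f 0 + f 0" using f unfolding lin_def by blast
      then show ?thesis by simp
    qed
    have "f (\<Sum>(v, w)\<leftarrow>ps. tens V W v w) = (\<Sum>(v, w)\<leftarrow>ps. \<beta> v w)"
      if "set ps \<subseteq> carrier V \<times> carrier W" for ps
      using that
    proof (induction ps)
      case (Cons p ps)
      obtain v w where p: "p = (v, w)" by force
      have "(\<Sum>(v, w)\<leftarrow>ps. tens V W v w) \<in> carrier (tensor_space V W)" using Cons.prems iff by auto
      then have "f (tens V W v w + (\<Sum>(v, w)\<leftarrow>ps. tens V W v w)) =
          f (tens V W v w) + f (\<Sum>(v, w)\<leftarrow>ps. tens V W v w)"
        using Cons.prems p f base unfolding lin_def by auto
      then show ?case using Cons p fp by (simp add: plus_fun_def)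
    qed (simp add: z)
    then show ?thesis using rep[OF t] by metis
  qed
qed


section \<open>Hopf algebras\<close>

record ('k, 'a) alg = "('k, 'a) space" +
  mult :: "'a \<Rightarrow> 'a \<Rightarrow> 'a"
  one :: "'a"

record ('k, 'a) hopf = "('k, 'a) alg" +
  comult :: "'a \<Rightarrow> ('k, 'a, 'a) tensor"
  counit :: "'a \<Rightarrow> 'k"
  antipode :: "'a \<Rightarrow> 'a"

definition algebra :: "('k::field, 'a::ab_group_add, 'x) alg_scheme \<Rightarrow> bool" where
  "algebra A \<longleftrightarrow> is_space A \<and> bilin A A A (mult A) \<and> one A \<in> carrier A \<and>
     (\<forall>a\<in>carrier A. \<forall>b\<in>carrier A. \<forall>c\<in>carrier A. mult A (mult A a b) c = mult A a (mult A b c)) \<and>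
     (\<forall>a\<in>carrier A. mult A (one A) a = a \<and> mult A a (one A) = a)"

definition tensor_mult :: "('k::field, 'a::ab_group_add, 'x) alg_scheme \<Rightarrow>
    ('k, 'b::ab_group_add, 'y) alg_scheme \<Rightarrow>
    ('k, 'a, 'b) tensor \<Rightarrow> ('k, 'a, 'b) tensor \<Rightarrow> ('k, 'a, 'b) tensor" where
  "tensor_mult A B s t =
     lift A B (\<lambda>a b. lift A B (\<lambda>a' b'. tens A B (mult A a a') (mult B b b')) t) s"

text \<open>Sweedler notation: \<open>sw2 A \<beta> a\<close> is the sum of the \<open>\<beta> a\<^sub>1 a\<^sub>2\<close>, and \<open>sw3\<close> likewise.\<close>

definition sw2 :: "('k::field, 'a::ab_group_add, 'x) hopf_scheme \<Rightarrow>
    ('a \<Rightarrow> 'a \<Rightarrow> 'b::ab_group_add) \<Rightarrow> 'a \<Rightarrow> 'b" where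
  "sw2 A \<beta> a = lift A A \<beta> (comult A a)"

definition sw3 :: "('k::field, 'a::ab_group_add, 'x) hopf_scheme \<Rightarrow>
    ('a \<Rightarrow> 'a \<Rightarrow> 'a \<Rightarrow> 'b::ab_group_add) \<Rightarrow> 'a \<Rightarrow> 'b" where
  "sw3 A \<gamma> a = sw2 A (\<lambda>a1 b. sw2 A (\<lambda>a2 a3. \<gamma> a1 a2 a3) b) a"

definition coalgebra :: "('k::field, 'a::ab_group_add, 'x) hopf_scheme \<Rightarrow> bool" where
  "coalgebra A \<longleftrightarrow> is_space A \<and>
     lin A (tensor_space A A) (comult A) \<and> lin A field_space (counit A) \<and>
     (\<forall>a\<in>carrier A.
        tassoc A A A (tmap A A (tensor_space A A) A (comult A) id (comult A a)) =
        tmap A A A (tensor_space A A) id (comult A) (comult A a)) \<and>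
     (\<forall>a\<in>carrier A. sw2 A (\<lambda>a1 a2. smul A (counit A a1) a2) a = a \<and>
                    sw2 A (\<lambda>a1 a2. smul A (counit A a2) a1) a = a)"

definition hopf_algebra :: "('k::field, 'a::ab_group_add, 'x) hopf_scheme \<Rightarrow> bool" where
  "hopf_algebra A \<longleftrightarrow> algebra A \<and> coalgebra A \<and>
     (\<forall>a\<in>carrier A. \<forall>b\<in>carrier A.
        comult A (mult A a b) = tensor_mult A A (comult A a) (comult A b) \<and>
        counit A (mult A a b) = counit A a * counit A b) \<and>
     comult A (one A) = tens A A (one A) (one A) \<and> counit A (one A) = 1 \<and>
     lin A A (antipode A) \<and>
     (\<forall>a\<in>carrier A.
        sw2 A (\<lambda>a1 a2. mult A (antipode A a1) a2) a = smul A (counit A a) (one A) \<and>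
        sw2 A (\<lambda>a1 a2. mult A a1 (antipode A a2)) a = smul A (counit A a) (one A))"

text \<open>\<open>A\<^sup>o\<^sup>p\<close> has the opposite multiplication, the same comultiplication and the inverse antipode.\<close>

definition op_hopf :: "('k::field, 'a::ab_group_add) hopf \<Rightarrow> ('k, 'a) hopf" where
  "op_hopf A = A\<lparr>mult := (\<lambda>a b. mult A b a), antipode := inv_into (carrier A) (antipode A)\<rparr>"

definition op_alg :: "('k::field, 'a::ab_group_add, 'x) alg_scheme \<Rightarrow> ('k, 'a) alg" where
  "op_alg A = \<lparr>carrier = carrier A, smul = smul A, mult = (\<lambda>a b. mult A b a), one = one A\<rparr>"

definition tensor_alg :: "('k::field, 'a::ab_group_add, 'x) alg_scheme \<Rightarrow>
    ('k, 'b::ab_group_add, 'y) alg_scheme \<Rightarrow> ('k, ('k, 'a, 'b) tensor) alg" where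
  "tensor_alg A B =
     \<lparr>carrier = carrier (tensor_space A B), smul = smul (tensor_space A B),
      mult = tensor_mult A B, one = tens A B (one A) (one B)\<rparr>"

definition tensor_hopf :: "('k::field, 'a::ab_group_add, 'x) hopf_scheme \<Rightarrow>
    ('k, 'b::ab_group_add, 'y) hopf_scheme \<Rightarrow> ('k, ('k, 'a, 'b) tensor) hopf" where
  "tensor_hopf A B =
     \<lparr>carrier = carrier (tensor_space A B), smul = smul (tensor_space A B),
      mult = tensor_mult A B, one = tens A B (one A) (one B),
      comult = lift A B (\<lambda>a b. sw2 A (\<lambda>a1 a2. sw2 B (\<lambda>b1 b2.
        tens (tensor_space A B) (tensor_space A B) (tens A B a1 b1) (tens A B a2 b2)) b) a),
      counit = lift A B (\<lambda>a b. counit A a * counit B b),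
      antipode = tmap A B A B (antipode A) (antipode B)\<rparr>"

text \<open>
  Functionals on \<open>carrier H\<close> are represented by functions vanishing outside \<open>carrier H\<close>, so that
  they form a subspace of \<open>'a \<Rightarrow> 'k\<close>. The comultiplication of \<open>p\<close> is the element with
  \<open>\<Sum> p\<^sub>1(h) p\<^sub>2(h') = p(h h')\<close>, which exists for finite dimensional \<open>H\<close>.
\<close>

definition dual_space :: "('k::field, 'a::ab_group_add, 'x) space_scheme \<Rightarrow> ('k, 'a \<Rightarrow> 'k) space" where
  "dual_space V = \<lparr>carrier = {p. lin V field_space p \<and> (\<forall>x. x \<notin> carrier V \<longrightarrow> p x = 0)},
                   smul = (\<lambda>c p x. c * p x)\<rparr>"

definition dual_hopf :: "('k::field, 'a::ab_group_add, 'x) hopf_scheme \<Rightarrow> ('k, 'a \<Rightarrow> 'k) hopf" where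
  "dual_hopf H =
     \<lparr>carrier = carrier (dual_space H), smul = smul (dual_space H),
      mult = (\<lambda>p q h. if h \<in> carrier H then sw2 H (\<lambda>h1 h2. p h1 * q h2) h else 0),
      one = (\<lambda>h. if h \<in> carrier H then counit H h else 0),
      comult = (\<lambda>p. THE t. t \<in> carrier (tensor_space (dual_space H) (dual_space H)) \<and>
        (\<forall>h\<in>carrier H. \<forall>h'\<in>carrier H.
           lift (dual_space H) (dual_space H) (\<lambda>p1 p2. p1 h * p2 h') t = p (mult H h h'))),
      counit = (\<lambda>p. p (one H)),
      antipode = (\<lambda>p h. if h \<in> carrier H then p (antipode H h) else 0)\<rparr>"


section \<open>Diagonal crossed products and the algebra \<open>Z\<close>\<close>

text \<open>\<open>la\<close> and \<open>ra\<close> are the left and right actions making \<open>C\<close> a \<open>K\<close>-bimodule algebra.\<close>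

definition diag_crossed :: "('k::field, 'a::ab_group_add) hopf \<Rightarrow> ('k, 'c::ab_group_add) alg \<Rightarrow>
    ('a \<Rightarrow> 'c \<Rightarrow> 'c) \<Rightarrow> ('c \<Rightarrow> 'a \<Rightarrow> 'c) \<Rightarrow> ('k, ('k, 'c, 'a) tensor) alg" where
  "diag_crossed K C la ra =
     \<lparr>carrier = carrier (tensor_space C K), smul = smul (tensor_space C K),
      mult = (\<lambda>u v. lift C K (\<lambda>c x. lift C K (\<lambda>c' x'.
        sw3 K (\<lambda>x1 x2 x3.
          tens C K (mult C c (ra (la x1 c') (inv_into (carrier K) (antipode K) x3))) (mult K x2 x')) x) v) u),
      one = tens C K (one C) (one K)\<rparr>"

definition lreg :: "('k::field, 'a::ab_group_add, 'x) hopf_scheme \<Rightarrow> 'a \<Rightarrow> ('a \<Rightarrow> 'k) \<Rightarrow> ('a \<Rightarrow> 'k)" where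
  "lreg H h f = (\<lambda>x. if x \<in> carrier H then f (mult H x h) else 0)"

definition rreg :: "('k::field, 'a::ab_group_add, 'x) hopf_scheme \<Rightarrow> ('a \<Rightarrow> 'k) \<Rightarrow> 'a \<Rightarrow> ('a \<Rightarrow> 'k)" where
  "rreg H f h = (\<lambda>x. if x \<in> carrier H then f (mult H h x) else 0)"

abbreviation Z_K :: "('k::field, 'a::ab_group_add) hopf \<Rightarrow> ('k, ('k, 'a, 'a) tensor) hopf" where
  "Z_K H \<equiv> tensor_hopf H (op_hopf H)"

abbreviation Z_C :: "('k::field, 'a::ab_group_add) hopf \<Rightarrow> ('k, ('k, 'a \<Rightarrow> 'k, 'a \<Rightarrow> 'k) tensor) alg" where
  "Z_C H \<equiv> tensor_alg (dual_hopf H) (op_alg (dual_hopf H))"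

definition Z_lact :: "('k::field, 'a::ab_group_add) hopf \<Rightarrow> ('k, 'a, 'a) tensor \<Rightarrow>
    ('k, 'a \<Rightarrow> 'k, 'a \<Rightarrow> 'k) tensor \<Rightarrow> ('k, 'a \<Rightarrow> 'k, 'a \<Rightarrow> 'k) tensor" where
  "Z_lact H x = tmap (dual_hopf H) (dual_hopf H) (dual_hopf H) (dual_hopf H)
     (\<lambda>p. lift H H (\<lambda>h h'. rreg H (lreg H h p) h') x) id"

definition Z_ract :: "('k::field, 'a::ab_group_add) hopf \<Rightarrow> ('k, 'a \<Rightarrow> 'k, 'a \<Rightarrow> 'k) tensor \<Rightarrow>
    ('k, 'a, 'a) tensor \<Rightarrow> ('k, 'a \<Rightarrow> 'k, 'a \<Rightarrow> 'k) tensor" where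
  "Z_ract H c y = tmap (dual_hopf H) (dual_hopf H) (dual_hopf H) (dual_hopf H) id
     (\<lambda>q. lift H H (\<lambda>h h'. rreg H (lreg H (antipode H h) q)
                             (inv_into (carrier H) (antipode H) h')) y) c"

definition Z_alg :: "('k::field, 'a::ab_group_add) hopf \<Rightarrow>
    ('k, ('k, ('k, 'a \<Rightarrow> 'k, 'a \<Rightarrow> 'k) tensor, ('k, 'a, 'a) tensor) tensor) alg" where
  "Z_alg H = diag_crossed (Z_K H) (Z_C H) (Z_lact H) (Z_ract H)"

text \<open>\<open>Z_elem H p q h g\<close> is \<open>(p \<otimes> q) \<bowtie> (h \<otimes> g)\<close>.\<close>

definition Z_elem :: "('k::field, 'a::ab_group_add) hopf \<Rightarrow> ('a \<Rightarrow> 'k) \<Rightarrow> ('a \<Rightarrow> 'k) \<Rightarrow> 'a \<Rightarrow> 'a \<Rightarrow>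
    ('k, ('k, 'a \<Rightarrow> 'k, 'a \<Rightarrow> 'k) tensor, ('k, 'a, 'a) tensor) tensor" where
  "Z_elem H p q h g = tens (Z_C H) (Z_K H) (tens (dual_hopf H) (dual_hopf H) p q) (tens H H h g)"


section \<open>Categories\<close>

record ('o, 'f) category =
  Obj :: "'o set"
  Hom :: "'o \<Rightarrow> 'o \<Rightarrow> 'f set"
  Idm :: "'o \<Rightarrow> 'f"
  Comp :: "'o \<Rightarrow> 'o \<Rightarrow> 'o \<Rightarrow> 'f \<Rightarrow> 'f \<Rightarrow> 'f"

text \<open>\<open>Comp C L M N g f\<close> is the composite of \<open>f \<in> Hom C L M\<close> and \<open>g \<in> Hom C M N\<close>.\<close>

definition is_category :: "('o, 'f) category \<Rightarrow> bool" where
  "is_category C \<longleftrightarrow>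
     (\<forall>M\<in>Obj C. Idm C M \<in> Hom C M M) \<and>
     (\<forall>L\<in>Obj C. \<forall>M\<in>Obj C. \<forall>N\<in>Obj C. \<forall>f\<in>Hom C L M. \<forall>g\<in>Hom C M N.
        Comp C L M N g f \<in> Hom C L N) \<and>
     (\<forall>M\<in>Obj C. \<forall>N\<in>Obj C. \<forall>f\<in>Hom C M N.
        Comp C M M N f (Idm C M) = f \<and> Comp C M N N (Idm C N) f = f) \<and>
     (\<forall>K\<in>Obj C. \<forall>L\<in>Obj C. \<forall>M\<in>Obj C. \<forall>N\<in>Obj C. \<forall>f\<in>Hom C K L. \<forall>g\<in>Hom C L M. \<forall>h\<in>Hom C M N.
        Comp C K M N h (Comp C K L M g f) = Comp C K L N (Comp C L M N h g) f)"

definition category_iso :: "('o, 'f) category \<Rightarrow> ('p, 'g) category \<Rightarrow>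
    ('o \<Rightarrow> 'p) \<Rightarrow> ('o \<Rightarrow> 'o \<Rightarrow> 'f \<Rightarrow> 'g) \<Rightarrow> bool" where
  "category_iso C D Fo Fm \<longleftrightarrow> is_category C \<and> is_category D \<and>
     bij_betw Fo (Obj C) (Obj D) \<and>
     (\<forall>M\<in>Obj C. \<forall>N\<in>Obj C. bij_betw (Fm M N) (Hom C M N) (Hom D (Fo M) (Fo N))) \<and>
     (\<forall>M\<in>Obj C. Fm M M (Idm C M) = Idm D (Fo M)) \<and>
     (\<forall>L\<in>Obj C. \<forall>M\<in>Obj C. \<forall>N\<in>Obj C. \<forall>f\<in>Hom C L M. \<forall>g\<in>Hom C M N.
        Fm L N (Comp C L M N g f) = Comp D (Fo L) (Fo M) (Fo N) (Fm M N g) (Fm L M f))"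


section \<open>Left modules\<close>

text \<open>
  Here and below, structure maps and morphisms are required to be \<open>extensional\<close>, i.e. \<open>undefined\<close>
  outside the relevant carriers, so that equality of objects and of morphisms in the categories
  is equality on carriers.
\<close>

record ('k, 'a, 'm) left_module = "('k, 'm) space" +
  act :: "'a \<Rightarrow> 'm \<Rightarrow> 'm"

definition is_left_module :: "('k::field, 'a::ab_group_add, 'x) alg_scheme \<Rightarrow>
    ('k, 'a, 'm::ab_group_add) left_module \<Rightarrow> bool" where
  "is_left_module A M \<longleftrightarrow> is_space M \<and> bilin A M M (act M) \<and>
     case_prod (act M) \<in> extensional (carrier A \<times> carrier M) \<and>
     (\<forall>m\<in>carrier M. act M (one A) m = m) \<and>
     (\<forall>a\<in>carrier A. \<forall>b\<in>carrier A. \<forall>m\<in>carrier M. act M (mult A a b) m = act M a (act M b m))"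

definition left_module_hom :: "('k::field, 'a::ab_group_add, 'x) alg_scheme \<Rightarrow>
    ('k, 'a, 'm::ab_group_add) left_module \<Rightarrow> ('k, 'a, 'm) left_module \<Rightarrow> ('m \<Rightarrow> 'm) set" where
  "left_module_hom A M N = {f. f \<in> extensional (carrier M) \<and> lin M N f \<and>
     (\<forall>a\<in>carrier A. \<forall>m\<in>carrier M. f (act M a m) = act N a (f m))}"

definition left_module_cat :: "('k::field, 'a::ab_group_add, 'x) alg_scheme \<Rightarrow>
    (('k, 'a, 'm::ab_group_add) left_module, 'm \<Rightarrow> 'm) category" where
  "left_module_cat A =
     \<lparr>Obj = Collect (is_left_module A), Hom = left_module_hom A,
      Idm = (\<lambda>M. restrict id (carrier M)),
      Comp = (\<lambda>L M N g f. compose (carrier L) g f)\<rparr>"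


section \<open>Hopf bimodules\<close>

record ('k, 'a, 'm) hopf_bimodule = "('k, 'm) space" +
  lact :: "'a \<Rightarrow> 'm \<Rightarrow> 'm"
  ract :: "'m \<Rightarrow> 'a \<Rightarrow> 'm"
  lcoact :: "'m \<Rightarrow> ('k, 'a, 'm) tensor"
  rcoact :: "'m \<Rightarrow> ('k, 'm, 'a) tensor"

definition is_bimodule :: "('k::field, 'a::ab_group_add, 'x) alg_scheme \<Rightarrow>
    ('k, 'a, 'm::ab_group_add) hopf_bimodule \<Rightarrow> bool" where
  "is_bimodule A M \<longleftrightarrow> is_space M \<and> bilin A M M (lact M) \<and> bilin M A M (ract M) \<and>
     case_prod (lact M) \<in> extensional (carrier A \<times> carrier M) \<and>
     case_prod (ract M) \<in> extensional (carrier M \<times> carrier A) \<and>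
     (\<forall>m\<in>carrier M. lact M (one A) m = m \<and> ract M m (one A) = m) \<and>
     (\<forall>a\<in>carrier A. \<forall>b\<in>carrier A. \<forall>m\<in>carrier M.
        lact M (mult A a b) m = lact M a (lact M b m) \<and>
        ract M m (mult A a b) = ract M (ract M m a) b \<and>
        ract M (lact M a m) b = lact M a (ract M m b))"

text \<open>The combined coaction \<open>m \<mapsto> \<Sum> m\<^sub>(\<^sub>-\<^sub>1\<^sub>) \<otimes> m\<^sub>(\<^sub>0\<^sub>) \<otimes> m\<^sub>(\<^sub>1\<^sub>)\<close>, and the Sweedler notation for it.\<close>

definition bicoact :: "('k::field, 'a::ab_group_add, 'x) hopf_scheme \<Rightarrow>
    ('k, 'a, 'm::ab_group_add) hopf_bimodule \<Rightarrow> 'm \<Rightarrow> ('k, 'a, ('k, 'm, 'a) tensor) tensor" where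
  "bicoact A M m = tmap A M A (tensor_space M A) id (rcoact M) (lcoact M m)"

definition bisw :: "('k::field, 'a::ab_group_add, 'x) hopf_scheme \<Rightarrow>
    ('k, 'a, 'm::ab_group_add) hopf_bimodule \<Rightarrow> ('a \<Rightarrow> 'm \<Rightarrow> 'a \<Rightarrow> 'b::ab_group_add) \<Rightarrow> 'm \<Rightarrow> 'b" where
  "bisw A M \<gamma> m = lift A (tensor_space M A) (\<lambda>a t. lift M A (\<lambda>m0 b. \<gamma> a m0 b) t) (bicoact A M m)"

definition is_bicomodule :: "('k::field, 'a::ab_group_add, 'x) hopf_scheme \<Rightarrow>
    ('k, 'a, 'm::ab_group_add) hopf_bimodule \<Rightarrow> bool" where
  "is_bicomodule A M \<longleftrightarrow> is_space M \<and>
     lin M (tensor_space A M) (lcoact M) \<and> lin M (tensor_space M A) (rcoact M) \<and>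
     lcoact M \<in> extensional (carrier M) \<and> rcoact M \<in> extensional (carrier M) \<and>
     (\<forall>m\<in>carrier M.
        tassoc A A M (tmap A M (tensor_space A A) M (comult A) id (lcoact M m)) =
          tmap A M A (tensor_space A M) id (lcoact M) (lcoact M m) \<and>
        tassoc M A A (tmap M A (tensor_space M A) A (rcoact M) id (rcoact M m)) =
          tmap M A M (tensor_space A A) id (comult A) (rcoact M m) \<and>
        tassoc A M A (tmap M A (tensor_space A M) A (lcoact M) id (rcoact M m)) =
          tmap A M A (tensor_space M A) id (rcoact M) (lcoact M m) \<and>
        lift A M (\<lambda>a m0. smul M (counit A a) m0) (lcoact M m) = m \<and>
        lift M A (\<lambda>m0 a. smul M (counit A a) m0) (rcoact M m) = m)"

definition is_hopf_bimodule :: "('k::field, 'a::ab_group_add, 'x) hopf_scheme \<Rightarrow>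
    ('k, 'a, 'm::ab_group_add) hopf_bimodule \<Rightarrow> bool" where
  "is_hopf_bimodule A M \<longleftrightarrow> is_bimodule A M \<and> is_bicomodule A M \<and>
     (\<forall>p\<in>carrier A. \<forall>q\<in>carrier A. \<forall>m\<in>carrier M.
        bicoact A M (ract M (lact M p m) q) =
          sw3 A (\<lambda>p1 p2 p3. sw3 A (\<lambda>q1 q2 q3. bisw A M (\<lambda>a m0 b.
            tens A (tensor_space M A) (mult A (mult A p1 a) q1)
              (tens M A (ract M (lact M p2 m0) q2) (mult A (mult A p3 b) q3))) m) q) p)"

definition hopf_bimodule_hom :: "('k::field, 'a::ab_group_add, 'x) hopf_scheme \<Rightarrow>
    ('k, 'a, 'm::ab_group_add) hopf_bimodule \<Rightarrow> ('k, 'a, 'm) hopf_bimodule \<Rightarrow> ('m \<Rightarrow> 'm) set" where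
  "hopf_bimodule_hom A M N = {f. f \<in> extensional (carrier M) \<and> lin M N f \<and>
     (\<forall>a\<in>carrier A. \<forall>m\<in>carrier M. f (lact M a m) = lact N a (f m) \<and> f (ract M m a) = ract N (f m) a) \<and>
     (\<forall>m\<in>carrier M. lcoact N (f m) = tmap A M A N id f (lcoact M m) \<and>
                    rcoact N (f m) = tmap M A N A f id (rcoact M m))}"

definition hopf_bimodule_cat :: "('k::field, 'a::ab_group_add, 'x) hopf_scheme \<Rightarrow>
    (('k, 'a, 'm::ab_group_add) hopf_bimodule, 'm \<Rightarrow> 'm) category" where
  "hopf_bimodule_cat A =
     \<lparr>Obj = Collect (is_hopf_bimodule A), Hom = hopf_bimodule_hom A,
      Idm = (\<lambda>M. restrict id (carrier M)),
      Comp = (\<lambda>L M N g f. compose (carrier L) g f)\<rparr>"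

end

theory Submission
  imports Defs
begin

text \<open>
  Let \<open>A\<close> be the dual of \<open>H\<close>. Since \<open>H\<close> is finite dimensional, an element of \<open>A \<otimes> M\<close> or \<open>M \<otimes> A\<close> is
  the same as a linear map \<open>H \<rightarrow> M\<close>, via evaluation of the factor in \<open>A\<close>. A left coaction thus
  becomes a right action \<open>m \<cdot> g = \<Sum> m\<^sub>(\<^sub>-\<^sub>1\<^sub>)(g) m\<^sub>(\<^sub>0\<^sub>)\<close> of \<open>H\<close>, a right coaction a left action
  \<open>h \<cdot> m = \<Sum> m\<^sub>(\<^sub>1\<^sub>)(h) m\<^sub>(\<^sub>0\<^sub>)\<close>, and evaluating the Hopf bimodule condition at \<open>(g, h)\<close> gives
  \<open>h \<cdot> (p \<cdot> m \<cdot> q) \<cdot> g = \<Sum> (h\<^sub>1 \<rightharpoonup> p \<leftharpoonup> g\<^sub>1) \<cdot> (h\<^sub>2 \<cdot> m \<cdot> g\<^sub>2) \<cdot> (h\<^sub>3 \<rightharpoonup> q \<leftharpoonup> g\<^sub>3)\<close>.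
  This is exactly the commutation rule in \<open>Z\<close> between the generators \<open>h \<otimes> g\<close> and \<open>p \<otimes> q\<close>, so both kinds
  of objects are \<open>A\<close>-bimodules and \<open>H\<close>-bimodules on the same space subject to this single rule.
\<close>

subsection \<open>Linear maps\<close>

text \<open>An identity between tensors with \<open>A\<close>-legs is tested by evaluating those
  legs at points of \<open>H\<close>. This is faithful because finitely many such evaluations form a
  dual basis of \<open>A\<close>, and every linear map from \<open>H\<close> is hit. Coactions are
  therefore recovered exactly from the actions; together with extensionality this gives a bijection
  on objects, not merely an equivalence.

  Coproducts are handled in two ways. In \<open>H\<close> one representative of each coproduct is
  fixed, so Sweedler expressions become finite sums that can be interchanged, and the Hopf bimodule
  condition and the product of \<open>Z\<close> both arrive at literally the same sum. In
  \<open>A\<close> the coproduct is contracted instead: evaluating the outer legs of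
  \<open>p\<close> at \<open>g\<close> and \<open>h\<close> leaves h \<rightharpoonup> p
  \<leftharpoonup> g.

  The antipode enters the product of \<open>Z\<close> twice, as the inverse antipode of
  \<open>K\<close> on the third leg and inside the right action of \<open>K\<close> on
  \<open>C\<close>. The two occurrences cancel, which is why h and g themselves act on q in the rule
  above.\<close>

lemma is_space_vector_space: "is_space V \<Longrightarrow> vector_space (smul V)"
  by (simp add: is_space_def)

lemma
  assumes "is_space V"
  shows space_zero: "0 \<in> carrier V"
    and space_add: "x \<in> carrier V \<Longrightarrow> y \<in> carrier V \<Longrightarrow> x + y \<in> carrier V"
    and space_smul: "x \<in> carrier V \<Longrightarrow> smul V c x \<in> carrier V"
proof -
  interpret V: vector_space "smul V" using assms by (rule is_space_vector_space)
  have s: "V.subspace (carrier V)" using assms by (simp add: is_space_def)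
  show "0 \<in> carrier V" by (rule V.subspace_0[OF s])
  show "x \<in> carrier V \<Longrightarrow> y \<in> carrier V \<Longrightarrow> x + y \<in> carrier V" by (rule V.subspace_add[OF s])
  show "x \<in> carrier V \<Longrightarrow> smul V c x \<in> carrier V" by (rule V.subspace_scale[OF s])
qed

lemma
  assumes "is_space V"
  shows smul_add_right: "smul V c (x + y) = smul V c x + smul V c y"
    and smul_add_left: "smul V (c + d) x = smul V c x + smul V d x"
    and smul_smul: "smul V c (smul V d x) = smul V (c * d) x"
    and smul_zero_right: "smul V c 0 = 0"
proof -
  interpret V: vector_space "smul V" using assms by (rule is_space_vector_space)
  show "smul V c (x + y) = smul V c x + smul V c y" "smul V (c + d) x = smul V c x + smul V d x"
    "smul V c (smul V d x) = smul V (c * d) x" "smul V c 0 = 0"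
    by (simp_all add: V.scale_right_distrib V.scale_left_distrib)
qed

lemma space_sum:
  assumes "is_space V" "\<And>i. i \<in> I \<Longrightarrow> f i \<in> carrier V"
  shows "sum f I \<in> carrier V"
  using assms(2) by (induction I rule: infinite_finite_induct)
    (auto intro: space_zero space_add assms(1))

lemma is_space_field [simp]: "is_space field_space"
  unfolding is_space_def field_space_def
  by (auto simp: vector_space_def module.subspace_def module_def algebra_simps)

lemma field_space_simps [simp]: "carrier field_space = UNIV" "smul field_space = (*)"
  by (simp_all add: field_space_def)

lemma
  assumes "lin V W f"
  shows lin_closed: "x \<in> carrier V \<Longrightarrow> f x \<in> carrier W"
    and lin_add: "x \<in> carrier V \<Longrightarrow> y \<in> carrier V \<Longrightarrow> f (x + y) = f x + f y"
    and lin_smul: "x \<in> carrier V \<Longrightarrow> f (smul V c x) = smul W c (f x)"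
  using assms unfolding lin_def by auto

lemma linI:
  assumes "\<And>x. x \<in> carrier V \<Longrightarrow> f x \<in> carrier W"
    and "\<And>x y. x \<in> carrier V \<Longrightarrow> y \<in> carrier V \<Longrightarrow> f (x + y) = f x + f y"
    and "\<And>c x. x \<in> carrier V \<Longrightarrow> f (smul V c x) = smul W c (f x)"
  shows "lin V W f"
  using assms unfolding lin_def by auto

lemma lin_zero:
  assumes "is_space V" "lin V W f"
  shows "f 0 = 0"
  using lin_add[OF assms(2) space_zero[OF assms(1)] space_zero[OF assms(1)]] by simp

lemma lin_sum:
  assumes V: "is_space V" and f: "lin V W f" and g: "\<And>i. i \<in> I \<Longrightarrow> g i \<in> carrier V"
  shows "f (\<Sum>i\<in>I. g i) = (\<Sum>i\<in>I. f (g i))"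
  using g
proof (induction I rule: infinite_finite_induct)
  case (insert i I)
  then show ?case by (simp add: lin_add[OF f] space_sum[OF V])
qed (simp_all add: lin_zero[OF V f])

lemma lin_cong:
  assumes "lin V W f" "is_space V" "\<And>x. x \<in> carrier V \<Longrightarrow> f x = g x"
  shows "lin V W g"
  using assms by (auto simp: lin_def space_add space_smul)

text \<open>Linearity, and below bilinearity and the tensor constructions, read only the carrier and
  the scalars of a record. Transfer along this replaces opposite algebras,
  \<open>dual_space H\<close> and converted modules or bimodules by one common space.\<close>

lemma lin_eq_space:
  assumes "carrier V = carrier V'" "smul V = smul V'" "carrier W = carrier W'" "smul W = smul W'"
  shows "lin V W = lin V' W'"
  using assms by (auto simp: lin_def fun_eq_iff)

lemma bilin_eq_space:
  assumes "carrier V = carrier V'" "smul V = smul V'" "carrier W = carrier W'" "smul W = smul W'"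
    "carrier X = carrier X'" "smul X = smul X'"
  shows "bilin V W X = bilin V' W' X'"
  using lin_eq_space[OF assms(1,2,5,6)] lin_eq_space[OF assms(3-6)] assms
  by (simp add: bilin_def fun_eq_iff)

lemma tens_eq_space:
  assumes "carrier V = carrier V'" "smul V = smul V'" "carrier W = carrier W'" "smul W = smul W'"
  shows "tens V W = tens V' W'"
  using bilin_eq_space[OF assms, of field_space field_space]
  by (simp add: tens_def fun_eq_iff)

lemma tensor_space_eq_space:
  assumes "carrier V = carrier V'" "smul V = smul V'" "carrier W = carrier W'" "smul W = smul W'"
  shows "tensor_space V W = tensor_space V' W'"
  using tens_eq_space[OF assms] assms by (simp add: tensor_space_def)

lemma lift_eq_space:
  assumes "carrier V = carrier V'" "smul V = smul V'" "carrier W = carrier W'" "smul W = smul W'"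
  shows "lift V W = lift V' W'"
  unfolding lift_def tens_eq_space[OF assms] assms(1,3) ..

lemma bilinI:
  assumes "\<And>w. w \<in> carrier W \<Longrightarrow> lin V X (\<lambda>v. \<beta> v w)"
    and "\<And>v. v \<in> carrier V \<Longrightarrow> lin W X (\<lambda>w. \<beta> v w)"
  shows "bilin V W X \<beta>"
  using assms by (simp add: bilin_def)

lemma bilin_lin_left: "bilin V W X \<beta> \<Longrightarrow> w \<in> carrier W \<Longrightarrow> lin V X (\<lambda>v. \<beta> v w)"
  and bilin_lin_right: "bilin V W X \<beta> \<Longrightarrow> v \<in> carrier V \<Longrightarrow> lin W X (\<beta> v)"
  by (simp_all add: bilin_def)

lemma bilin_closed:
  "bilin V W X \<beta> \<Longrightarrow> v \<in> carrier V \<Longrightarrow> w \<in> carrier W \<Longrightarrow> \<beta> v w \<in> carrier X"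
  by (simp add: bilin_def lin_def)

lemma bilin_cong:
  assumes "bilin U V W \<beta>" "is_space U" "is_space V"
    and "\<And>u v. u \<in> carrier U \<Longrightarrow> v \<in> carrier V \<Longrightarrow> \<beta> u v = \<beta>' u v"
  shows "bilin U V W \<beta>'"
proof (rule bilinI)
  show "lin U W (\<lambda>v. \<beta>' v w)" if "w \<in> carrier V" for w
    by (rule lin_cong[OF bilin_lin_left[OF assms(1) that] assms(2)]) (simp add: assms(4) that)
  show "lin V W (\<lambda>w. \<beta>' v w)" if "v \<in> carrier U" for v
    by (rule lin_cong[OF bilin_lin_right[OF assms(1) that] assms(3)]) (simp add: assms(4) that)
qed

lemma lin_id: "lin V V (\<lambda>x. x)"
  by (simp add: lin_def)

lemma lin_identity: "lin V V id"
  by (simp add: id_def lin_id)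

lemma lin_comp: "lin V W f \<Longrightarrow> lin U V g \<Longrightarrow> lin U W (\<lambda>x. f (g x))"
  by (simp add: lin_def)

lemma bilin_comp_left: "bilin V W X \<beta> \<Longrightarrow> w \<in> carrier W \<Longrightarrow> lin U V f \<Longrightarrow> lin U X (\<lambda>x. \<beta> (f x) w)"
  by (simp add: bilin_def lin_def)

lemma bilin_comp_right: "bilin V W X \<beta> \<Longrightarrow> v \<in> carrier V \<Longrightarrow> lin U W f \<Longrightarrow> lin U X (\<lambda>x. \<beta> v (f x))"
  by (simp_all add: bilin_def lin_def)

lemma lin_smul_right:
  assumes "is_space V" "lin U V f"
  shows "lin U V (\<lambda>x. smul V c (f x))"
  using assms by (auto simp: lin_def smul_add_right smul_smul mult.commute intro: space_smul)

lemma lin_smul_left: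
  assumes "is_space V" "lin U field_space f" "v \<in> carrier V"
  shows "lin U V (\<lambda>x. smul V (f x) v)"
  using assms by (auto simp: lin_def smul_add_left smul_smul intro: space_smul)

lemma lin_field_mult_left: "lin U field_space f \<Longrightarrow> lin U field_space (\<lambda>x. f x * c)"
  and lin_field_mult_right: "lin U field_space f \<Longrightarrow> lin U field_space (\<lambda>x. c * f x)"
  by (auto simp: lin_def algebra_simps)

subsection \<open>Tensor products\<close>

lemma bilin_zero: "is_space X \<Longrightarrow> bilin V W X (\<lambda>_ _. 0)"
  by (simp add: bilin_def lin_def space_zero smul_zero_right)

context
  fixes V :: "('k::field, 'a::ab_group_add, 'x) space_scheme"
    and W :: "('k, 'b::ab_group_add, 'y) space_scheme"
  assumes V: "is_space V" and W: "is_space W"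
begin

lemma is_space_tensor: "is_space (tensor_space V W)"
  and bilin_tens: "bilin V W (tensor_space V W) (tens V W)"
  \<comment> \<open>The zero form is a filler for the bilinear map; the first two conclusions of
    \<open>tensor_universal\<close> do not mention it.\<close>
  using tensor_universal[OF V W is_space_field bilin_zero[OF is_space_field]] by auto

lemma tens_closed:
  "v \<in> carrier V \<Longrightarrow> w \<in> carrier W \<Longrightarrow> tens V W v w \<in> carrier (tensor_space V W)"
  by (rule bilin_closed[OF bilin_tens])

lemma lin_tens_left:
  "lin U V f \<Longrightarrow> w \<in> carrier W \<Longrightarrow> lin U (tensor_space V W) (\<lambda>u. tens V W (f u) w)"
  by (rule bilin_comp_left[OF bilin_tens])

lemma lin_tens_right:
  "lin U W f \<Longrightarrow> v \<in> carrier V \<Longrightarrow> lin U (tensor_space V W) (\<lambda>u. tens V W v (f u))"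
  by (rule bilin_comp_right[OF bilin_tens])

text \<open>Scalars get no case of their own: they are absorbed into the left factor of a pure
  tensor, so every tensor is a plain sum of pure ones.\<close>

lemma tensor_induct [consumes 1, case_names zero add tens]:
  assumes t: "t \<in> carrier (tensor_space V W)" and z: "P 0"
    and a: "\<And>s t. s \<in> carrier (tensor_space V W) \<Longrightarrow> t \<in> carrier (tensor_space V W) \<Longrightarrow>
      P s \<Longrightarrow> P t \<Longrightarrow> P (s + t)"
    and p: "\<And>v w. v \<in> carrier V \<Longrightarrow> w \<in> carrier W \<Longrightarrow> P (tens V W v w)"
  shows "P t"
proof -
  obtain ps where ps: "set ps \<subseteq> carrier V \<times> carrier W" "t = (\<Sum>(v, w)\<leftarrow>ps. tens V W v w)"
    using t carrier_tensor_iff[OF V] by blast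
  have "P (\<Sum>(v, w)\<leftarrow>ps. tens V W v w)"
    using ps(1)
  proof (induction ps)
    case (Cons p ps)
    have "(\<Sum>(v, w)\<leftarrow>ps. tens V W v w) \<in> carrier (tensor_space V W)"
      using carrier_tensor_iff[OF V, of _ W] Cons.prems by auto
    moreover obtain v w where "p = (v, w)" by force
    ultimately have "P (tens V W v w + (\<Sum>(v, w)\<leftarrow>ps. tens V W v w))"
      using Cons by (intro a p tens_closed) auto
    then show ?case by (simp add: \<open>p = (v, w)\<close> plus_fun_def)
  qed (simp add: z)
  then show ?thesis using ps by simp
qed

lemma tensor_ext:
  assumes f: "lin (tensor_space V W) X f" and g: "lin (tensor_space V W) X g"
    and eq: "\<And>v w. v \<in> carrier V \<Longrightarrow> w \<in> carrier W \<Longrightarrow> f (tens V W v w) = g (tens V W v w)"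
    and t: "t \<in> carrier (tensor_space V W)"
  shows "f t = g t"
  using t
proof (induction rule: tensor_induct)
  case zero
  show ?case unfolding lin_zero[OF is_space_tensor f] lin_zero[OF is_space_tensor g] ..
next
  case (add s t)
  then show ?case unfolding lin_add[OF f add(1,2)] lin_add[OF g add(1,2)] by simp
qed (rule eq)

context
  fixes X :: "('k, 'c::ab_group_add, 'z) space_scheme"
  assumes X: "is_space X"
begin

lemma lin_lift: "bilin V W X \<beta> \<Longrightarrow> lin (tensor_space V W) X (lift V W \<beta>)"
  by (rule tensor_universal(3)[OF V W X])

lemma lift_tens: "bilin V W X \<beta> \<Longrightarrow> v \<in> carrier V \<Longrightarrow> w \<in> carrier W \<Longrightarrow> lift V W \<beta> (tens V W v w) = \<beta> v w"
  by (rule tensor_universal(4)[OF V W X])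

lemma lift_closed: "bilin V W X \<beta> \<Longrightarrow> t \<in> carrier (tensor_space V W) \<Longrightarrow> lift V W \<beta> t \<in> carrier X"
  by (rule lin_closed[OF lin_lift])

lemma lin_lift_comp:
  "bilin V W X \<beta> \<Longrightarrow> lin U (tensor_space V W) f \<Longrightarrow> lin U X (\<lambda>u. lift V W \<beta> (f u))"
  by (rule lin_comp[OF lin_lift])

text \<open>Nested Sweedler expressions carry parameters inside the bilinear form rather than in the
  tensor. Together with \<open>lin_lift_comp\<close> this covers both places where a variable can
  occur.\<close>

lemma lin_lift_param:
  assumes U: "is_space U"
    and t: "t \<in> carrier (tensor_space V W)"
    and b: "\<And>u. u \<in> carrier U \<Longrightarrow> bilin V W X (\<beta> u)"
    and l: "\<And>v w. v \<in> carrier V \<Longrightarrow> w \<in> carrier W \<Longrightarrow> lin U X (\<lambda>u. \<beta> u v w)"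
  shows "lin U X (\<lambda>u. lift V W (\<beta> u) t)"
proof (rule linI)
  fix x y c assume x: "x \<in> carrier U"
  show "lift V W (\<beta> x) t \<in> carrier X" by (rule lift_closed[OF b[OF x] t])
  note T = is_space_tensor
  have "smul X c (lift V W (\<beta> x) t) = lift V W (\<beta> (smul U c x)) t"
    by (rule tensor_ext[OF _ _ _ t, where X = X])
       (simp_all add: lin_smul_right[OF X] lin_lift[OF b] x U space_smul lift_tens[OF b] lin_smul[OF l])
  then show "lift V W (\<beta> (smul U c x)) t = smul X c (lift V W (\<beta> x) t)" ..
  assume y: "y \<in> carrier U"
  have xy: "x + y \<in> carrier U" by (rule space_add[OF U x y])
  show "lift V W (\<beta> (x + y)) t = lift V W (\<beta> x) t + lift V W (\<beta> y) t"
    using t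
  proof (induction rule: tensor_induct)
    case zero
    note l = lin_zero[OF T lin_lift[OF b]]
    show ?case unfolding l[OF x] l[OF y] l[OF xy] by simp
  next
    case (add s t)
    note l = lin_add[OF lin_lift[OF b] add(1,2)]
    show ?case unfolding l[OF x] l[OF y] l[OF xy] add(3,4) by (simp add: algebra_simps)
  next
    case (tens v w)
    then show ?case by (simp add: lift_tens[OF b] x y xy lin_add[OF l])
  qed
qed

text \<open>Uniqueness in the universal property: both sides are linear in \<open>t\<close> and
  agree on pure tensors. This is the rule for moving a linear map under a Sweedler sum.\<close>

lemma lin_apply_lift:
  assumes Y: "is_space Y" and f: "lin X Y f" and b: "bilin V W X \<beta>"
    and t: "t \<in> carrier (tensor_space V W)"
  shows "f (lift V W \<beta> t) = lift V W (\<lambda>v w. f (\<beta> v w)) t"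
proof -
  have b': "bilin V W Y (\<lambda>v w. f (\<beta> v w))"
    using b f by (simp add: bilin_def lin_def)
  show ?thesis
    by (rule tensor_universal(5)[OF V W Y b' _ _ t])
       (simp_all add: lin_comp[OF f lin_lift[OF b]] lift_tens[OF b])
qed

end

text \<open>The description defining \<open>lift\<close> ranges over lists within the carriers, so
  the two descriptions coincide, even for maps that are not bilinear.\<close>

lemma lift_cong:
  assumes eq: "\<And>v w. v \<in> carrier V \<Longrightarrow> w \<in> carrier W \<Longrightarrow> \<beta> v w = \<gamma> v w"
  shows "lift V W \<beta> = lift V W \<gamma>"
proof
  fix t
  have *: "(\<Sum>(v, w)\<leftarrow>ps. \<beta> v w) = (\<Sum>(v, w)\<leftarrow>ps. \<gamma> v w)" if "set ps \<subseteq> carrier V \<times> carrier W" for ps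
    using that by (induction ps) (auto simp: eq)
  show "lift V W \<beta> t = lift V W \<gamma> t"
    unfolding lift_def by (rule arg_cong[of _ _ The]) (use * in \<open>fastforce simp: fun_eq_iff\<close>)
qed

end

subsection \<open>Dual bases\<close>

text \<open>Only reconstruction of vectors is demanded, not independence of the family. This is the
  property that lets a tensor be rebuilt from its slices, and it passes to tensor products.\<close>

definition dual_basis :: "('k::field, 'a::ab_group_add, 'x) space_scheme \<Rightarrow> 'i set \<Rightarrow>
    ('i \<Rightarrow> 'a) \<Rightarrow> ('i \<Rightarrow> 'a \<Rightarrow> 'k) \<Rightarrow> bool" where
  "dual_basis V I e \<phi> \<longleftrightarrow> finite I \<and> (\<forall>i\<in>I. e i \<in> carrier V \<and> lin V field_space (\<phi> i)) \<and>
     (\<forall>v\<in>carrier V. (\<Sum>i\<in>I. smul V (\<phi> i v) (e i)) = v)"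

text \<open>This is \<phi> \<otimes> id followed by the identification of k \<otimes> W with W, that
  is, contraction of one leg against a functional.\<close>

definition slice_left :: "('k::field, 'a::ab_group_add, 'x) space_scheme \<Rightarrow>
    ('k, 'b::ab_group_add, 'y) space_scheme \<Rightarrow> ('a \<Rightarrow> 'k) \<Rightarrow> ('k, 'a, 'b) tensor \<Rightarrow> 'b" where
  "slice_left V W \<phi> t = lift V W (\<lambda>v w. smul W (\<phi> v) w) t"

definition slice_right :: "('k::field, 'a::ab_group_add, 'x) space_scheme \<Rightarrow>
    ('k, 'b::ab_group_add, 'y) space_scheme \<Rightarrow> ('b \<Rightarrow> 'k) \<Rightarrow> ('k, 'a, 'b) tensor \<Rightarrow> 'a" where
  "slice_right V W \<phi> t = lift V W (\<lambda>v w. smul V (\<phi> w) v) t"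

lemma lin_sum_fun:
  assumes W: "is_space W" and "\<And>i. i \<in> I \<Longrightarrow> lin V W (f i)"
  shows "lin V W (\<lambda>x. \<Sum>i\<in>I. f i x)"
  using assms(2)
  by (induction I rule: infinite_finite_induct)
    (auto simp: lin_def space_zero[OF W] space_add[OF W] smul_zero_right[OF W] smul_add_right[OF W] algebra_simps)

lemma lift_sum:
  assumes V: "is_space V" and W: "is_space W" and X: "is_space X"
    and b: "\<And>i. i \<in> I \<Longrightarrow> bilin V W X (\<beta> i)" and t: "t \<in> carrier (tensor_space V W)"
  shows "lift V W (\<lambda>v w. \<Sum>i\<in>I. \<beta> i v w) t = (\<Sum>i\<in>I. lift V W (\<beta> i) t)"
proof (rule tensor_ext[OF V W _ _ _ t, where X = X])
  have *: "bilin V W X (\<lambda>v w. \<Sum>i\<in>I. \<beta> i v w)"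
    using b by (intro bilinI lin_sum_fun X) (auto simp: bilin_def)
  then show "lin (tensor_space V W) X (lift V W (\<lambda>v w. \<Sum>i\<in>I. \<beta> i v w))" by (rule lin_lift[OF V W X])
  show "lin (tensor_space V W) X (\<lambda>t. \<Sum>i\<in>I. lift V W (\<beta> i) t)"
    by (intro lin_sum_fun X lin_lift[OF V W X] b)
  fix v w assume "v \<in> carrier V" "w \<in> carrier W"
  then show "lift V W (\<lambda>v w. \<Sum>i\<in>I. \<beta> i v w) (tens V W v w) = (\<Sum>i\<in>I. lift V W (\<beta> i) (tens V W v w))"
    by (simp add: lift_tens[OF V W X *] lift_tens[OF V W X b])
qed

context
  fixes V :: "('k::field, 'a::ab_group_add, 'x) space_scheme"
    and W :: "('k, 'b::ab_group_add, 'y) space_scheme"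
  assumes V: "is_space V" and W: "is_space W"
begin

lemma bilin_slice_left: "lin V field_space \<phi> \<Longrightarrow> bilin V W W (\<lambda>v w. smul W (\<phi> v) w)"
  by (intro bilinI lin_smul_left lin_smul_right W lin_id)

lemma bilin_slice_right: "lin W field_space \<phi> \<Longrightarrow> bilin V W V (\<lambda>v w. smul V (\<phi> w) v)"
  by (intro bilinI lin_smul_left lin_smul_right V lin_id)

lemma lin_slice_left: "lin V field_space \<phi> \<Longrightarrow> lin (tensor_space V W) W (slice_left V W \<phi>)"
  unfolding slice_left_def by (intro lin_lift V W bilin_slice_left)

lemma lin_slice_right: "lin W field_space \<phi> \<Longrightarrow> lin (tensor_space V W) V (slice_right V W \<phi>)"
  unfolding slice_right_def by (intro lin_lift V W bilin_slice_right)

lemma slice_left_tens: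
  "lin V field_space \<phi> \<Longrightarrow> v \<in> carrier V \<Longrightarrow> w \<in> carrier W \<Longrightarrow> slice_left V W \<phi> (tens V W v w) = smul W (\<phi> v) w"
  unfolding slice_left_def by (intro lift_tens[OF V W W] bilin_slice_left)

lemma slice_right_tens:
  "lin W field_space \<phi> \<Longrightarrow> v \<in> carrier V \<Longrightarrow> w \<in> carrier W \<Longrightarrow> slice_right V W \<phi> (tens V W v w) = smul V (\<phi> w) v"
  unfolding slice_right_def by (intro lift_tens[OF V W V] bilin_slice_right)

lemma tens_smul_left:
  "v \<in> carrier V \<Longrightarrow> w \<in> carrier W \<Longrightarrow> tens V W (smul V c v) w = smul (tensor_space V W) c (tens V W v w)"
  by (rule lin_smul[OF bilin_lin_left[OF bilin_tens[OF V W]]])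

lemma tens_smul_right:
  "v \<in> carrier V \<Longrightarrow> w \<in> carrier W \<Longrightarrow> tens V W v (smul W c w) = smul (tensor_space V W) c (tens V W v w)"
  by (rule lin_smul[OF bilin_lin_right[OF bilin_tens[OF V W]]])

text \<open>On a pure tensor this is reconstruction in \<open>V\<close> with the scalars moved
  across the tensor sign. Hence a tensor is determined by its slices against a dual basis, the
  source of all tensor comparisons below.\<close>

lemma expand_left:
  assumes B: "dual_basis V I e \<phi>" and t: "t \<in> carrier (tensor_space V W)"
  shows "(\<Sum>i\<in>I. tens V W (e i) (slice_left V W (\<phi> i) t)) = t"
proof (rule tensor_ext[OF V W _ lin_id _ t])
  have e: "\<And>i. i \<in> I \<Longrightarrow> e i \<in> carrier V" and \<phi>: "\<And>i. i \<in> I \<Longrightarrow> lin V field_space (\<phi> i)"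
    and s: "\<And>v. v \<in> carrier V \<Longrightarrow> (\<Sum>i\<in>I. smul V (\<phi> i v) (e i)) = v"
    using B by (auto simp: dual_basis_def)
  show "lin (tensor_space V W) (tensor_space V W) (\<lambda>t. \<Sum>i\<in>I. tens V W (e i) (slice_left V W (\<phi> i) t))"
    by (intro lin_sum_fun is_space_tensor V W lin_tens_right lin_slice_left e \<phi>)
  fix v w assume v: "v \<in> carrier V" "w \<in> carrier W"
  have "(\<Sum>i\<in>I. tens V W (e i) (slice_left V W (\<phi> i) (tens V W v w))) =
      (\<Sum>i\<in>I. tens V W (smul V (\<phi> i v) (e i)) w)"
    using v e \<phi> by (intro sum.cong) (auto simp: slice_left_tens tens_smul_left tens_smul_right)
  also have "\<dots> = tens V W (\<Sum>i\<in>I. smul V (\<phi> i v) (e i)) w"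
    by (rule lin_sum[OF V bilin_lin_left[OF bilin_tens[OF V W]], symmetric]) (auto simp: v e space_smul[OF V])
  finally show "(\<Sum>i\<in>I. tens V W (e i) (slice_left V W (\<phi> i) (tens V W v w))) = tens V W v w"
    by (simp only: s[OF v(1)])
qed

lemma expand_right:
  assumes B: "dual_basis W I e \<phi>" and t: "t \<in> carrier (tensor_space V W)"
  shows "(\<Sum>i\<in>I. tens V W (slice_right V W (\<phi> i) t) (e i)) = t"
proof (rule tensor_ext[OF V W _ lin_id _ t])
  have e: "\<And>i. i \<in> I \<Longrightarrow> e i \<in> carrier W" and \<phi>: "\<And>i. i \<in> I \<Longrightarrow> lin W field_space (\<phi> i)"
    and s: "\<And>v. v \<in> carrier W \<Longrightarrow> (\<Sum>i\<in>I. smul W (\<phi> i v) (e i)) = v"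
    using B by (auto simp: dual_basis_def)
  show "lin (tensor_space V W) (tensor_space V W) (\<lambda>t. \<Sum>i\<in>I. tens V W (slice_right V W (\<phi> i) t) (e i))"
    by (intro lin_sum_fun is_space_tensor V W lin_tens_left lin_slice_right e \<phi>)
  fix v w assume v: "v \<in> carrier V" "w \<in> carrier W"
  have "(\<Sum>i\<in>I. tens V W (slice_right V W (\<phi> i) (tens V W v w)) (e i)) =
      (\<Sum>i\<in>I. tens V W v (smul W (\<phi> i w) (e i)))"
    using v e \<phi> by (intro sum.cong) (auto simp: slice_right_tens tens_smul_left tens_smul_right)
  also have "\<dots> = tens V W v (\<Sum>i\<in>I. smul W (\<phi> i w) (e i))"
    by (rule lin_sum[OF W bilin_lin_right[OF bilin_tens[OF V W]], symmetric]) (auto simp: v e space_smul[OF W])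
  finally show "(\<Sum>i\<in>I. tens V W (slice_right V W (\<phi> i) (tens V W v w)) (e i)) = tens V W v w"
    by (simp only: s[OF v(2)])
qed

lemma tensor_eqI_left:
  assumes B: "dual_basis V I e \<phi>" and "t \<in> carrier (tensor_space V W)" "s \<in> carrier (tensor_space V W)"
    and eq: "\<And>i. i \<in> I \<Longrightarrow> slice_left V W (\<phi> i) t = slice_left V W (\<phi> i) s"
  shows "t = s"
proof -
  have "(\<Sum>i\<in>I. tens V W (e i) (slice_left V W (\<phi> i) t)) = (\<Sum>i\<in>I. tens V W (e i) (slice_left V W (\<phi> i) s))"
    by (rule sum.cong) (simp_all add: eq)
  then show ?thesis using expand_left[OF B] assms(2,3) by simp
qed

lemma tensor_eqI_right:
  assumes B: "dual_basis W I e \<phi>" and "t \<in> carrier (tensor_space V W)" "s \<in> carrier (tensor_space V W)"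
    and eq: "\<And>i. i \<in> I \<Longrightarrow> slice_right V W (\<phi> i) t = slice_right V W (\<phi> i) s"
  shows "t = s"
proof -
  have "(\<Sum>i\<in>I. tens V W (slice_right V W (\<phi> i) t) (e i)) = (\<Sum>i\<in>I. tens V W (slice_right V W (\<phi> i) s) (e i))"
    by (rule sum.cong) (simp_all add: eq)
  then show ?thesis using expand_right[OF B] assms(2,3) by simp
qed

lemma lin_tensor_form:
  assumes "lin V field_space \<phi>" "lin W field_space \<psi>"
  shows "bilin V W field_space (\<lambda>v w. \<phi> v * \<psi> w)"
    and "lin (tensor_space V W) field_space (lift V W (\<lambda>v w. \<phi> v * \<psi> w))"
proof -
  show "bilin V W field_space (\<lambda>v w. \<phi> v * \<psi> w)"
    by (intro bilinI lin_field_mult_left lin_field_mult_right assms)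
  then show "lin (tensor_space V W) field_space (lift V W (\<lambda>v w. \<phi> v * \<psi> w))"
    by (rule lin_lift[OF V W is_space_field])
qed

text \<open>The tensor is expanded in the left factor by \<open>expand_left\<close>, and each
  resulting slice is then reconstructed in \<open>W\<close>. It serves for V \<otimes> (A \<otimes>
  A), where both legs in \<open>A\<close> are tested at once.\<close>

lemma dual_basis_tensor:
  assumes B: "dual_basis V I e \<phi>" and C: "dual_basis W J f \<psi>"
  shows "dual_basis (tensor_space V W) (I \<times> J) (\<lambda>(i, j). tens V W (e i) (f j))
    (\<lambda>(i, j). lift V W (\<lambda>v w. \<phi> i v * \<psi> j w))"
proof -
  have e: "\<And>i. i \<in> I \<Longrightarrow> e i \<in> carrier V" and \<phi>: "\<And>i. i \<in> I \<Longrightarrow> lin V field_space (\<phi> i)"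
    and f: "\<And>i. i \<in> J \<Longrightarrow> f i \<in> carrier W" and \<psi>: "\<And>i. i \<in> J \<Longrightarrow> lin W field_space (\<psi> i)"
    and s: "\<And>v. v \<in> carrier W \<Longrightarrow> (\<Sum>i\<in>J. smul W (\<psi> i v) (f i)) = v"
    using B C by (auto simp: dual_basis_def)
  note T = is_space_tensor[OF V W]
  have "(\<Sum>(i, j)\<in>I \<times> J. smul (tensor_space V W) (lift V W (\<lambda>v w. \<phi> i v * \<psi> j w) t) (tens V W (e i) (f j))) = t"
    if t: "t \<in> carrier (tensor_space V W)" for t
  proof -
    have sl: "slice_left V W (\<phi> i) t \<in> carrier W" if "i \<in> I" for i
      by (rule lin_closed[OF lin_slice_left t]) (rule \<phi>[OF that])
    have "tens V W (e i) (slice_left V W (\<phi> i) t) =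
      (\<Sum>j\<in>J. smul (tensor_space V W) (lift V W (\<lambda>v w. \<phi> i v * \<psi> j w) t) (tens V W (e i) (f j)))"
      if i: "i \<in> I" for i
    proof -
      \<comment> \<open>Slicing by one functional and then applying the other is the product form;
        both sides are linear in \<open>t\<close>, so pure tensors suffice.\<close>
      have l: "\<psi> j (slice_left V W (\<phi> i) t) = lift V W (\<lambda>v w. \<phi> i v * \<psi> j w) t" if j: "j \<in> J" for j
        by (rule tensor_ext[OF V W lin_comp[OF \<psi>[OF j] lin_slice_left[OF \<phi>[OF i]]] lin_tensor_form(2)[OF \<phi>[OF i] \<psi>[OF j]] _ t])
          (simp add: slice_left_tens \<phi> i lin_smul[OF \<psi>[OF j]] lift_tens[OF V W is_space_field lin_tensor_form(1)[OF \<phi>[OF i] \<psi>[OF j]]])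
      have "tens V W (e i) (slice_left V W (\<phi> i) t) =
          tens V W (e i) (\<Sum>j\<in>J. smul W (\<psi> j (slice_left V W (\<phi> i) t)) (f j))"
        by (simp only: s[OF sl[OF i]])
      also have "\<dots> = (\<Sum>j\<in>J. tens V W (e i) (smul W (\<psi> j (slice_left V W (\<phi> i) t)) (f j)))"
        by (rule lin_sum[OF W bilin_lin_right[OF bilin_tens[OF V W]]]) (auto simp: e i f space_smul[OF W])
      also have "\<dots> = (\<Sum>j\<in>J. smul (tensor_space V W) (lift V W (\<lambda>v w. \<phi> i v * \<psi> j w) t) (tens V W (e i) (f j)))"
        by (rule sum.cong) (simp_all add: l tens_smul_right e i f)
      finally show ?thesis .
    qed
    then have "(\<Sum>i\<in>I. \<Sum>j\<in>J. smul (tensor_space V W) (lift V W (\<lambda>v w. \<phi> i v * \<psi> j w) t) (tens V W (e i) (f j))) =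
      (\<Sum>i\<in>I. tens V W (e i) (slice_left V W (\<phi> i) t))"
      by (intro sum.cong) simp_all
    then show ?thesis using expand_left[OF B t] by (simp add: sum.cartesian_product)
  qed
  moreover have "finite (I \<times> J)" using B C by (auto simp: dual_basis_def)
  ultimately show ?thesis
    unfolding dual_basis_def
    by (auto intro: tens_closed[OF V W] e f lin_tensor_form(2)[OF \<phi> \<psi>] simp: case_prod_unfold)
qed

end

text \<open>A maximal independent subset of a finite spanning set, with its coordinate
  functionals.\<close>

lemma finite_dim_dual_basis:
  fixes V :: "('k::field, 'a::ab_group_add, 'x) space_scheme"
  assumes V: "is_space V" and fd: "finite_dim V"
  obtains B :: "'a set" and \<phi> where "dual_basis V B (\<lambda>b. b) \<phi>"
    and "\<And>b x. b \<in> B \<Longrightarrow> x \<notin> carrier V \<Longrightarrow> \<phi> b x = 0"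
proof -
  interpret V: vector_space "smul V" using V by (rule is_space_vector_space)
  obtain S where S: "finite S" "V.span S = carrier V" using fd by (auto simp: finite_dim_def)
  obtain B where B: "B \<subseteq> S" "V.independent B" "S \<subseteq> V.span B"
    using V.maximal_independent_subset by blast
  have sp: "V.span B = carrier V"
    using S B by (metis V.span_mono V.span_span subset_antisym)
  have fB: "finite B" using B S finite_subset by blast
  have BV: "B \<subseteq> carrier V" using sp V.span_superset by blast
  \<comment> \<open>Coordinates are set to 0 off the carrier, the normal form of functionals in
    \<open>dual_space\<close>, so that over \<open>H\<close> they are elements of the dual Hopf
    algebra.\<close>
  let ?r = "\<lambda>b x. if x \<in> carrier V then V.representation B x b else 0"
  have "lin V field_space (?r b)" for b
    unfolding lin_def using space_add[OF V] space_smul[OF V]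
    by (auto simp: sp V.representation_add[OF B(2)] V.representation_scale[OF B(2)])
  moreover have "(\<Sum>b\<in>B. smul V (V.representation B v b) b) = v" if "v \<in> carrier V" for v
    using V.sum_representation_eq[OF B(2) _ fB subset_refl] that sp by simp
  ultimately have "dual_basis V B (\<lambda>b. b) ?r"
    unfolding dual_basis_def using BV fB by auto
  then show ?thesis by (rule that) auto
qed

subsection \<open>Maps between tensor products\<close>

context
  fixes V :: "('k::field, 'a::ab_group_add, 'x) space_scheme"
    and W :: "('k, 'b::ab_group_add, 'y) space_scheme"
    and V' :: "('k, 'c::ab_group_add, 'z) space_scheme"
    and W' :: "('k, 'd::ab_group_add, 'w) space_scheme"
    and f g
  assumes V: "is_space V" and W: "is_space W" and V': "is_space V'" and W': "is_space W'"
    and f: "lin V V' f" and g: "lin W W' g"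
begin

lemma bilin_tmap: "bilin V W (tensor_space V' W') (\<lambda>v w. tens V' W' (f v) (g w))"
  by (intro bilinI lin_tens_left lin_tens_right V' W' f g) (auto intro: lin_closed[OF f] lin_closed[OF g])

lemma tmap_tens:
  "v \<in> carrier V \<Longrightarrow> w \<in> carrier W \<Longrightarrow> tmap V W V' W' f g (tens V W v w) = tens V' W' (f v) (g w)"
  unfolding tmap_def by (rule lift_tens[OF V W is_space_tensor[OF V' W'] bilin_tmap])

lemma lin_tmap: "lin (tensor_space V W) (tensor_space V' W') (tmap V W V' W' f g)"
  unfolding tmap_def by (rule lin_lift[OF V W is_space_tensor[OF V' W'] bilin_tmap])

end

context
  fixes U :: "('k::field, 'u::ab_group_add, 'x) space_scheme"
    and V :: "('k, 'a::ab_group_add, 'y) space_scheme"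
    and W :: "('k, 'b::ab_group_add, 'z) space_scheme"
  assumes U: "is_space U" and V: "is_space V" and W: "is_space W"
begin

lemma bilin_tassoc_inner: "w \<in> carrier W \<Longrightarrow>
    bilin U V (tensor_space U (tensor_space V W)) (\<lambda>u v. tens U (tensor_space V W) u (tens V W v w))"
  by (intro bilinI lin_tens_left lin_tens_right U V W is_space_tensor lin_id tens_closed)

lemma bilin_tassoc: "bilin (tensor_space U V) W (tensor_space U (tensor_space V W))
    (\<lambda>t w. lift U V (\<lambda>u v. tens U (tensor_space V W) u (tens V W v w)) t)"
  by (intro bilinI lin_lift[OF U V] lin_lift_param[OF U V] bilin_tassoc_inner
      lin_tens_right U V W is_space_tensor lin_id)

lemma lin_tassoc: "lin (tensor_space (tensor_space U V) W) (tensor_space U (tensor_space V W)) (tassoc U V W)"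
  unfolding tassoc_def by (intro lin_lift bilin_tassoc is_space_tensor U V W)

text \<open>The left argument stays an arbitrary tensor: in \<open>sw3_assoc\<close> it is a
  coproduct, which need not be pure.\<close>

lemma tassoc_tens:
  "t \<in> carrier (tensor_space U V) \<Longrightarrow> w \<in> carrier W \<Longrightarrow>
    tassoc U V W (tens (tensor_space U V) W t w) =
      lift U V (\<lambda>u v. tens U (tensor_space V W) u (tens V W v w)) t"
  unfolding tassoc_def by (intro lift_tens[OF _ _ _ bilin_tassoc] is_space_tensor U V W)

end

subsection \<open>Sweedler notation\<close>

text \<open>A linear coproduct is all that the Sweedler calculus asks for. The same lemmas then
  serve \<open>H\<close>, its dual and \<open>K\<close>, without first proving the latter two to be
  coalgebras.\<close>

definition lin_comult :: "('k::field, 'a::ab_group_add, 'x) hopf_scheme \<Rightarrow> bool" where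
  "lin_comult C \<longleftrightarrow> is_space C \<and> lin C (tensor_space C C) (comult C)"

definition trilin :: "('k::field, 'a::ab_group_add, 'x) space_scheme \<Rightarrow>
    ('k, 'b::ab_group_add, 'y) space_scheme \<Rightarrow> ('a \<Rightarrow> 'a \<Rightarrow> 'a \<Rightarrow> 'b) \<Rightarrow> bool" where
  "trilin C X \<gamma> \<longleftrightarrow> (\<forall>b\<in>carrier C. \<forall>c\<in>carrier C.
     lin C X (\<lambda>a. \<gamma> a b c) \<and> lin C X (\<lambda>a. \<gamma> b a c) \<and> lin C X (\<lambda>a. \<gamma> b c a))"

lemma trilinI:
  assumes "\<And>b c. b \<in> carrier C \<Longrightarrow> c \<in> carrier C \<Longrightarrow> lin C X (\<lambda>a. \<gamma> a b c)"
    and "\<And>b c. b \<in> carrier C \<Longrightarrow> c \<in> carrier C \<Longrightarrow> lin C X (\<lambda>a. \<gamma> b a c)"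
    and "\<And>b c. b \<in> carrier C \<Longrightarrow> c \<in> carrier C \<Longrightarrow> lin C X (\<lambda>a. \<gamma> b c a)"
  shows "trilin C X \<gamma>"
  using assms by (simp add: trilin_def)

lemma trilin_bilin: "trilin C X \<gamma> \<Longrightarrow> a \<in> carrier C \<Longrightarrow> bilin C C X (\<gamma> a)"
  by (auto simp: trilin_def bilin_def)

text \<open>The chosen list depends on the element only and not on the form applied to it. Different
  Sweedler expressions in the same element thus become sums over one index set and can be compared
  term by term.\<close>

definition comult_rep :: "('k::field, 'a::ab_group_add, 'x) hopf_scheme \<Rightarrow> 'a \<Rightarrow> ('a \<times> 'a) list" where
  "comult_rep C c = (SOME ps. set ps \<subseteq> carrier C \<times> carrier C \<and> comult C c = (\<Sum>(v, w)\<leftarrow>ps. tens C C v w))"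

definition cop1 :: "('k::field, 'a::ab_group_add, 'x) hopf_scheme \<Rightarrow> 'a \<Rightarrow> nat \<Rightarrow> 'a" where
  "cop1 C c i = fst (comult_rep C c ! i)"

definition cop2 :: "('k::field, 'a::ab_group_add, 'x) hopf_scheme \<Rightarrow> 'a \<Rightarrow> nat \<Rightarrow> 'a" where
  "cop2 C c i = snd (comult_rep C c ! i)"

definition cop_index :: "('k::field, 'a::ab_group_add, 'x) hopf_scheme \<Rightarrow> 'a \<Rightarrow> nat set" where
  "cop_index C c = {..<length (comult_rep C c)}"

text \<open>A pair (i, j) picks a summand of the coproduct of \<open>c\<close> and then one of the
  coproduct of its second leg, in agreement with the right-nested definition of
  \<open>sw3\<close>.\<close>

definition cop_index3 :: "('k::field, 'a::ab_group_add, 'x) hopf_scheme \<Rightarrow> 'a \<Rightarrow> (nat \<times> nat) set" where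
  "cop_index3 C c = Sigma (cop_index C c) (\<lambda>i. cop_index C (cop2 C c i))"

definition cop31 :: "('k::field, 'a::ab_group_add, 'x) hopf_scheme \<Rightarrow> 'a \<Rightarrow> nat \<times> nat \<Rightarrow> 'a" where
  "cop31 C c s = cop1 C c (fst s)"

definition cop32 :: "('k::field, 'a::ab_group_add, 'x) hopf_scheme \<Rightarrow> 'a \<Rightarrow> nat \<times> nat \<Rightarrow> 'a" where
  "cop32 C c s = cop1 C (cop2 C c (fst s)) (snd s)"

definition cop33 :: "('k::field, 'a::ab_group_add, 'x) hopf_scheme \<Rightarrow> 'a \<Rightarrow> nat \<times> nat \<Rightarrow> 'a" where
  "cop33 C c s = cop2 C (cop2 C c (fst s)) (snd s)"

context
  fixes C :: "('k::field, 'a::ab_group_add, 'x) hopf_scheme"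
  assumes C: "lin_comult C"
begin

lemma is_space_C: "is_space C" and lin_comult: "lin C (tensor_space C C) (comult C)"
  using C by (auto simp: lin_comult_def)

lemma comult_rep:
  assumes c: "c \<in> carrier C"
  shows "set (comult_rep C c) \<subseteq> carrier C \<times> carrier C"
    and "comult C c = (\<Sum>(v, w)\<leftarrow>comult_rep C c. tens C C v w)"
proof -
  have "\<exists>ps. set ps \<subseteq> carrier C \<times> carrier C \<and> comult C c = (\<Sum>(v, w)\<leftarrow>ps. tens C C v w)"
    using carrier_tensor_iff[OF is_space_C] lin_closed[OF lin_comult c] by blast
  from someI_ex[OF this] show "set (comult_rep C c) \<subseteq> carrier C \<times> carrier C"
    and "comult C c = (\<Sum>(v, w)\<leftarrow>comult_rep C c. tens C C v w)"
    unfolding comult_rep_def by blast+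
qed

lemma cop_closed:
  assumes "c \<in> carrier C" "i \<in> cop_index C c"
  shows "cop1 C c i \<in> carrier C" "cop2 C c i \<in> carrier C"
proof -
  have "comult_rep C c ! i \<in> set (comult_rep C c)"
    using assms by (simp add: cop_index_def)
  then have "comult_rep C c ! i \<in> carrier C \<times> carrier C"
    using comult_rep(1)[OF assms(1)] by blast
  then show "cop1 C c i \<in> carrier C" "cop2 C c i \<in> carrier C"
    by (auto simp: cop1_def cop2_def mem_Times_iff)
qed

lemma cop3_closed:
  assumes "c \<in> carrier C" "s \<in> cop_index3 C c"
  shows "cop31 C c s \<in> carrier C" "cop32 C c s \<in> carrier C" "cop33 C c s \<in> carrier C"
  using assms by (auto simp: cop31_def cop32_def cop33_def cop_index3_def intro!: cop_closed)

context
  fixes X :: "('k, 'c::ab_group_add, 'z) space_scheme"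
  assumes X: "is_space X"
begin

lemma sw2_sum:
  assumes "bilin C C X \<beta>" "c \<in> carrier C"
  shows "sw2 C \<beta> c = (\<Sum>i\<in>cop_index C c. \<beta> (cop1 C c i) (cop2 C c i))"
  using lift_eqI[OF X assms(1) comult_rep[OF assms(2)]]
  by (simp add: sw2_def sum_list_sum_nth case_prod_unfold cop1_def cop2_def cop_index_def atLeast0LessThan)

lemma lin_sw2: "bilin C C X \<beta> \<Longrightarrow> lin U C f \<Longrightarrow> lin U X (\<lambda>u. sw2 C \<beta> (f u))"
  unfolding sw2_def
  by (rule lin_comp[OF lin_lift[OF is_space_C is_space_C X] lin_comp[OF lin_comult]])

lemma lin_sw2_param:
  assumes "is_space U" "c \<in> carrier C"
    and "\<And>u. u \<in> carrier U \<Longrightarrow> bilin C C X (\<beta> u)"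
    and "\<And>v w. v \<in> carrier C \<Longrightarrow> w \<in> carrier C \<Longrightarrow> lin U X (\<lambda>u. \<beta> u v w)"
  shows "lin U X (\<lambda>u. sw2 C (\<beta> u) c)"
  unfolding sw2_def by (intro lin_lift_param is_space_C X assms lin_closed[OF lin_comult])

lemma bilin_sw2: "trilin C X \<gamma> \<Longrightarrow> bilin C C X (\<lambda>a b. sw2 C (\<gamma> a) b)"
  by (intro bilinI lin_sw2 lin_sw2_param is_space_C lin_id) (auto simp: trilin_def bilin_def)

lemma sw3_sum:
  assumes \<gamma>: "trilin C X \<gamma>" and c: "c \<in> carrier C"
  shows "sw3 C \<gamma> c = (\<Sum>s\<in>cop_index3 C c. \<gamma> (cop31 C c s) (cop32 C c s) (cop33 C c s))"
proof -
  have "sw3 C \<gamma> c = (\<Sum>i\<in>cop_index C c. sw2 C (\<gamma> (cop1 C c i)) (cop2 C c i))"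
    unfolding sw3_def by (rule sw2_sum[OF bilin_sw2[OF \<gamma>] c])
  also have "\<dots> = (\<Sum>i\<in>cop_index C c. \<Sum>j\<in>cop_index C (cop2 C c i).
      \<gamma> (cop1 C c i) (cop1 C (cop2 C c i) j) (cop2 C (cop2 C c i) j))"
    by (intro sum.cong refl sw2_sum trilin_bilin[OF \<gamma>] cop_closed c)
  also have "\<dots> = (\<Sum>(i, j)\<in>cop_index3 C c. \<gamma> (cop1 C c i) (cop1 C (cop2 C c i) j) (cop2 C (cop2 C c i) j))"
    unfolding cop_index3_def by (rule sum.Sigma) (auto simp: cop_index_def)
  finally show ?thesis by (simp add: cop31_def cop32_def cop33_def case_prod_unfold)
qed

lemma lin_sw3: "trilin C X \<gamma> \<Longrightarrow> lin U C f \<Longrightarrow> lin U X (\<lambda>u. sw3 C \<gamma> (f u))"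
  unfolding sw3_def by (intro lin_sw2 bilin_sw2)

lemma lin_sw3_param:
  assumes U: "is_space U" and c: "c \<in> carrier C"
    and b: "\<And>u. u \<in> carrier U \<Longrightarrow> trilin C X (\<gamma> u)"
    and l: "\<And>x y z. x \<in> carrier C \<Longrightarrow> y \<in> carrier C \<Longrightarrow> z \<in> carrier C \<Longrightarrow> lin U X (\<lambda>u. \<gamma> u x y z)"
  shows "lin U X (\<lambda>u. sw3 C (\<gamma> u) c)"
  unfolding sw3_def by (intro lin_sw2_param bilin_sw2 U c b l trilin_bilin)

lemma sw3_closed: "trilin C X \<gamma> \<Longrightarrow> c \<in> carrier C \<Longrightarrow> sw3 C \<gamma> c \<in> carrier X"
  by (rule lin_closed[OF lin_sw3[OF _ lin_id]])

lemma apply_sw2: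
  assumes "is_space Y" "lin X Y f" "bilin C C X \<beta>" "c \<in> carrier C"
  shows "f (sw2 C \<beta> c) = sw2 C (\<lambda>a b. f (\<beta> a b)) c"
  unfolding sw2_def by (intro lin_apply_lift[where X = X and Y = Y] is_space_C X assms lin_closed[OF lin_comult])

end

lemma sw2_cong:
  assumes "\<And>a b. a \<in> carrier C \<Longrightarrow> b \<in> carrier C \<Longrightarrow> \<beta> a b = \<beta>' a b"
  shows "sw2 C \<beta> c = sw2 C \<beta>' c"
  unfolding sw2_def by (intro fun_cong[OF lift_cong] is_space_C assms)

lemma sw3_cong:
  assumes "\<And>x y z. x \<in> carrier C \<Longrightarrow> y \<in> carrier C \<Longrightarrow> z \<in> carrier C \<Longrightarrow> \<gamma> x y z = \<gamma>' x y z"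
  shows "sw3 C \<gamma> c = sw3 C \<gamma>' c"
  unfolding sw3_def by (intro sw2_cong assms)

lemma apply_sw3:
  assumes X: "is_space X" and Y: "is_space Y" and f: "lin X Y f" and \<gamma>: "trilin C X \<gamma>" and c: "c \<in> carrier C"
  shows "f (sw3 C \<gamma> c) = sw3 C (\<lambda>x y z. f (\<gamma> x y z)) c"
proof -
  have "f (sw3 C \<gamma> c) = sw2 C (\<lambda>a b. f (sw2 C (\<gamma> a) b)) c"
    unfolding sw3_def by (rule apply_sw2[OF X Y f bilin_sw2[OF X \<gamma>] c])
  also have "\<dots> = sw3 C (\<lambda>x y z. f (\<gamma> x y z)) c"
    unfolding sw3_def by (intro sw2_cong apply_sw2[OF X Y f] trilin_bilin[OF \<gamma>])
  finally show ?thesis .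
qed

end

text \<open>The form \<gamma> induces a linear map \<open>?F\<close> on C \<otimes> (C \<otimes> C).
  Applied to the two sides of the coassociativity equation, it yields the two nestings of the
  coproduct.\<close>

lemma sw3_assoc:
  assumes C: "coalgebra C" and X: "is_space X" and \<gamma>: "trilin C X \<gamma>" and c: "c \<in> carrier C"
  shows "sw2 C (\<lambda>b a3. sw2 C (\<lambda>a1 a2. \<gamma> a1 a2 a3) b) c = sw3 C \<gamma> c"
proof -
  have L: "lin_comult C" using C by (auto simp: lin_comult_def coalgebra_def)
  note S = is_space_C[OF L] and D = lin_comult[OF L]
  note T = is_space_tensor[OF S S]
  let ?F = "lift C (tensor_space C C) (\<lambda>a t. lift C C (\<gamma> a) t)"
  have g1: "bilin C C X (\<gamma> a)" if "a \<in> carrier C" for a by (rule trilin_bilin[OF \<gamma> that])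
  have g2: "bilin C C X (\<lambda>a b. \<gamma> a b d)" if "d \<in> carrier C" for d
    using \<gamma> that by (auto simp: trilin_def bilin_def)
  have b: "bilin C (tensor_space C C) X (\<lambda>a t. lift C C (\<gamma> a) t)"
    by (intro bilinI lin_lift lin_lift_param S X T g1) (use \<gamma> in \<open>auto simp: trilin_def\<close>)
  have F: "lin (tensor_space C (tensor_space C C)) X ?F" by (intro lin_lift S T X b)
  have id: "lin C C id" by (simp add: id_def lin_id)
  have *: "bilin C C (tensor_space C (tensor_space C C)) (\<lambda>a b. tens C (tensor_space C C) a (comult C b))"
    by (intro bilinI lin_tens_left lin_tens_right S T lin_id D lin_closed[OF D])
  have "?F (tmap C C C (tensor_space C C) id (comult C) (comult C c)) =
      lift C C (\<lambda>a b. ?F (tens C (tensor_space C C) a (comult C b))) (comult C c)"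
    unfolding tmap_def id_def
    by (rule lin_apply_lift[OF S S is_space_tensor[OF S T] X F * lin_closed[OF D c]])
  also have "\<dots> = sw3 C \<gamma> c"
    unfolding sw3_def sw2_def
    by (intro fun_cong[OF lift_cong[OF S S]] lift_tens[OF S T X b] lin_closed[OF D])
  finally have R: "?F (tmap C C C (tensor_space C C) id (comult C) (comult C c)) = sw3 C \<gamma> c" .
  have FT: "lin (tensor_space (tensor_space C C) C) X (\<lambda>t. ?F (tassoc C C C t))"
    by (rule lin_comp[OF F lin_tassoc[OF S S S]])
  have *: "bilin C C (tensor_space (tensor_space C C) C) (\<lambda>b a. tens (tensor_space C C) C (comult C b) a)"
    by (intro bilinI lin_tens_left lin_tens_right S T lin_id D lin_closed[OF D])
  have "?F (tassoc C C C (tmap C C (tensor_space C C) C (comult C) id (comult C c))) =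
      lift C C (\<lambda>b a. ?F (tassoc C C C (tens (tensor_space C C) C (comult C b) a))) (comult C c)"
    unfolding tmap_def id_def
    by (rule lin_apply_lift[OF S S is_space_tensor[OF T S] X FT * lin_closed[OF D c]])
  also have "\<dots> = sw2 C (\<lambda>b a3. sw2 C (\<lambda>a1 a2. \<gamma> a1 a2 a3) b) c"
    unfolding sw2_def
  proof (intro fun_cong[OF lift_cong[OF S S]])
    fix u v assume u: "u \<in> carrier C" and v: "v \<in> carrier C"
    have "?F (tassoc C C C (tens (tensor_space C C) C (comult C u) v)) =
       ?F (lift C C (\<lambda>a b. tens C (tensor_space C C) a (tens C C b v)) (comult C u))"
      by (simp add: tassoc_tens[OF S S S lin_closed[OF D u] v])
    also have "\<dots> = lift C C (\<lambda>a b. ?F (tens C (tensor_space C C) a (tens C C b v))) (comult C u)"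
      by (rule lin_apply_lift[OF S S is_space_tensor[OF S T] X F bilin_tassoc_inner[OF S S S v] lin_closed[OF D u]])
    also have "\<dots> = lift C C (\<lambda>a b. \<gamma> a b v) (comult C u)"
    proof (intro fun_cong[OF lift_cong[OF S S]])
      fix a b assume ab: "a \<in> carrier C" "b \<in> carrier C"
      show "?F (tens C (tensor_space C C) a (tens C C b v)) = \<gamma> a b v"
        using lift_tens[OF S T X b ab(1) tens_closed[OF S S ab(2) v]] lift_tens[OF S S X g1[OF ab(1)] ab(2) v]
        by simp
    qed
    finally show "?F (tassoc C C C (tens (tensor_space C C) C (comult C u) v)) = lift C C (\<lambda>a b. \<gamma> a b v) (comult C u)" .
  qed
  finally show ?thesis using R C c unfolding coalgebra_def by auto
qed

subsection \<open>The dual of a finite dimensional Hopf algebra\<close>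

text \<open>A name for evaluation makes the introduction rules for linear maps below match by higher-order patterns.\<close>

definition ev :: "('a \<Rightarrow> 'k) \<Rightarrow> 'a \<Rightarrow> 'k" where
  "ev p h = p h"

lemmas lin_intros = lin_id bilinI trilinI lin_lift_comp lin_lift_param lin_tens_left lin_tens_right
  lin_smul_left lin_smul_right lin_field_mult_left lin_field_mult_right
  lin_sw2 lin_sw2_param lin_sw3 lin_sw3_param
  is_space_tensor is_space_field tens_closed lift_closed space_smul

locale fd_hopf =
  fixes H :: "('k::field, 'h::ab_group_add) hopf"
  assumes hopf: "hopf_algebra H" and fin: "finite_dim H"
    and bij: "bij_betw (antipode H) (carrier H) (carrier H)"
begin

abbreviation "A \<equiv> dual_hopf H"
abbreviation "A2 \<equiv> tensor_space A A"
abbreviation "H2 \<equiv> tensor_space H H"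

lemma coalgebra_H: "coalgebra H"
  and space_H [simp]: "is_space H"
  and bilin_mult_H: "bilin H H H (mult H)"
  and one_H [simp]: "one H \<in> carrier H"
  and assoc_H: "a \<in> carrier H \<Longrightarrow> b \<in> carrier H \<Longrightarrow> c \<in> carrier H \<Longrightarrow>
      mult H (mult H a b) c = mult H a (mult H b c)"
  and mult_one_H [simp]: "a \<in> carrier H \<Longrightarrow> mult H (one H) a = a" "a \<in> carrier H \<Longrightarrow> mult H a (one H) = a"
  and lin_comult_H [simp]: "lin_comult H"
  and lin_counit: "lin H field_space (counit H)"
  and counit_mult [simp]: "a \<in> carrier H \<Longrightarrow> b \<in> carrier H \<Longrightarrow> counit H (mult H a b) = counit H a * counit H b"
  and comult_one: "comult H (one H) = tens H H (one H) (one H)"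
  and counit_one [simp]: "counit H (one H) = 1"
  and lin_antipode: "lin H H (antipode H)"
  and sw2_counit_left: "a \<in> carrier H \<Longrightarrow> sw2 H (\<lambda>a1 a2. smul H (counit H a1) a2) a = a"
  and sw2_counit_right: "a \<in> carrier H \<Longrightarrow> sw2 H (\<lambda>a1 a2. smul H (counit H a2) a1) a = a"
  using hopf unfolding hopf_algebra_def algebra_def coalgebra_def lin_comult_def by auto

lemma carrier_A: "p \<in> carrier A \<longleftrightarrow> lin H field_space p \<and> (\<forall>x. x \<notin> carrier H \<longrightarrow> p x = 0)"
  by (simp add: dual_hopf_def dual_space_def)

lemma smul_A: "smul A c p = (\<lambda>x. c * p x)"
  by (simp add: dual_hopf_def dual_space_def)

lemma ev_smul [simp]: "ev (smul A c p) x = c * ev p x"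
  by (simp add: ev_def smul_A)

lemma ev_add [simp]: "ev (p + q) x = ev p x + ev q x"
  by (simp add: ev_def)

lemma space_A [simp]: "is_space A"
proof -
  have "smul A = (\<lambda>c p x. c * p x)" by (simp add: fun_eq_iff smul_A)
  moreover interpret vector_space "\<lambda>(c::'k) (p::'h \<Rightarrow> 'k) x. c * p x" by (rule vs_tensor)
  have "subspace (carrier A)"
    unfolding subspace_def by (auto simp: carrier_A lin_def algebra_simps)
  ultimately show ?thesis by (simp add: is_space_def vs_tensor)
qed

lemma A_eqI:
  assumes "p \<in> carrier A" "q \<in> carrier A" "\<And>h. h \<in> carrier H \<Longrightarrow> ev p h = ev q h"
  shows "p = q"
  using assms by (auto simp: carrier_A ev_def fun_eq_iff) metis

lemma A_memI: "lin H field_space f \<Longrightarrow> (\<lambda>x. if x \<in> carrier H then f x else 0) \<in> carrier A"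
  by (auto simp: carrier_A intro: lin_cong)

text \<open>Addition and scalars of functionals are pointwise and elements of \<open>A\<close> are
  determined by their values on \<open>H\<close>, so linearity can be tested at each point.\<close>

lemma lin_into_A:
  assumes U: "is_space U" and c: "\<And>u. u \<in> carrier U \<Longrightarrow> F u \<in> carrier A"
    and l: "\<And>h. h \<in> carrier H \<Longrightarrow> lin U field_space (\<lambda>u. ev (F u) h)"
  shows "lin U A F"
proof (rule linI)
  fix x y c assume x: "x \<in> carrier U"
  show "F x \<in> carrier A" by (rule c[OF x])
  show "F (smul U c x) = smul A c (F x)"
    by (rule A_eqI) (simp_all add: assms x space_smul lin_smul[OF l])
  assume y: "y \<in> carrier U"
  show "F (x + y) = F x + F y"
    by (rule A_eqI) (simp_all add: assms x y space_add lin_add[OF l])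
qed

lemma lin_ev: "h \<in> carrier H \<Longrightarrow> lin U A f \<Longrightarrow> lin U field_space (\<lambda>u. ev (f u) h)"
  by (simp add: lin_def)

lemma lin_ev_arg: "p \<in> carrier A \<Longrightarrow> lin U H f \<Longrightarrow> lin U field_space (\<lambda>u. ev p (f u))"
  by (simp add: lin_def carrier_A ev_def)

section \<open>The convolution product of the dual and the regular actions\<close>

lemma mult_A: "h \<in> carrier H \<Longrightarrow> ev (mult A p q) h = sw2 H (\<lambda>h1 h2. ev p h1 * ev q h2) h"
  by (simp add: dual_hopf_def ev_def)

lemma one_A: "h \<in> carrier H \<Longrightarrow> ev (one A) h = counit H h"
  by (simp add: dual_hopf_def ev_def)

lemma counit_A: "counit A p = ev p (one H)"
  by (simp add: dual_hopf_def ev_def)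

lemma lreg: "x \<in> carrier H \<Longrightarrow> ev (lreg H h p) x = ev p (mult H x h)"
  by (simp add: lreg_def ev_def)

lemma rreg: "x \<in> carrier H \<Longrightarrow> ev (rreg H p h) x = ev p (mult H h x)"
  by (simp add: rreg_def ev_def)

lemma lin_mult_H_left: "lin U H f \<Longrightarrow> c \<in> carrier H \<Longrightarrow> lin U H (\<lambda>u. mult H (f u) c)"
  by (rule bilin_comp_left[OF bilin_mult_H])

lemma lin_mult_H_right: "lin U H f \<Longrightarrow> c \<in> carrier H \<Longrightarrow> lin U H (\<lambda>u. mult H c (f u))"
  by (rule bilin_comp_right[OF bilin_mult_H])

lemma mult_H_closed [simp]: "a \<in> carrier H \<Longrightarrow> b \<in> carrier H \<Longrightarrow> mult H a b \<in> carrier H"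
  by (rule bilin_closed[OF bilin_mult_H])

lemma one_A_closed [simp]: "one A \<in> carrier A"
  using A_memI[OF lin_counit] by (simp add: dual_hopf_def)

lemma mult_A_closed [simp]:
  assumes "p \<in> carrier A" "q \<in> carrier A"
  shows "mult A p q \<in> carrier A"
proof -
  have "lin H field_space (\<lambda>h. sw2 H (\<lambda>h1 h2. ev p h1 * ev q h2) h)"
    by (intro lin_intros lin_ev_arg) (simp_all add: assms)
  from A_memI[OF this] show ?thesis unfolding ev_def by (simp add: dual_hopf_def)
qed

lemma lreg_closed [simp]:
  assumes "p \<in> carrier A" "h \<in> carrier H"
  shows "lreg H h p \<in> carrier A"
proof -
  have "lin H field_space (\<lambda>x. ev p (mult H x h))"
    by (intro lin_intros lin_ev_arg lin_mult_H_left assms)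
  from A_memI[OF this] show ?thesis unfolding lreg_def ev_def .
qed

lemma rreg_closed [simp]:
  assumes "p \<in> carrier A" "h \<in> carrier H"
  shows "rreg H p h \<in> carrier A"
proof -
  have "lin H field_space (\<lambda>x. ev p (mult H h x))"
    by (intro lin_intros lin_ev_arg lin_mult_H_right assms)
  from A_memI[OF this] show ?thesis unfolding rreg_def ev_def .
qed

lemma bilin_mult_A: "bilin A A A (mult A)"
proof (rule bilinI; rule lin_into_A)
  fix w h assume w: "w \<in> carrier A" and h: "h \<in> carrier H"
  show "lin A field_space (\<lambda>p. ev (mult A p w) h)" "lin A field_space (\<lambda>p. ev (mult A w p) h)"
    unfolding mult_A[OF h] by (intro lin_intros lin_ev lin_ev_arg; simp add: w h)+
qed simp_all

lemma bilin_lreg: "bilin H A A (lreg H)"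
proof (rule bilinI; rule lin_into_A)
  fix h x assume h: "h \<in> carrier H" and x: "x \<in> carrier H"
  show "lin A field_space (\<lambda>p. ev (lreg H h p) x)"
    unfolding lreg[OF x] by (intro lin_ev lin_id) (simp add: h x)
next
  fix p x assume p: "p \<in> carrier A" and x: "x \<in> carrier H"
  show "lin H field_space (\<lambda>h. ev (lreg H h p) x)"
    unfolding lreg[OF x] by (intro lin_ev_arg lin_mult_H_right lin_id p x)
qed simp_all

lemma bilin_rreg: "bilin A H A (rreg H)"
proof (rule bilinI; rule lin_into_A)
  fix h x assume h: "h \<in> carrier H" and x: "x \<in> carrier H"
  show "lin A field_space (\<lambda>p. ev (rreg H p h) x)"
    unfolding rreg[OF x] by (intro lin_ev lin_id) (simp add: h x)
next
  fix p x assume p: "p \<in> carrier A" and x: "x \<in> carrier H"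
  show "lin H field_space (\<lambda>h. ev (rreg H p h) x)"
    unfolding rreg[OF x] by (intro lin_ev_arg lin_mult_H_left lin_id p x)
qed simp_all

lemmas lin_A_intros = lin_ev lin_ev_arg lin_mult_H_left lin_mult_H_right
  bilin_comp_left[OF bilin_mult_A] bilin_comp_right[OF bilin_mult_A]
  bilin_comp_left[OF bilin_lreg] bilin_comp_right[OF bilin_lreg]
  bilin_comp_left[OF bilin_rreg] bilin_comp_right[OF bilin_rreg]

lemma mult_one_A [simp]:
  assumes p: "p \<in> carrier A"
  shows "mult A (one A) p = p" "mult A p (one A) = p"
proof -
  have *: "bilin H H H (\<lambda>h1 h2. smul H (counit H h1) h2)" "bilin H H H (\<lambda>h1 h2. smul H (counit H h2) h1)"
    by (intro lin_intros lin_counit; simp)+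
  have lp: "lin H field_space (ev p)" using lin_ev_arg[OF p lin_id] by simp
  { fix h assume h: "h \<in> carrier H"
    have "ev (mult A (one A) p) h = sw2 H (\<lambda>h1 h2. ev p (smul H (counit H h1) h2)) h"
      unfolding mult_A[OF h] by (rule sw2_cong) (simp_all add: one_A lin_smul[OF lp])
    also have "\<dots> = ev p (sw2 H (\<lambda>h1 h2. smul H (counit H h1) h2) h)"
      by (rule apply_sw2[symmetric, where X = H and Y = field_space]) (simp_all add: lp * h)
    finally have "ev (mult A (one A) p) h = ev p h" by (simp add: sw2_counit_left h) }
  then show "mult A (one A) p = p" by (intro A_eqI) (simp_all add: p)
  { fix h assume h: "h \<in> carrier H"
    have "ev (mult A p (one A)) h = sw2 H (\<lambda>h1 h2. ev p (smul H (counit H h2) h1)) h"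
      unfolding mult_A[OF h] by (rule sw2_cong) (simp_all add: one_A lin_smul[OF lp])
    also have "\<dots> = ev p (sw2 H (\<lambda>h1 h2. smul H (counit H h2) h1) h)"
      by (rule apply_sw2[symmetric, where X = H and Y = field_space]) (simp_all add: lp * h)
    finally have "ev (mult A p (one A)) h = ev p h" by (simp add: sw2_counit_right h) }
  then show "mult A p (one A) = p" by (intro A_eqI) (simp_all add: p)
qed

text \<open>The counit axiom applied to both outer legs. Such counits arise from the regular actions
  on \<epsilon>, since h \<rightharpoonup> \<epsilon> and \<epsilon> \<leftharpoonup> h are both
  \<epsilon> scaled by its value at h.\<close>

lemma sw3_counit:
  assumes X: "is_space X" and f: "lin H X f" and h: "h \<in> carrier H"
  shows "sw3 H (\<lambda>h1 h2 h3. smul X (counit H h1 * counit H h3) (f h2)) h = f h"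
proof -
  have "sw3 H (\<lambda>h1 h2 h3. smul X (counit H h1 * counit H h3) (f h2)) h =
      sw2 H (\<lambda>h1 x. smul X (counit H h1) (f x)) h"
    unfolding sw3_def
  proof (rule sw2_cong)
    fix a b assume a: "a \<in> carrier H" and b: "b \<in> carrier H"
    have g: "lin H X (\<lambda>x. smul X (counit H a) (f x))" by (intro lin_smul_right X f)
    have *: "bilin H H H (\<lambda>h2 h3. smul H (counit H h3) h2)"
      by (intro lin_intros lin_counit; simp)
    have "sw2 H (\<lambda>h2 h3. smul X (counit H a * counit H h3) (f h2)) b =
      sw2 H (\<lambda>h2 h3. smul X (counit H a) (f (smul H (counit H h3) h2))) b"
      by (rule sw2_cong) (simp_all add: lin_smul[OF f] smul_smul[OF X])
    also have "\<dots> = smul X (counit H a) (f (sw2 H (\<lambda>h2 h3. smul H (counit H h3) h2) b))"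
      by (rule apply_sw2[symmetric, OF _ _ X g *]) (simp_all add: b)
    finally show "sw2 H (\<lambda>h2 h3. smul X (counit H a * counit H h3) (f h2)) b = smul X (counit H a) (f b)"
      by (simp add: sw2_counit_right b)
  qed simp
  also have "\<dots> = sw2 H (\<lambda>h1 x. f (smul H (counit H h1) x)) h"
    by (rule sw2_cong) (simp_all add: lin_smul[OF f])
  also have "\<dots> = f (sw2 H (\<lambda>h1 x. smul H (counit H h1) x) h)"
    by (rule apply_sw2[symmetric, OF _ _ X f]) (auto intro!: lin_intros lin_counit simp: h)
  finally show ?thesis by (simp add: sw2_counit_left h)
qed

text \<open>The unit is grouplike, used once for each of the two nested coproducts.\<close>

lemma sw3_one:
  assumes X: "is_space X" and \<gamma>: "trilin H X \<gamma>"
  shows "sw3 H \<gamma> (one H) = \<gamma> (one H) (one H) (one H)"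
  unfolding sw3_def sw2_def comult_one
  using lift_tens[OF space_H space_H X bilin_sw2[OF _ X \<gamma>, unfolded sw2_def]]
    lift_tens[OF space_H space_H X trilin_bilin[OF \<gamma>]]
  by (simp add: comult_one)

lemma lreg_one_A: "h \<in> carrier H \<Longrightarrow> lreg H h (one A) = smul A (counit H h) (one A)"
  by (rule A_eqI) (simp_all add: space_smul lreg one_A)

lemma rreg_one_A: "h \<in> carrier H \<Longrightarrow> rreg H (one A) h = smul A (counit H h) (one A)"
  by (rule A_eqI) (simp_all add: space_smul rreg one_A)

lemma lreg_one: "p \<in> carrier A \<Longrightarrow> lreg H (one H) p = p"
  by (rule A_eqI) (simp_all add: lreg)

lemma rreg_one: "p \<in> carrier A \<Longrightarrow> rreg H p (one H) = p"
  by (rule A_eqI) (simp_all add: rreg)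

subsection \<open>Separation by evaluations\<close>

definition evl :: "('k, 'v::ab_group_add, 'x) space_scheme \<Rightarrow> 'h \<Rightarrow> ('k, 'h \<Rightarrow> 'k, 'v) tensor \<Rightarrow> 'v" where
  "evl V g = slice_left A V (\<lambda>a. ev a g)"

definition evr :: "('k, 'v::ab_group_add, 'x) space_scheme \<Rightarrow> 'h \<Rightarrow> ('k, 'v, 'h \<Rightarrow> 'k) tensor \<Rightarrow> 'v" where
  "evr V h = slice_right V A (\<lambda>a. ev a h)"

lemma lin_eval: "h \<in> carrier H \<Longrightarrow> lin A field_space (\<lambda>a. ev a h)"
  by (intro lin_ev lin_id)

text \<open>One pair of families serves in both directions: the points \<open>B\<close> with
  coordinate functionals \<phi> reconstruct \<open>H\<close>, and \<phi> with evaluation at the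
  points of \<open>B\<close> reconstructs \<open>A\<close>. The latter makes evaluations at points
  of \<open>H\<close> sufficient to separate tensors.\<close>

lemma dual_basis_A:
  obtains B \<phi> where "dual_basis A B \<phi> (\<lambda>b p. ev p b)" "dual_basis H B (\<lambda>b. b) (\<lambda>b. ev (\<phi> b))"
    "\<And>b. b \<in> B \<Longrightarrow> b \<in> carrier H \<and> \<phi> b \<in> carrier A"
proof -
  obtain B \<phi> where B: "dual_basis H B (\<lambda>b. b) \<phi>"
    and z: "\<And>b x. b \<in> B \<Longrightarrow> x \<notin> carrier H \<Longrightarrow> \<phi> b x = 0"
    using finite_dim_dual_basis[OF space_H fin] by metis
  have b: "b \<in> carrier H" "\<phi> b \<in> carrier A" if "b \<in> B" for b
    using B z that by (auto simp: dual_basis_def carrier_A)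
  have "(\<Sum>b\<in>B. smul A (ev p b) (\<phi> b)) = p" if p: "p \<in> carrier A" for p
  proof (rule A_eqI)
    fix h assume h: "h \<in> carrier H"
    have "ev (\<Sum>b\<in>B. smul A (ev p b) (\<phi> b)) h = (\<Sum>b\<in>B. ev p (smul H (\<phi> b h) b))"
      using lin_sum[OF space_A lin_eval[OF h], of B "\<lambda>b. smul A (ev p b) (\<phi> b)"] b
        lin_smul[OF lin_ev_arg[OF p lin_id]]
      by (simp add: space_smul ev_def[of "\<phi> _"] mult.commute)
    also have "\<dots> = ev p (\<Sum>b\<in>B. smul H (\<phi> b h) b)"
      by (rule lin_sum[OF space_H lin_ev_arg[OF p lin_id], symmetric]) (simp add: b space_smul)
    finally show "ev (\<Sum>b\<in>B. smul A (ev p b) (\<phi> b)) h = ev p h"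
      using B h by (simp add: dual_basis_def)
  qed (simp_all add: p b space_sum space_smul)
  then have "dual_basis A B \<phi> (\<lambda>b p. ev p b)"
    using B b unfolding dual_basis_def by (auto intro: lin_eval)
  moreover have "dual_basis H B (\<lambda>b. b) (\<lambda>b. ev (\<phi> b))"
    using B by (simp add: ev_def[abs_def])
  ultimately show ?thesis by (rule that) (simp add: b)
qed

context
  fixes V :: "('k, 'v::ab_group_add, 'x) space_scheme"
  assumes V: "is_space V"
begin

lemma lin_evl: "g \<in> carrier H \<Longrightarrow> lin (tensor_space A V) V (evl V g)"
  unfolding evl_def by (intro lin_slice_left V space_A lin_eval)

lemma lin_evr: "g \<in> carrier H \<Longrightarrow> lin (tensor_space V A) V (evr V g)"
  unfolding evr_def by (intro lin_slice_right V space_A lin_eval)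

lemma lin_evl_arg:
  assumes t: "t \<in> carrier (tensor_space A V)"
  shows "lin H V (\<lambda>g. evl V g t)"
  unfolding evl_def slice_left_def by (intro lin_intros lin_A_intros) (simp_all add: t V)

lemma lin_evr_arg:
  assumes t: "t \<in> carrier (tensor_space V A)"
  shows "lin H V (\<lambda>g. evr V g t)"
  unfolding evr_def slice_right_def by (intro lin_intros lin_A_intros) (simp_all add: t V)

lemma evl_tens: "g \<in> carrier H \<Longrightarrow> a \<in> carrier A \<Longrightarrow> v \<in> carrier V \<Longrightarrow> evl V g (tens A V a v) = smul V (ev a g) v"
  unfolding evl_def by (intro slice_left_tens space_A V lin_eval)

lemma evr_tens: "g \<in> carrier H \<Longrightarrow> a \<in> carrier A \<Longrightarrow> v \<in> carrier V \<Longrightarrow> evr V g (tens V A v a) = smul V (ev a g) v"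
  unfolding evr_def by (intro slice_right_tens space_A V lin_eval)

text \<open>Injectivity of the map from A \<otimes> V to linear maps H \<rightarrow> V, since
  evaluations at finitely many points already form a dual basis of \<open>A\<close>.\<close>

lemma evl_eqI:
  assumes "t \<in> carrier (tensor_space A V)" "s \<in> carrier (tensor_space A V)"
    and "\<And>g. g \<in> carrier H \<Longrightarrow> evl V g t = evl V g s"
  shows "t = s"
proof -
  obtain B \<phi> where B: "dual_basis A B \<phi> (\<lambda>b p. ev p b)" "\<And>b. b \<in> B \<Longrightarrow> b \<in> carrier H \<and> \<phi> b \<in> carrier A"
    using dual_basis_A by metis
  show ?thesis
    by (rule tensor_eqI_left[OF space_A V B(1) assms(1,2)]) (use assms(3) B(2) in \<open>auto simp: evl_def\<close>)
qed

lemma evr_eqI: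
  assumes "t \<in> carrier (tensor_space V A)" "s \<in> carrier (tensor_space V A)"
    and "\<And>g. g \<in> carrier H \<Longrightarrow> evr V g t = evr V g s"
  shows "t = s"
proof -
  obtain B \<phi> where B: "dual_basis A B \<phi> (\<lambda>b p. ev p b)" "\<And>b. b \<in> B \<Longrightarrow> b \<in> carrier H \<and> \<phi> b \<in> carrier A"
    using dual_basis_A by metis
  show ?thesis
    by (rule tensor_eqI_right[OF V space_A B(1) assms(1,2)]) (use assms(3) B(2) in \<open>auto simp: evr_def\<close>)
qed

text \<open>Surjectivity of the same map. The preimage of \<open>f\<close> is the sum of the tensors
  \<phi> b \<otimes> f b over a dual basis, which is finite because \<open>H\<close> is finite
  dimensional.\<close>

lemma evl_exists:
  assumes f: "lin H V f"
  obtains t where "t \<in> carrier (tensor_space A V)" "\<And>g. g \<in> carrier H \<Longrightarrow> evl V g t = f g"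
proof -
  obtain B \<phi> where B: "dual_basis H B (\<lambda>b. b) (\<lambda>b. ev (\<phi> b))" "\<And>b. b \<in> B \<Longrightarrow> b \<in> carrier H \<and> \<phi> b \<in> carrier A"
    using dual_basis_A by metis
  show ?thesis
  proof
    have c: "tens A V (\<phi> b) (f b) \<in> carrier (tensor_space A V)" if "b \<in> B" for b
      using that B(2) by (intro tens_closed space_A V lin_closed[OF f]) auto
    show "(\<Sum>b\<in>B. tens A V (\<phi> b) (f b)) \<in> carrier (tensor_space A V)"
      by (intro space_sum is_space_tensor space_A V c)
    fix g assume g: "g \<in> carrier H"
    have "evl V g (\<Sum>b\<in>B. tens A V (\<phi> b) (f b)) = (\<Sum>b\<in>B. f (smul H (ev (\<phi> b) g) b))"
      by (subst lin_sum[OF is_space_tensor[OF space_A V] lin_evl[OF g]], erule c, intro sum.cong)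
        (use B(2) g in \<open>auto simp: evl_tens lin_closed[OF f] lin_smul[OF f]\<close>)
    also have "\<dots> = f (\<Sum>b\<in>B. smul H (ev (\<phi> b) g) b)"
      by (rule lin_sum[OF space_H f, symmetric]) (simp add: B(2) space_smul)
    finally show "evl V g (\<Sum>b\<in>B. tens A V (\<phi> b) (f b)) = f g"
      using B(1) g by (simp add: dual_basis_def)
  qed
qed

lemma evr_exists:
  assumes f: "lin H V f"
  obtains t where "t \<in> carrier (tensor_space V A)" "\<And>g. g \<in> carrier H \<Longrightarrow> evr V g t = f g"
proof -
  obtain B \<phi> where B: "dual_basis H B (\<lambda>b. b) (\<lambda>b. ev (\<phi> b))" "\<And>b. b \<in> B \<Longrightarrow> b \<in> carrier H \<and> \<phi> b \<in> carrier A"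
    using dual_basis_A by metis
  show ?thesis
  proof
    have c: "tens V A (f b) (\<phi> b) \<in> carrier (tensor_space V A)" if "b \<in> B" for b
      using that B(2) by (intro tens_closed space_A V lin_closed[OF f]) auto
    show "(\<Sum>b\<in>B. tens V A (f b) (\<phi> b)) \<in> carrier (tensor_space V A)"
      by (intro space_sum is_space_tensor space_A V c)
    fix g assume g: "g \<in> carrier H"
    have "evr V g (\<Sum>b\<in>B. tens V A (f b) (\<phi> b)) = (\<Sum>b\<in>B. f (smul H (ev (\<phi> b) g) b))"
      by (subst lin_sum[OF is_space_tensor[OF V space_A] lin_evr[OF g]], erule c, intro sum.cong)
        (use B(2) g in \<open>auto simp: evr_tens lin_closed[OF f] lin_smul[OF f]\<close>)
    also have "\<dots> = f (\<Sum>b\<in>B. smul H (ev (\<phi> b) g) b)"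
      by (rule lin_sum[OF space_H f, symmetric]) (simp add: B(2) space_smul)
    finally show "evr V g (\<Sum>b\<in>B. tens V A (f b) (\<phi> b)) = f g"
      using B(1) g by (simp add: dual_basis_def)
  qed
qed

end

section \<open>The coproduct of the dual through evaluations\<close>

lemma lift_A_A:
  assumes t: "t \<in> carrier A2" and h: "h \<in> carrier H" and h': "h' \<in> carrier H"
  shows "lift A A (\<lambda>p1 p2. ev p1 h * ev p2 h') t = ev (evl A h t) h'"
    and "lift A A (\<lambda>p1 p2. ev p1 h * ev p2 h') t = ev (evr A h' t) h"
proof -
  have "ev (evl A h t) h' = lift A A (\<lambda>p1 p2. ev (smul A (ev p1 h) p2) h') t"
    unfolding evl_def slice_left_def
    by (rule lin_apply_lift[where X = A and Y = field_space])
       (auto intro!: lin_intros lin_A_intros simp: t h h')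
  then show "lift A A (\<lambda>p1 p2. ev p1 h * ev p2 h') t = ev (evl A h t) h'" by simp
  have "ev (evr A h' t) h = lift A A (\<lambda>p1 p2. ev (smul A (ev p2 h') p1) h) t"
    unfolding evr_def slice_right_def
    by (rule lin_apply_lift[where X = A and Y = field_space])
       (auto intro!: lin_intros lin_A_intros simp: t h h')
  then show "lift A A (\<lambda>p1 p2. ev p1 h * ev p2 h') t = ev (evr A h' t) h" by (simp add: mult.commute)
qed

text \<open>Read for fixed \<open>h\<close>, the pairing condition in the definition of the
  coproduct says that evaluating the first leg at \<open>h\<close> leaves p \<leftharpoonup> h. A
  tensor with these evaluations exists by \<open>evl_exists\<close> and is unique by
  \<open>evl_eqI\<close>, so the definite description is legitimate.\<close>

lemma comult_A:
  assumes p: "p \<in> carrier A"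
  shows "comult A p \<in> carrier A2"
    and "h \<in> carrier H \<Longrightarrow> evl A h (comult A p) = rreg H p h"
    and "h \<in> carrier H \<Longrightarrow> evr A h (comult A p) = lreg H h p"
proof -
  \<comment> \<open>The coproduct is defined over \<open>dual_space H\<close>, a smaller record with
    the same carrier and scalars as \<open>A\<close>.\<close>
  have eq: "tensor_space (dual_space H) (dual_space H) = A2"
    "lift (dual_space H) (dual_space H) = (lift A A :: ((_ \<Rightarrow> _ \<Rightarrow> 'k) \<Rightarrow> _))"
    by (rule tensor_space_eq_space lift_eq_space; simp add: dual_hopf_def)+
  let ?P = "\<lambda>t. t \<in> carrier A2 \<and>
    (\<forall>h\<in>carrier H. \<forall>h'\<in>carrier H. lift A A (\<lambda>p1 p2. p1 h * p2 h') t = p (mult H h h'))"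
  have l: "lift A A (\<lambda>p1 p2. p1 h * p2 h') t = ev (evl A h t) h'"
    if "t \<in> carrier A2" "h \<in> carrier H" "h' \<in> carrier H" for t h h'
    using lift_A_A(1)[OF that] by (simp add: ev_def)
  have ev_closed: "evl A h t \<in> carrier A" "evr A h t \<in> carrier A"
    if "t \<in> carrier A2" "h \<in> carrier H" for t h
    using that lin_closed[OF lin_evl[OF space_A]] lin_closed[OF lin_evr[OF space_A]] by auto
  have P: "?P t \<longleftrightarrow> t \<in> carrier A2 \<and> (\<forall>h\<in>carrier H. evl A h t = rreg H p h)" for t
    using p by (auto simp: l rreg ev_closed ev_def[of p, symmetric] intro!: A_eqI)
  have "lin H A (rreg H p)" by (rule bilin_lin_right[OF bilin_rreg p])
  then obtain t where t: "?P t" using evl_exists[OF space_A] unfolding P by metis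
  have "s = t" if "?P s" for s
    using that t unfolding P by (metis evl_eqI[OF space_A])
  then have "(THE t. ?P t) = t" using t by (intro the_equality)
  moreover have "comult A p = (THE t. t \<in> carrier (tensor_space (dual_space H) (dual_space H)) \<and>
    (\<forall>h\<in>carrier H. \<forall>h'\<in>carrier H.
      lift (dual_space H) (dual_space H) (\<lambda>p1 p2. p1 h * p2 h') t = p (mult H h h')))"
    by (simp only: dual_hopf_def hopf.simps)
  ultimately have "comult A p = t" unfolding eq by simp
  with t have c: "?P (comult A p)" by simp
  then show c1: "comult A p \<in> carrier A2"
    and e: "\<And>h. h \<in> carrier H \<Longrightarrow> evl A h (comult A p) = rreg H p h"
    unfolding P by blast+
  show "h \<in> carrier H \<Longrightarrow> evr A h (comult A p) = lreg H h p"
  proof (rule A_eqI)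
    fix x assume h: "h \<in> carrier H" and x: "x \<in> carrier H"
    have "ev (evr A h (comult A p)) x = ev (evl A x (comult A p)) h"
      using lift_A_A[OF c1 x h] by simp
    then show "ev (evr A h (comult A p)) x = ev (lreg H h p) x"
      by (simp add: e lreg rreg h x)
  qed (use p c1 in \<open>auto intro: ev_closed\<close>)
qed

lemma lin_comult_A [simp]: "lin_comult A"
  unfolding lin_comult_def
proof (intro conjI linI space_A)
  note T = is_space_tensor[OF space_A space_A]
  fix p q c assume p: "p \<in> carrier A"
  show "comult A p \<in> carrier A2" by (rule comult_A[OF p])
  show "comult A (smul A c p) = smul A2 c (comult A p)"
    by (rule evl_eqI[OF space_A])
      (simp_all add: comult_A p space_smul T lin_smul[OF lin_evl] lin_smul[OF bilin_lin_left[OF bilin_rreg]])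
  assume q: "q \<in> carrier A"
  show "comult A (p + q) = comult A p + comult A q"
    by (rule evl_eqI[OF space_A])
      (simp_all only: comult_A p q space_add T space_A lin_add[OF lin_evl[OF space_A]] lin_add[OF bilin_lin_left[OF bilin_rreg]])
qed

text \<open>Evaluating a leg absorbs the coproduct of the dual into a regular action: the sum of
  p1(g) p2 is p \<leftharpoonup> g. With \<open>sw2_A_right\<close> this removes every coproduct of
  \<open>A\<close> from the Hopf bimodule condition.\<close>

lemma sw2_A_left:
  assumes X: "is_space X" and f: "lin A X f" and p: "p \<in> carrier A" and g: "g \<in> carrier H"
  shows "sw2 A (\<lambda>p1 p2. smul X (ev p1 g) (f p2)) p = f (rreg H p g)"
proof -
  have "f (rreg H p g) = sw2 A (\<lambda>p1 p2. f (smul A (ev p1 g) p2)) p"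
    unfolding comult_A(2)[OF p g, symmetric] sw2_def evl_def slice_left_def
    by (rule lin_apply_lift[where X = A and Y = X])
       (auto intro!: lin_intros lin_A_intros simp: X f comult_A p g)
  also have "\<dots> = sw2 A (\<lambda>p1 p2. smul X (ev p1 g) (f p2)) p"
    by (rule sw2_cong) (simp_all add: lin_smul[OF f])
  finally show ?thesis ..
qed

lemma sw2_A_right:
  assumes X: "is_space X" and f: "lin A X f" and p: "p \<in> carrier A" and g: "g \<in> carrier H"
  shows "sw2 A (\<lambda>p1 p2. smul X (ev p2 g) (f p1)) p = f (lreg H g p)"
proof -
  have "f (lreg H g p) = sw2 A (\<lambda>p1 p2. f (smul A (ev p2 g) p1)) p"
    unfolding comult_A(3)[OF p g, symmetric] sw2_def evr_def slice_right_def
    by (rule lin_apply_lift[where X = A and Y = X])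
       (auto intro!: lin_intros lin_A_intros simp: X f comult_A p g)
  also have "\<dots> = sw2 A (\<lambda>p1 p2. smul X (ev p2 g) (f p1)) p"
    by (rule sw2_cong) (simp_all add: lin_smul[OF f])
  finally show ?thesis ..
qed

lemma sw3_A:
  assumes X: "is_space X" and f: "lin A X f" and p: "p \<in> carrier A" and g: "g \<in> carrier H" and h: "h \<in> carrier H"
  shows "sw3 A (\<lambda>p1 p2 p3. smul X (ev p1 g * ev p3 h) (f p2)) p = f (lreg H h (rreg H p g))"
proof -
  have "sw3 A (\<lambda>p1 p2 p3. smul X (ev p1 g * ev p3 h) (f p2)) p =
      sw2 A (\<lambda>p1 x. smul X (ev p1 g) (f (lreg H h x))) p"
    unfolding sw3_def
  proof (rule sw2_cong)
    fix a b assume b: "b \<in> carrier A"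
    have l: "lin A X (\<lambda>x. smul X (ev a g) (f x))" by (intro lin_smul_right X f)
    show "sw2 A (\<lambda>p2 p3. smul X (ev a g * ev p3 h) (f p2)) b = smul X (ev a g) (f (lreg H h b))"
      using sw2_A_right[OF X l b h] by (simp add: smul_smul[OF X] mult.commute)
  qed simp
  also have "\<dots> = f (lreg H h (rreg H p g))"
    by (rule sw2_A_left[OF X _ p g]) (intro lin_comp[OF f] bilin_lin_right[OF bilin_lreg h])
  finally show ?thesis .
qed

lemma trilin_A:
  assumes X: "is_space X" and f: "lin A X f" and g: "g \<in> carrier H" and h: "h \<in> carrier H"
  shows "trilin A X (\<lambda>p1 p2 p3. smul X (ev p1 g * ev p3 h) (f p2))"
  by (intro trilinI lin_smul_left lin_smul_right lin_field_mult_left lin_field_mult_right X f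
      lin_eval g h lin_closed[OF f])

text \<open>The points depend on a summation index because they will be legs of coproducts in
  \<open>H\<close>. Writing the coproduct of \<open>p\<close> as a finite sum allows the two
  summations to be interchanged, after which \<open>sw3_A\<close> applies to each index.\<close>

lemma sw3_A_sum:
  assumes X: "is_space X" and f: "\<And>i. i \<in> I \<Longrightarrow> lin A X (f i)" and p: "p \<in> carrier A"
    and g: "\<And>i. i \<in> I \<Longrightarrow> g i \<in> carrier H" and h: "\<And>i. i \<in> I \<Longrightarrow> h i \<in> carrier H"
  shows "sw3 A (\<lambda>p1 p2 p3. \<Sum>i\<in>I. smul X (ev p1 (g i) * ev p3 (h i)) (f i p2)) p =
    (\<Sum>i\<in>I. f i (lreg H (h i) (rreg H p (g i))))"
proof -
  have t: "trilin A X (\<lambda>p1 p2 p3. smul X (ev p1 (g i) * ev p3 (h i)) (f i p2))" if "i \<in> I" for i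
    by (intro trilin_A X f g h that)
  have "trilin A X (\<lambda>p1 p2 p3. \<Sum>i\<in>I. smul X (ev p1 (g i) * ev p3 (h i)) (f i p2))"
    using t unfolding trilin_def by (intro ballI conjI lin_sum_fun X) auto
  from sw3_sum[OF lin_comult_A X this p]
  have "sw3 A (\<lambda>p1 p2 p3. \<Sum>i\<in>I. smul X (ev p1 (g i) * ev p3 (h i)) (f i p2)) p =
    (\<Sum>i\<in>I. \<Sum>s\<in>cop_index3 A p. smul X (ev (cop31 A p s) (g i) * ev (cop33 A p s) (h i)) (f i (cop32 A p s)))"
    by (simp add: sum.swap[of _ _ I])
  also have "\<dots> = (\<Sum>i\<in>I. f i (lreg H (h i) (rreg H p (g i))))"
    using sw3_sum[OF lin_comult_A X t p] sw3_A[OF X f p g h] by (intro sum.cong) simp_all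
  finally show ?thesis .
qed

section \<open>Coassociativity diagrams under evaluation\<close>

lemma tensor_A_space [simp]: "is_space V \<Longrightarrow> is_space (tensor_space A V)" "is_space V \<Longrightarrow> is_space (tensor_space V A)"
  by (intro is_space_tensor space_A, assumption)+

lemma evl_tmap:
  assumes V: "is_space V" and W: "is_space W" and f: "lin V W f" and g: "g \<in> carrier H"
    and t: "t \<in> carrier (tensor_space A V)"
  shows "evl W g (tmap A V A W id f t) = f (evl V g t)"
  by (rule tensor_ext[OF space_A V lin_comp[OF lin_evl[OF W g] lin_tmap[OF space_A V space_A W lin_identity f]]
        lin_comp[OF f lin_evl[OF V g]] _ t])
    (simp add: tmap_tens[OF space_A V space_A W lin_identity f] evl_tens V W g lin_closed[OF f] lin_smul[OF f])

lemma evr_tmap: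
  assumes V: "is_space V" and W: "is_space W" and f: "lin V W f" and g: "g \<in> carrier H"
    and t: "t \<in> carrier (tensor_space V A)"
  shows "evr W g (tmap V A W A f id t) = f (evr V g t)"
  by (rule tensor_ext[OF V space_A lin_comp[OF lin_evr[OF W g] lin_tmap[OF V space_A W space_A f lin_identity]]
        lin_comp[OF f lin_evr[OF V g]] _ t])
    (simp add: tmap_tens[OF V space_A W space_A f lin_identity] evr_tens V W g lin_closed[OF f] lin_smul[OF f])

text \<open>The pairing of A \<otimes> A with g \<otimes> h. On a coproduct it gives p(gh), which is
  how coassociativity becomes associativity of an action.\<close>

definition ev2 :: "'h \<Rightarrow> 'h \<Rightarrow> ('k, 'h \<Rightarrow> 'k, 'h \<Rightarrow> 'k) tensor \<Rightarrow> 'k" where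
  "ev2 g h = lift A A (\<lambda>a b. ev a g * ev b h)"

lemma lin_ev2: "g \<in> carrier H \<Longrightarrow> h \<in> carrier H \<Longrightarrow> lin A2 field_space (ev2 g h)"
  unfolding ev2_def by (intro lin_tensor_form(2) space_A lin_eval)

lemma ev2_comult: "p \<in> carrier A \<Longrightarrow> g \<in> carrier H \<Longrightarrow> h \<in> carrier H \<Longrightarrow> ev2 g h (comult A p) = ev p (mult H g h)"
  unfolding ev2_def by (simp add: lift_A_A(1) comult_A rreg)

lemma slice_left_comult:
  assumes V: "is_space V" and g: "g \<in> carrier H" and h: "h \<in> carrier H" and t: "t \<in> carrier (tensor_space A V)"
  shows "slice_left A2 V (ev2 g h) (tmap A V A2 V (comult A) id t) =
    evl V (mult H g h) t"
proof -
  note D = lin_comult[OF lin_comult_A]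
  note AA = is_space_tensor[OF space_A space_A]
  show ?thesis
    by (rule tensor_ext[OF space_A V lin_comp[OF lin_slice_left[OF AA V lin_ev2[OF g h]] lin_tmap[OF space_A V AA V D lin_identity]]
        lin_evl[OF V] _ t])
      (simp_all add: tmap_tens[OF space_A V AA V D lin_identity] slice_left_tens[OF AA V lin_ev2] lin_closed[OF D]
        evl_tens V g h ev2_comult)
qed

lemma slice_right_comult:
  assumes V: "is_space V" and g: "g \<in> carrier H" and h: "h \<in> carrier H" and t: "t \<in> carrier (tensor_space V A)"
  shows "slice_right V A2 (ev2 g h) (tmap V A V A2 id (comult A) t) =
    evr V (mult H g h) t"
proof -
  note D = lin_comult[OF lin_comult_A]
  note AA = is_space_tensor[OF space_A space_A]
  show ?thesis
    by (rule tensor_ext[OF V space_A lin_comp[OF lin_slice_right[OF V AA lin_ev2[OF g h]] lin_tmap[OF V space_A V AA lin_identity D]]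
        lin_evr[OF V] _ t])
      (simp_all add: tmap_tens[OF V space_A V AA lin_identity D] slice_right_tens[OF V AA lin_ev2] lin_closed[OF D]
        evr_tens V g h ev2_comult)
qed

context
  fixes V :: "('k, 'v::ab_group_add, 'x) space_scheme"
  assumes V: "is_space V"
begin

text \<open>The associator disappears under evaluation. After it, the outer leg receives
  \<open>g\<close> and the inner one \<open>h\<close>; before it, both legs sit in A \<otimes> A and
  are paired with \<open>ev2 g h\<close>.\<close>

lemma evl_tassoc:
  assumes g: "g \<in> carrier H" and h: "h \<in> carrier H" and t: "t \<in> carrier (tensor_space A2 V)"
  shows "evl V h (evl (tensor_space A V) g (tassoc A A V t)) = slice_left A2 V (ev2 g h) t"
proof -
  note AA = is_space_tensor[OF space_A space_A]
  have F: "lin (tensor_space A (tensor_space A V)) V (\<lambda>x. evl V h (evl (tensor_space A V) g x))"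
    by (intro lin_comp[OF lin_evl lin_evl]) (simp_all add: V g h)
  show ?thesis
  proof (rule tensor_ext[OF AA V lin_comp[OF F lin_tassoc[OF space_A space_A V]] lin_slice_left[OF AA V lin_ev2[OF g h]] _ t])
    fix s v assume s: "s \<in> carrier A2" and v: "v \<in> carrier V"
    have b: "bilin A A (tensor_space A (tensor_space A V)) (\<lambda>a b. tens A (tensor_space A V) a (tens A V b v))"
      by (rule bilin_tassoc_inner[OF space_A space_A V v])
    have "evl V h (evl (tensor_space A V) g (tassoc A A V (tens A2 V s v))) =
      evl V h (evl (tensor_space A V) g (lift A A (\<lambda>a b. tens A (tensor_space A V) a (tens A V b v)) s))"
      by (simp add: tassoc_tens V s v)
    also have "\<dots> = lift A A (\<lambda>a b. evl V h (evl (tensor_space A V) g (tens A (tensor_space A V) a (tens A V b v)))) s"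
      by (rule lin_apply_lift[OF space_A space_A _ V F b s]) (simp add: V)
    also have "\<dots> = lift A A (\<lambda>a b. smul V (ev a g * ev b h) v) s"
      by (rule fun_cong[OF lift_cong[OF space_A space_A]])
        (simp add: evl_tens V tens_closed v g h lin_smul[OF lin_evl] smul_smul)
    also have "\<dots> = smul V (ev2 g h s) v"
      unfolding ev2_def
      by (rule lin_apply_lift[symmetric, where f = "\<lambda>c. smul V c v" and X = field_space and Y = V])
        (auto intro!: lin_intros lin_A_intros simp: V v s g h)
    also have "\<dots> = slice_left A2 V (ev2 g h) (tens A2 V s v)"
      by (simp add: slice_left_tens[OF AA V lin_ev2[OF g h] s v])
    finally show "evl V h (evl (tensor_space A V) g (tassoc A A V (tens A2 V s v))) =
      slice_left A2 V (ev2 g h) (tens A2 V s v)" .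
  qed
qed

lemma evr_tassoc:
  assumes g: "g \<in> carrier H" and h: "h \<in> carrier H" and t: "t \<in> carrier (tensor_space (tensor_space V A) A)"
  shows "slice_right V A2 (ev2 g h) (tassoc V A A t) = evr V g (evr (tensor_space V A) h t)"
proof -
  note AA = is_space_tensor[OF space_A space_A]
  note VA = is_space_tensor[OF V space_A]
  note F = lin_slice_right[OF V AA lin_ev2[OF g h]]
  have G: "lin (tensor_space (tensor_space V A) A) V (\<lambda>x. evr V g (evr (tensor_space V A) h x))"
    by (intro lin_comp[OF lin_evr lin_evr]) (simp_all add: V g h)
  show ?thesis
  proof (rule tensor_ext[OF VA space_A lin_comp[OF F lin_tassoc[OF V space_A space_A]] G _ t])
    fix s c assume s: "s \<in> carrier (tensor_space V A)" and c: "c \<in> carrier A"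
    have b: "bilin V A (tensor_space V A2) (\<lambda>v a. tens V A2 v (tens A A a c))"
      by (rule bilin_tassoc_inner[OF V space_A space_A c])
    have "slice_right V A2 (ev2 g h) (tassoc V A A (tens (tensor_space V A) A s c)) =
      slice_right V A2 (ev2 g h) (lift V A (\<lambda>v a. tens V A2 v (tens A A a c)) s)"
      by (simp add: tassoc_tens V s c)
    also have "\<dots> = lift V A (\<lambda>v a. slice_right V A2 (ev2 g h) (tens V A2 v (tens A A a c))) s"
      by (rule lin_apply_lift[OF V space_A _ V F b s]) (simp add: V is_space_tensor)
    also have "\<dots> = lift V A (\<lambda>v a. smul V (ev c h) (smul V (ev a g) v)) s"
    proof (rule fun_cong[OF lift_cong[OF V space_A]])
      fix v a assume v: "v \<in> carrier V" and a: "a \<in> carrier A"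
      have "ev2 g h (tens A A a c) = ev a g * ev c h"
        unfolding ev2_def
        by (rule lift_tens[OF space_A space_A is_space_field lin_tensor_form(1)]) (simp_all add: lin_eval a c g h)
      then show "slice_right V A2 (ev2 g h) (tens V A2 v (tens A A a c)) =
          smul V (ev c h) (smul V (ev a g) v)"
        by (simp add: slice_right_tens[OF V AA lin_ev2[OF g h] v] tens_closed a c smul_smul V mult.commute)
    qed
    also have "\<dots> = smul V (ev c h) (evr V g s)"
      unfolding evr_def slice_right_def
      by (rule lin_apply_lift[symmetric, where X = V and Y = V])
        (auto intro!: lin_intros lin_A_intros simp: V s g h)
    also have "\<dots> = evr V g (evr (tensor_space V A) h (tens (tensor_space V A) A s c))"
      by (simp add: evr_tens V s c g h lin_smul[OF lin_evr])
    finally show "slice_right V A2 (ev2 g h) (tassoc V A A (tens (tensor_space V A) A s c)) =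
      evr V g (evr (tensor_space V A) h (tens (tensor_space V A) A s c))" .
  qed
qed

lemma evlr_tassoc:
  assumes g: "g \<in> carrier H" and h: "h \<in> carrier H" and t: "t \<in> carrier (tensor_space (tensor_space A V) A)"
  shows "evr V h (evl (tensor_space V A) g (tassoc A V A t)) = evl V g (evr (tensor_space A V) h t)"
proof -
  note AV = is_space_tensor[OF space_A V]
  have F: "lin (tensor_space A (tensor_space V A)) V (\<lambda>x. evr V h (evl (tensor_space V A) g x))"
    by (intro lin_comp[OF lin_evr lin_evl]) (simp_all add: V g h)
  have G: "lin (tensor_space (tensor_space A V) A) V (\<lambda>x. evl V g (evr (tensor_space A V) h x))"
    by (intro lin_comp[OF lin_evl lin_evr]) (simp_all add: V g h)
  show ?thesis
  proof (rule tensor_ext[OF AV space_A lin_comp[OF F lin_tassoc[OF space_A V space_A]] G _ t])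
    fix s c assume s: "s \<in> carrier (tensor_space A V)" and c: "c \<in> carrier A"
    have b: "bilin A V (tensor_space A (tensor_space V A)) (\<lambda>a v. tens A (tensor_space V A) a (tens V A v c))"
      by (rule bilin_tassoc_inner[OF space_A V space_A c])
    have "evr V h (evl (tensor_space V A) g (tassoc A V A (tens (tensor_space A V) A s c))) =
      evr V h (evl (tensor_space V A) g (lift A V (\<lambda>a v. tens A (tensor_space V A) a (tens V A v c)) s))"
      by (simp add: tassoc_tens V s c)
    also have "\<dots> = lift A V (\<lambda>a v. evr V h (evl (tensor_space V A) g (tens A (tensor_space V A) a (tens V A v c)))) s"
      by (rule lin_apply_lift[OF space_A V _ V F b s]) (simp add: V)
    also have "\<dots> = lift A V (\<lambda>a v. smul V (ev c h) (smul V (ev a g) v)) s"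
      by (rule fun_cong[OF lift_cong[OF space_A V]])
        (simp add: evl_tens evr_tens V tens_closed c g h lin_smul[OF lin_evr] smul_smul mult.commute)
    also have "\<dots> = smul V (ev c h) (evl V g s)"
      unfolding evl_def slice_left_def
      by (rule lin_apply_lift[symmetric, where X = V and Y = V])
        (auto intro!: lin_intros lin_A_intros simp: V s g h)
    also have "\<dots> = evl V g (evr (tensor_space A V) h (tens (tensor_space A V) A s c))"
      by (simp add: evr_tens V s c g h lin_smul[OF lin_evl])
    finally show "evr V h (evl (tensor_space V A) g (tassoc A V A (tens (tensor_space A V) A s c))) =
      evl V g (evr (tensor_space A V) h (tens (tensor_space A V) A s c))" .
  qed
qed

lemma tensor_AAV_eqI:
  assumes "t \<in> carrier (tensor_space A (tensor_space A V))" "s \<in> carrier (tensor_space A (tensor_space A V))"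
    and "\<And>g h. g \<in> carrier H \<Longrightarrow> h \<in> carrier H \<Longrightarrow>
      evl V h (evl (tensor_space A V) g t) = evl V h (evl (tensor_space A V) g s)"
  shows "t = s"
  using assms by (intro evl_eqI[of "tensor_space A V" t s] evl_eqI[OF V])
    (simp_all add: V lin_closed[OF lin_evl])

lemma tensor_AVA_eqI:
  assumes "t \<in> carrier (tensor_space A (tensor_space V A))" "s \<in> carrier (tensor_space A (tensor_space V A))"
    and "\<And>g h. g \<in> carrier H \<Longrightarrow> h \<in> carrier H \<Longrightarrow>
      evr V h (evl (tensor_space V A) g t) = evr V h (evl (tensor_space V A) g s)"
  shows "t = s"
  using assms by (intro evl_eqI[of "tensor_space V A" t s] evr_eqI[OF V])
    (simp_all add: V lin_closed[OF lin_evl])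

text \<open>Here the two legs in \<open>A\<close> form one right factor and are not peeled off in
  turn, so separation uses the product dual basis of A \<otimes> A.\<close>

lemma tensor_VAA_eqI:
  assumes t: "t \<in> carrier (tensor_space V A2)" "s \<in> carrier (tensor_space V A2)"
    and eq: "\<And>g h. g \<in> carrier H \<Longrightarrow> h \<in> carrier H \<Longrightarrow>
      slice_right V A2 (ev2 g h) t = slice_right V A2 (ev2 g h) s"
  shows "t = s"
proof -
  obtain B \<phi> where B: "dual_basis A B \<phi> (\<lambda>b p. ev p b)" "\<And>b. b \<in> B \<Longrightarrow> b \<in> carrier H"
    using dual_basis_A by metis
  have *: "dual_basis A2 (B \<times> B) (\<lambda>(i, j). tens A A (\<phi> i) (\<phi> j)) (\<lambda>(i, j). ev2 i j)"
    using dual_basis_tensor[OF space_A space_A B(1) B(1)] by (simp add: ev2_def)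
  show ?thesis
    by (rule tensor_eqI_right[OF V is_space_tensor[OF space_A space_A] * t]) (auto simp: eq B(2))
qed

end

subsection \<open>Hopf bimodules as spaces with commuting actions\<close>

definition Lact :: "('k, 'h \<Rightarrow> 'k, 'm::ab_group_add) hopf_bimodule \<Rightarrow> 'h \<Rightarrow> 'm \<Rightarrow> 'm" where
  "Lact M h m = evr M h (rcoact M m)"

definition Ract :: "('k, 'h \<Rightarrow> 'k, 'm::ab_group_add) hopf_bimodule \<Rightarrow> 'm \<Rightarrow> 'h \<Rightarrow> 'm" where
  "Ract M m g = evl M g (lcoact M m)"

definition two_sided :: "('k, 'm::ab_group_add, 'x) space_scheme \<Rightarrow> ('h \<Rightarrow> 'm \<Rightarrow> 'm) \<Rightarrow> ('m \<Rightarrow> 'h \<Rightarrow> 'm) \<Rightarrow> bool" where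
  "two_sided V L R \<longleftrightarrow> bilin H V V L \<and> bilin V H V R \<and>
     (\<forall>m\<in>carrier V. L (one H) m = m \<and> R m (one H) = m) \<and>
     (\<forall>g\<in>carrier H. \<forall>h\<in>carrier H. \<forall>m\<in>carrier V.
        L (mult H g h) m = L g (L h m) \<and> R m (mult H g h) = R (R m g) h \<and> R (L h m) g = L h (R m g))"

text \<open>Both sides of each coaction axiom are compared under evaluation of all legs in
  \<open>A\<close>, which loses nothing. The three coassociativity equations become the three
  associativity laws of an \<open>H\<close>-bimodule, and the counit axioms become its unit
  laws.\<close>

lemma bicomodule_iff:
  fixes M :: "('k, 'h \<Rightarrow> 'k, 'm::ab_group_add) hopf_bimodule"
  shows "is_bicomodule A M \<longleftrightarrow> is_space M \<and> lin M (tensor_space A M) (lcoact M) \<and> lin M (tensor_space M A) (rcoact M) \<and>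
     lcoact M \<in> extensional (carrier M) \<and> rcoact M \<in> extensional (carrier M) \<and> two_sided M (Lact M) (Ract M)"
    (is "_ \<longleftrightarrow> ?R")
proof (cases "is_space M \<and> lin M (tensor_space A M) (lcoact M) \<and> lin M (tensor_space M A) (rcoact M)")
  case True
  then have M: "is_space M" and l: "lin M (tensor_space A M) (lcoact M)" and r: "lin M (tensor_space M A) (rcoact M)" by auto
  note D = lin_comult[OF lin_comult_A]
  note AA = is_space_tensor[OF space_A space_A]
  note AM = is_space_tensor[OF space_A M]
  note MA = is_space_tensor[OF M space_A]
  note lc = lin_closed[OF l] and rc = lin_closed[OF r]
  have bL: "bilin H M M (Lact M)" unfolding Lact_def
    by (intro bilinI lin_evr_arg[OF M] lin_comp[OF lin_evr[OF M] r] rc)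
  have bR: "bilin M H M (Ract M)" unfolding Ract_def
    by (intro bilinI lin_evl_arg[OF M] lin_comp[OF lin_evl[OF M] l] lc)
  \<comment> \<open>Left coassociativity. Evaluation at g in the outer and h in the inner leg gives
    m \<cdot> (gh) on one side and (m \<cdot> g) \<cdot> h on the other, hence a right
    action.\<close>
  have 1: "tassoc A A M (tmap A M A2 M (comult A) id (lcoact M m)) =
          tmap A M A (tensor_space A M) id (lcoact M) (lcoact M m) \<longleftrightarrow>
     (\<forall>g\<in>carrier H. \<forall>h\<in>carrier H. Ract M m (mult H g h) = Ract M (Ract M m g) h)" (is "?s = ?t \<longleftrightarrow> _")
    if m: "m \<in> carrier M" for m
  proof -
    have c: "tmap A M A2 M (comult A) id (lcoact M m) \<in> carrier (tensor_space A2 M)"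
      by (rule lin_closed[OF lin_tmap[OF space_A M AA M D lin_identity] lc[OF m]])
    have s: "evl M h (evl (tensor_space A M) g ?s) = Ract M m (mult H g h)"
      and t: "evl M h (evl (tensor_space A M) g ?t) = Ract M (Ract M m g) h"
      if g: "g \<in> carrier H" and h: "h \<in> carrier H" for g h
      using evl_tassoc[OF M g h c] slice_left_comult[OF M g h lc[OF m]] evl_tmap[OF M AM l g lc[OF m]]
      by (simp_all add: Ract_def)
    have sc: "?s \<in> carrier (tensor_space A (tensor_space A M))"
      by (rule lin_closed[OF lin_tassoc[OF space_A space_A M] c])
    have tc: "?t \<in> carrier (tensor_space A (tensor_space A M))"
      by (rule lin_closed[OF lin_tmap[OF space_A M space_A AM lin_identity l] lc[OF m]])
    show ?thesis using tensor_AAV_eqI[OF M sc tc] s t by metis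
  qed
  \<comment> \<open>Right coassociativity. The last leg is evaluated at h and comes from the first
    coaction, so h acts before g and the action is a left one.\<close>
  have 2: "tassoc M A A (tmap M A (tensor_space M A) A (rcoact M) id (rcoact M m)) =
          tmap M A M A2 id (comult A) (rcoact M m) \<longleftrightarrow>
     (\<forall>g\<in>carrier H. \<forall>h\<in>carrier H. Lact M (mult H g h) m = Lact M g (Lact M h m))" (is "?s = ?t \<longleftrightarrow> _")
    if m: "m \<in> carrier M" for m
  proof -
    have c: "tmap M A (tensor_space M A) A (rcoact M) id (rcoact M m) \<in> carrier (tensor_space (tensor_space M A) A)"
      by (rule lin_closed[OF lin_tmap[OF M space_A MA space_A r lin_identity] rc[OF m]])
    have t: "slice_right M A2 (ev2 g h) ?t = Lact M (mult H g h) m"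
      and s: "slice_right M A2 (ev2 g h) ?s = Lact M g (Lact M h m)"
      if g: "g \<in> carrier H" and h: "h \<in> carrier H" for g h
      using evr_tassoc[OF M g h c] slice_right_comult[OF M g h rc[OF m]] evr_tmap[OF M MA r h rc[OF m]]
      by (simp_all add: Lact_def)
    have sc: "?s \<in> carrier (tensor_space M A2)"
      by (rule lin_closed[OF lin_tassoc[OF M space_A space_A] c])
    have tc: "?t \<in> carrier (tensor_space M A2)"
      by (rule lin_closed[OF lin_tmap[OF M space_A M AA lin_identity D] rc[OF m]])
    show ?thesis using tensor_VAA_eqI[OF M sc tc] s t by metis
  qed
  \<comment> \<open>Commutation of the two coactions becomes commutation of the two actions.\<close>
  have 3: "tassoc A M A (tmap M A (tensor_space A M) A (lcoact M) id (rcoact M m)) =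
          tmap A M A (tensor_space M A) id (rcoact M) (lcoact M m) \<longleftrightarrow>
     (\<forall>g\<in>carrier H. \<forall>h\<in>carrier H. Ract M (Lact M h m) g = Lact M h (Ract M m g))" (is "?s = ?t \<longleftrightarrow> _")
    if m: "m \<in> carrier M" for m
  proof -
    have c: "tmap M A (tensor_space A M) A (lcoact M) id (rcoact M m) \<in> carrier (tensor_space (tensor_space A M) A)"
      by (rule lin_closed[OF lin_tmap[OF M space_A AM space_A l lin_identity] rc[OF m]])
    have t: "evr M h (evl (tensor_space M A) g ?t) = Lact M h (Ract M m g)"
      and s: "evr M h (evl (tensor_space M A) g ?s) = Ract M (Lact M h m) g"
      if g: "g \<in> carrier H" and h: "h \<in> carrier H" for g h
      using evlr_tassoc[OF M g h c] evl_tmap[OF M MA r g lc[OF m]] evr_tmap[OF M AM l h rc[OF m]]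
      by (simp_all add: Lact_def Ract_def)
    have sc: "?s \<in> carrier (tensor_space A (tensor_space M A))"
      by (rule lin_closed[OF lin_tassoc[OF space_A M space_A] c])
    have tc: "?t \<in> carrier (tensor_space A (tensor_space M A))"
      by (rule lin_closed[OF lin_tmap[OF space_A M space_A MA lin_identity r] lc[OF m]])
    show ?thesis using tensor_AVA_eqI[OF M sc tc] s t by metis
  qed
  \<comment> \<open>The counit of \<open>A\<close> is evaluation at the unit of \<open>H\<close>, so
    these are equalities by unfolding.\<close>
  have 4: "lift A M (\<lambda>a m0. smul M (counit A a) m0) (lcoact M m) = Ract M m (one H)"
    "lift M A (\<lambda>m0 a. smul M (counit A a) m0) (rcoact M m) = Lact M (one H) m" for m
    by (simp_all add: Ract_def Lact_def evl_def evr_def slice_left_def slice_right_def counit_A)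
  show ?thesis
    unfolding is_bicomodule_def two_sided_def 4 using M l r bL bR 1 2 3 by (auto simp: 1 2 3)
qed (auto simp: is_bicomodule_def)

text \<open>The legs of h and g are taken from the fixed representatives of their coproducts. The
  condition extracted from Hopf bimodules and the product of \<open>Z\<close> use the same ones, so
  they match without any change of representative.\<close>

definition compat :: "('k, 'm::ab_group_add, 'x) space_scheme \<Rightarrow> (('h \<Rightarrow> 'k) \<Rightarrow> 'm \<Rightarrow> 'm) \<Rightarrow> ('m \<Rightarrow> ('h \<Rightarrow> 'k) \<Rightarrow> 'm) \<Rightarrow>
    ('h \<Rightarrow> 'm \<Rightarrow> 'm) \<Rightarrow> ('m \<Rightarrow> 'h \<Rightarrow> 'm) \<Rightarrow> bool" where
  "compat V l r L R \<longleftrightarrow>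
     (\<forall>p\<in>carrier A. \<forall>q\<in>carrier A. \<forall>m\<in>carrier V. \<forall>h\<in>carrier H. \<forall>g\<in>carrier H.
        L h (R (r (l p m) q) g) =
          (\<Sum>(s, t)\<in>cop_index3 H h \<times> cop_index3 H g.
             r (l (lreg H (cop31 H h s) (rreg H p (cop31 H g t))) (L (cop32 H h s) (R m (cop32 H g t))))
               (lreg H (cop33 H h s) (rreg H q (cop33 H g t)))))"

text \<open>The convolution product is nested to the left and \<open>sw3\<close> to the right;
  coassociativity of \<open>H\<close> mediates through \<open>sw3_assoc\<close>.\<close>

lemma ev_mult3:
  assumes p: "p \<in> carrier A" and a: "a \<in> carrier A" and q: "q \<in> carrier A" and g: "g \<in> carrier H"
  shows "ev (mult A (mult A p a) q) g =
    (\<Sum>t\<in>cop_index3 H g. ev p (cop31 H g t) * ev a (cop32 H g t) * ev q (cop33 H g t))"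
proof -
  have t: "trilin H field_space (\<lambda>g1 g2 g3. ev p g1 * ev a g2 * ev q g3)"
    by (intro lin_intros lin_A_intros p a q)
  have "ev (mult A (mult A p a) q) g = sw2 H (\<lambda>x g3. sw2 H (\<lambda>g1 g2. ev p g1 * ev a g2 * ev q g3) x) g"
    unfolding mult_A[OF g]
  proof (rule sw2_cong)
    fix x c assume x: "x \<in> carrier H" and c: "c \<in> carrier H"
    show "ev (mult A p a) x * ev q c = sw2 H (\<lambda>g1 g2. ev p g1 * ev a g2 * ev q c) x"
      unfolding mult_A[OF x]
      by (rule apply_sw2[where X = field_space and Y = field_space and f = "\<lambda>y. y * ev q c"])
        (auto intro!: lin_intros lin_A_intros simp: p a q x c)
  qed simp
  also have "\<dots> = sw3 H (\<lambda>g1 g2 g3. ev p g1 * ev a g2 * ev q g3) g"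
    by (rule sw3_assoc[OF coalgebra_H is_space_field t g])
  finally show ?thesis by (simp add: sw3_sum[OF lin_comult_H is_space_field t g])
qed

section \<open>Evaluating the Hopf bimodule condition\<close>

context
  fixes M :: "('k, 'h \<Rightarrow> 'k, 'm::ab_group_add) hopf_bimodule"
  assumes M [simp]: "is_space M" and bl: "bilin A M M (lact M)" and br: "bilin M A M (ract M)"
    and lc: "lin M (tensor_space A M) (lcoact M)" and rc: "lin M (tensor_space M A) (rcoact M)"
begin

lemma bilin_Lact: "bilin H M M (Lact M)"
  unfolding Lact_def
  by (intro bilinI lin_evr_arg[OF M] lin_comp[OF lin_evr[OF M] rc] lin_closed[OF rc])

lemma bilin_Ract: "bilin M H M (Ract M)"
  unfolding Ract_def
  by (intro bilinI lin_evl_arg[OF M] lin_comp[OF lin_evl[OF M] lc] lin_closed[OF lc])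

lemma bicoact_closed: "m \<in> carrier M \<Longrightarrow> bicoact A M m \<in> carrier (tensor_space A (tensor_space M A))"
  unfolding bicoact_def
  by (intro lin_closed[OF lin_tmap] lin_identity rc lin_closed[OF lc]) simp_all

lemma evl_bicoact: "m \<in> carrier M \<Longrightarrow> g \<in> carrier H \<Longrightarrow>
    evl (tensor_space M A) g (bicoact A M m) = rcoact M (Ract M m g)"
  unfolding bicoact_def Ract_def by (intro evl_tmap rc lin_closed[OF lc]) simp_all

text \<open>Evaluating the outer legs of the combined coaction at g and h leaves h \<cdot> (m
  \<cdot> g) in the middle. With \<open>f\<close> the map m0 \<mapsto> p \<cdot> m0 \<cdot> q this
  is also the formula for the action of \<open>Z\<close>.\<close>

lemma bisw_eval:
  assumes X: "is_space X" and f: "lin M X f" and g: "g \<in> carrier H" and h: "h \<in> carrier H" and m: "m \<in> carrier M"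
  shows "bisw A M (\<lambda>a m0 b. smul X (ev a g * ev b h) (f m0)) m = f (Lact M h (Ract M m g))"
proof -
  let ?T = "tensor_space M A"
  have T: "is_space ?T" by simp
  have F: "lin ?T X (\<lambda>t. f (evr M h t))" by (rule lin_comp[OF f lin_evr[OF M h]])
  have *: "lift M A (\<lambda>m0 b. smul X (ev a g * ev b h) (f m0)) t = f (evr M h (smul ?T (ev a g) t))"
    if t: "t \<in> carrier ?T" for a t
  proof -
    have "f (evr M h t) = lift M A (\<lambda>m0 b. f (smul M (ev b h) m0)) t"
      unfolding evr_def slice_right_def
      by (rule lin_apply_lift[OF M space_A M X f _ t]) (auto intro!: lin_intros lin_A_intros simp: h)
    then have "smul X (ev a g) (f (evr M h t)) = smul X (ev a g) (lift M A (\<lambda>m0 b. f (smul M (ev b h) m0)) t)"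
      by simp
    also have "\<dots> = lift M A (\<lambda>m0 b. smul X (ev a g) (f (smul M (ev b h) m0))) t"
      by (rule lin_apply_lift[OF M space_A X X lin_smul_right[OF X lin_id] _ t])
        (intro lin_intros lin_A_intros lin_comp[OF f]; simp add: h)
    also have "\<dots> = lift M A (\<lambda>m0 b. smul X (ev a g * ev b h) (f m0)) t"
      by (rule fun_cong[OF lift_cong[OF M space_A]]) (simp add: lin_smul[OF f] smul_smul[OF X])
    finally show ?thesis using lin_smul[OF F t] by simp
  qed
  have "bisw A M (\<lambda>a m0 b. smul X (ev a g * ev b h) (f m0)) m =
      lift A ?T (\<lambda>a t. f (evr M h (smul ?T (ev a g) t))) (bicoact A M m)"
    unfolding bisw_def by (rule fun_cong[OF lift_cong[OF space_A T]]) (rule *)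
  also have "\<dots> = f (evr M h (evl ?T g (bicoact A M m)))"
    unfolding evl_def slice_left_def
    by (rule lin_apply_lift[OF space_A T T X F _ bicoact_closed[OF m], symmetric])
      (intro lin_intros lin_A_intros; simp add: g)
  finally show ?thesis by (simp add: evl_bicoact m g Lact_def)
qed

lemma bilin_bisw_inner:
  assumes X: "is_space X" and 1: "\<And>m b. m \<in> carrier M \<Longrightarrow> b \<in> carrier A \<Longrightarrow> lin A X (\<lambda>a. \<gamma> a m b)"
    and 2: "\<And>a b. a \<in> carrier A \<Longrightarrow> b \<in> carrier A \<Longrightarrow> lin M X (\<lambda>m. \<gamma> a m b)"
    and 3: "\<And>a m. a \<in> carrier A \<Longrightarrow> m \<in> carrier M \<Longrightarrow> lin A X (\<lambda>b. \<gamma> a m b)"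
  shows "bilin A (tensor_space M A) X (\<lambda>a t. lift M A (\<lambda>m0 b. \<gamma> a m0 b) t)"
  by (intro lin_intros 1 2 3) (simp_all add: X)

text \<open>The points vary with the index because i will run over pairs of summands of the iterated
  coproducts of h and g.\<close>

lemma bisw_sum:
  assumes X: "is_space X" and f: "\<And>i. i \<in> I \<Longrightarrow> lin M X (f i)"
    and g: "\<And>i. i \<in> I \<Longrightarrow> g i \<in> carrier H" and h: "\<And>i. i \<in> I \<Longrightarrow> h i \<in> carrier H" and m: "m \<in> carrier M"
  shows "bisw A M (\<lambda>a m0 b. \<Sum>i\<in>I. smul X (ev a (g i) * ev b (h i)) (f i m0)) m =
    (\<Sum>i\<in>I. f i (Lact M (h i) (Ract M m (g i))))"
proof -
  let ?T = "tensor_space M A"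
  have T: "is_space ?T" by simp
  have b: "bilin M A X (\<lambda>m0 b. smul X (ev a (g i) * ev b (h i)) (f i m0))" if "i \<in> I" "a \<in> carrier A" for a i
    using that by (intro lin_intros lin_A_intros lin_comp[OF f] X g h lin_closed[OF f])
  have "bisw A M (\<lambda>a m0 b. \<Sum>i\<in>I. smul X (ev a (g i) * ev b (h i)) (f i m0)) m =
    lift A ?T (\<lambda>a t. \<Sum>i\<in>I. lift M A (\<lambda>m0 b. smul X (ev a (g i) * ev b (h i)) (f i m0)) t) (bicoact A M m)"
    unfolding bisw_def by (rule fun_cong[OF lift_cong[OF space_A T]]) (intro lift_sum[OF M space_A X] b)
  also have "\<dots> = (\<Sum>i\<in>I. bisw A M (\<lambda>a m0 b. smul X (ev a (g i) * ev b (h i)) (f i m0)) m)"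
    unfolding bisw_def
    by (intro lift_sum[OF space_A T X _ bicoact_closed[OF m]] bilin_bisw_inner X)
      (intro lin_intros lin_A_intros lin_comp[OF f] X g h lin_closed[OF f]; assumption)+
  also have "\<dots> = (\<Sum>i\<in>I. f i (Lact M (h i) (Ract M m (g i))))"
    by (intro sum.cong refl bisw_eval X f g h m)
  finally show ?thesis .
qed

lemma apply_bisw:
  assumes X: "is_space X" and Y: "is_space Y" and F: "lin X Y F"
    and 1: "\<And>m b. m \<in> carrier M \<Longrightarrow> b \<in> carrier A \<Longrightarrow> lin A X (\<lambda>a. \<gamma> a m b)"
    and 2: "\<And>a b. a \<in> carrier A \<Longrightarrow> b \<in> carrier A \<Longrightarrow> lin M X (\<lambda>m. \<gamma> a m b)"
    and 3: "\<And>a m. a \<in> carrier A \<Longrightarrow> m \<in> carrier M \<Longrightarrow> lin A X (\<lambda>b. \<gamma> a m b)"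
    and m: "m \<in> carrier M"
  shows "F (bisw A M \<gamma> m) = bisw A M (\<lambda>a m0 b. F (\<gamma> a m0 b)) m"
proof -
  let ?T = "tensor_space M A"
  have T: "is_space ?T" by simp
  have "F (bisw A M \<gamma> m) = lift A ?T (\<lambda>a t. F (lift M A (\<lambda>m0 b. \<gamma> a m0 b) t)) (bicoact A M m)"
    unfolding bisw_def
    by (intro lin_apply_lift[OF space_A T X Y F _ bicoact_closed[OF m]] bilin_bisw_inner X 1 2 3)
  also have "\<dots> = bisw A M (\<lambda>a m0 b. F (\<gamma> a m0 b)) m"
    unfolding bisw_def
    by (intro fun_cong[OF lift_cong[OF space_A T]] lin_apply_lift[OF M space_A X Y F] bilinI 2 3)
  finally show ?thesis .
qed

lemma bisw_cong:
  assumes "\<And>a m0 b. a \<in> carrier A \<Longrightarrow> m0 \<in> carrier M \<Longrightarrow> b \<in> carrier A \<Longrightarrow> \<gamma> a m0 b = \<gamma>' a m0 b"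
  shows "bisw A M \<gamma> m = bisw A M \<gamma>' m"
  unfolding bisw_def by (intro fun_cong[OF lift_cong] assms) simp_all

lemma lin_bisw_param:
  assumes U: "is_space U" and X: "is_space X" and m: "m \<in> carrier M"
    and 0: "\<And>a m b. a \<in> carrier A \<Longrightarrow> m \<in> carrier M \<Longrightarrow> b \<in> carrier A \<Longrightarrow> lin U X (\<lambda>u. \<gamma> u a m b)"
    and 1: "\<And>u m b. u \<in> carrier U \<Longrightarrow> m \<in> carrier M \<Longrightarrow> b \<in> carrier A \<Longrightarrow> lin A X (\<lambda>a. \<gamma> u a m b)"
    and 2: "\<And>u a b. u \<in> carrier U \<Longrightarrow> a \<in> carrier A \<Longrightarrow> b \<in> carrier A \<Longrightarrow> lin M X (\<lambda>m. \<gamma> u a m b)"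
    and 3: "\<And>u a m. u \<in> carrier U \<Longrightarrow> a \<in> carrier A \<Longrightarrow> m \<in> carrier M \<Longrightarrow> lin A X (\<lambda>b. \<gamma> u a m b)"
  shows "lin U X (\<lambda>u. bisw A M (\<gamma> u) m)"
  unfolding bisw_def
  by (intro lin_lift_param[OF space_A _ X U bicoact_closed[OF m]] bilin_bisw_inner X 1 2 3
      lin_lift_param[OF M space_A X U] bilinI 0) simp_all

text \<open>Both sides lie in A \<otimes> (M \<otimes> A) and are compared by evaluation at all (g,
  h). On the right, the evaluated triple products expand by \<open>ev_mult3\<close> into sums over
  legs of g and h. The coaction legs, the legs of q and the legs of p are then contracted in this
  order, the coaction legs to actions of \<open>H\<close> and the others to regular actions.\<close>

lemma hopf_condition_iff:
  assumes p: "p \<in> carrier A" and q: "q \<in> carrier A" and m: "m \<in> carrier M"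
  shows "bicoact A M (ract M (lact M p m) q) =
          sw3 A (\<lambda>p1 p2 p3. sw3 A (\<lambda>q1 q2 q3. bisw A M (\<lambda>a m0 b.
            tens A (tensor_space M A) (mult A (mult A p1 a) q1)
              (tens M A (ract M (lact M p2 m0) q2) (mult A (mult A p3 b) q3))) m) q) p \<longleftrightarrow>
    (\<forall>h\<in>carrier H. \<forall>g\<in>carrier H. Lact M h (Ract M (ract M (lact M p m) q) g) =
      (\<Sum>(s, t)\<in>cop_index3 H h \<times> cop_index3 H g.
         ract M (lact M (lreg H (cop31 H h s) (rreg H p (cop31 H g t))) (Lact M (cop32 H h s) (Ract M m (cop32 H g t))))
               (lreg H (cop33 H h s) (rreg H q (cop33 H g t)))))"
    (is "?lhs = ?rhs \<longleftrightarrow> (\<forall>h\<in>_. \<forall>g\<in>_. _ = ?sum h g)")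
proof -
  let ?T = "tensor_space M A"
  let ?X = "tensor_space A ?T"
  let ?\<gamma> = "\<lambda>p1 p2 p3 q1 q2 q3 a m0 b. tens A ?T (mult A (mult A p1 a) q1)
      (tens M A (ract M (lact M p2 m0) q2) (mult A (mult A p3 b) q3))"
  have T: "is_space ?T" and X: "is_space ?X" by simp_all
  note act_intros = bilin_comp_left[OF bl] bilin_comp_right[OF bl] bilin_comp_left[OF br] bilin_comp_right[OF br]
    bilin_closed[OF bl] bilin_closed[OF br]
  note rules = lin_tens_left[OF space_A T] lin_tens_right[OF space_A T] lin_tens_left[OF M space_A]
    lin_tens_right[OF M space_A] bilin_comp_left[OF bilin_mult_A] bilin_comp_right[OF bilin_mult_A]
    tens_closed[OF M space_A] act_intros mult_A_closed lin_id
  have \<gamma>q: "trilin A ?X (\<lambda>q1 q2 q3. bisw A M (?\<gamma> p1 p2 p3 q1 q2 q3) m)"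
    if "p1 \<in> carrier A" "p2 \<in> carrier A" "p3 \<in> carrier A" for p1 p2 p3
    using that by (intro trilinI lin_bisw_param space_A X m rules)
  have \<gamma>p: "trilin A ?X (\<lambda>p1 p2 p3. sw3 A (\<lambda>q1 q2 q3. bisw A M (?\<gamma> p1 p2 p3 q1 q2 q3) m) q)"
    by (intro trilinI lin_sw3_param lin_comult_A lin_bisw_param space_A X m q rules \<gamma>q)
  have rc: "?rhs \<in> carrier ?X" by (rule sw3_closed[OF lin_comult_A X \<gamma>p p])
  have n: "ract M (lact M p m) q \<in> carrier M" by (intro act_intros p q m)
  have ev_rhs: "evr M h (evl ?T g ?rhs) = ?sum h g"
    if g: "g \<in> carrier H" and h: "h \<in> carrier H" for g h
  proof -
    let ?F = "\<lambda>x. evr M h (evl ?T g x)"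
    let ?I = "cop_index3 H h \<times> cop_index3 H g"
    let ?h1 = "\<lambda>i. cop31 H h (fst i)" and ?h2 = "\<lambda>i. cop32 H h (fst i)" and ?h3 = "\<lambda>i. cop33 H h (fst i)"
    let ?g1 = "\<lambda>i. cop31 H g (snd i)" and ?g2 = "\<lambda>i. cop32 H g (snd i)" and ?g3 = "\<lambda>i. cop33 H g (snd i)"
    let ?N = "\<lambda>i. Lact M (?h2 i) (Ract M m (?g2 i))"
    have c: "?h1 i \<in> carrier H" "?h2 i \<in> carrier H" "?h3 i \<in> carrier H"
      "?g1 i \<in> carrier H" "?g2 i \<in> carrier H" "?g3 i \<in> carrier H" if "i \<in> ?I" for i
      using that cop3_closed[OF lin_comult_H] g h by auto
    have N: "?N i \<in> carrier M" if "i \<in> ?I" for i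
      by (intro bilin_closed[OF bilin_Lact] bilin_closed[OF bilin_Ract] c that m)
    have F: "lin ?X M ?F" by (intro lin_comp[OF lin_evr lin_evl] M T g h)
    \<comment> \<open>The scalars are arranged with the factors in the coaction legs a and b in
      front, the pattern that \<open>bisw_sum\<close> contracts.\<close>
    have F\<gamma>: "?F (?\<gamma> p1 p2 p3 q1 q2 q3 a m0 b) =
        (\<Sum>i\<in>?I. smul M (ev a (?g2 i) * ev b (?h2 i))
          (smul M (ev p1 (?g1 i) * ev p3 (?h1 i) * (ev q1 (?g3 i) * ev q3 (?h3 i))) (ract M (lact M p2 m0) q2)))"
      if e: "p1 \<in> carrier A" "p2 \<in> carrier A" "p3 \<in> carrier A" "q1 \<in> carrier A" "q2 \<in> carrier A" "q3 \<in> carrier A"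
        "a \<in> carrier A" "m0 \<in> carrier M" "b \<in> carrier A" for p1 p2 p3 q1 q2 q3 a m0 b
    proof -
      let ?v = "ract M (lact M p2 m0) q2"
      have v: "?v \<in> carrier M" by (intro act_intros e)
      have "?F (?\<gamma> p1 p2 p3 q1 q2 q3 a m0 b) =
          smul M (ev (mult A (mult A p3 b) q3) h * ev (mult A (mult A p1 a) q1) g) ?v"
        by (simp add: evl_tens evr_tens e v g h tens_closed lin_smul[OF lin_evr] smul_smul mult.commute)
      also have "ev (mult A (mult A p3 b) q3) h * ev (mult A (mult A p1 a) q1) g =
          (\<Sum>i\<in>?I. (ev p3 (?h1 i) * ev b (?h2 i) * ev q3 (?h3 i)) * (ev p1 (?g1 i) * ev a (?g2 i) * ev q1 (?g3 i)))"
        by (simp add: ev_mult3 e g h sum_product sum.cartesian_product case_prod_unfold)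
      also have "smul M \<dots> ?v = (\<Sum>i\<in>?I. smul M ((ev p3 (?h1 i) * ev b (?h2 i) * ev q3 (?h3 i)) *
          (ev p1 (?g1 i) * ev a (?g2 i) * ev q1 (?g3 i))) ?v)"
        by (rule lin_sum[OF is_space_field lin_smul_left[OF M lin_id v]]) simp
      also have "\<dots> = (\<Sum>i\<in>?I. smul M (ev a (?g2 i) * ev b (?h2 i))
          (smul M (ev p1 (?g1 i) * ev p3 (?h1 i) * (ev q1 (?g3 i) * ev q3 (?h3 i))) ?v))"
        by (simp add: smul_smul mult_ac)
      finally show ?thesis .
    qed
    \<comment> \<open>With a and b contracted, the middle vector is \<open>?N i\<close>. The
      remaining scalars are regrouped so that the factors in q1 and q3 stand in front, ready for
      \<open>sw3_A_sum\<close>; those in p1 and p3 wait for its second use.\<close>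
    have bis: "?F (bisw A M (?\<gamma> p1 p2 p3 q1 q2 q3) m) = (\<Sum>i\<in>?I. smul M (ev q1 (?g3 i) * ev q3 (?h3 i))
          (smul M (ev p1 (?g1 i) * ev p3 (?h1 i)) (ract M (lact M p2 (?N i)) q2)))"
      if e: "p1 \<in> carrier A" "p2 \<in> carrier A" "p3 \<in> carrier A" "q1 \<in> carrier A" "q2 \<in> carrier A" "q3 \<in> carrier A"
      for p1 p2 p3 q1 q2 q3
    proof -
      have "?F (bisw A M (?\<gamma> p1 p2 p3 q1 q2 q3) m) = bisw A M (\<lambda>a m0 b. ?F (?\<gamma> p1 p2 p3 q1 q2 q3 a m0 b)) m"
        using e by (intro apply_bisw[OF X M F] m rules)
      also have "\<dots> = bisw A M (\<lambda>a m0 b. \<Sum>i\<in>?I. smul M (ev a (?g2 i) * ev b (?h2 i))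
          (smul M (ev p1 (?g1 i) * ev p3 (?h1 i) * (ev q1 (?g3 i) * ev q3 (?h3 i))) (ract M (lact M p2 m0) q2))) m"
        by (rule bisw_cong) (rule F\<gamma>[OF e])
      also have "\<dots> = (\<Sum>i\<in>?I. smul M (ev p1 (?g1 i) * ev p3 (?h1 i) * (ev q1 (?g3 i) * ev q3 (?h3 i)))
          (ract M (lact M p2 (?N i)) q2))"
        by (rule bisw_sum[OF M _ c(5) c(2) m]) (intro lin_smul_right M act_intros lin_id e)
      also have "\<dots> = (\<Sum>i\<in>?I. smul M (ev q1 (?g3 i) * ev q3 (?h3 i))
          (smul M (ev p1 (?g1 i) * ev p3 (?h1 i)) (ract M (lact M p2 (?N i)) q2)))"
        by (simp add: smul_smul mult_ac)
      finally show ?thesis .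
    qed
    have "?F ?rhs = sw3 A (\<lambda>p1 p2 p3. ?F (sw3 A (\<lambda>q1 q2 q3. bisw A M (?\<gamma> p1 p2 p3 q1 q2 q3) m) q)) p"
      by (rule apply_sw3[OF lin_comult_A X M F \<gamma>p p])
    also have "\<dots> = sw3 A (\<lambda>p1 p2 p3. \<Sum>i\<in>?I. smul M (ev p1 (?g1 i) * ev p3 (?h1 i))
        (ract M (lact M p2 (?N i)) (lreg H (?h3 i) (rreg H q (?g3 i))))) p"
    proof (rule sw3_cong[OF lin_comult_A])
      fix p1 p2 p3 assume e: "p1 \<in> carrier A" "p2 \<in> carrier A" "p3 \<in> carrier A"
      have "?F (sw3 A (\<lambda>q1 q2 q3. bisw A M (?\<gamma> p1 p2 p3 q1 q2 q3) m) q) =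
          sw3 A (\<lambda>q1 q2 q3. ?F (bisw A M (?\<gamma> p1 p2 p3 q1 q2 q3) m)) q"
        by (rule apply_sw3[OF lin_comult_A X M F \<gamma>q[OF e] q])
      also have "\<dots> = sw3 A (\<lambda>q1 q2 q3. \<Sum>i\<in>?I. smul M (ev q1 (?g3 i) * ev q3 (?h3 i))
          (smul M (ev p1 (?g1 i) * ev p3 (?h1 i)) (ract M (lact M p2 (?N i)) q2))) q"
        by (rule sw3_cong[OF lin_comult_A]) (rule bis[OF e])
      also have "\<dots> = (\<Sum>i\<in>?I. smul M (ev p1 (?g1 i) * ev p3 (?h1 i))
        (ract M (lact M p2 (?N i)) (lreg H (?h3 i) (rreg H q (?g3 i)))))"
        by (rule sw3_A_sum[OF M _ q c(6) c(3)]) (intro lin_smul_right M act_intros lin_id e N)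
      finally show "?F (sw3 A (\<lambda>q1 q2 q3. bisw A M (?\<gamma> p1 p2 p3 q1 q2 q3) m) q) =
        (\<Sum>i\<in>?I. smul M (ev p1 (?g1 i) * ev p3 (?h1 i))
          (ract M (lact M p2 (?N i)) (lreg H (?h3 i) (rreg H q (?g3 i)))))" .
    qed
    also have "\<dots> = (\<Sum>i\<in>?I. ract M (lact M (lreg H (?h1 i) (rreg H p (?g1 i))) (?N i))
        (lreg H (?h3 i) (rreg H q (?g3 i))))"
      by (rule sw3_A_sum[OF M _ p c(4) c(1)]) (intro act_intros lin_id N lreg_closed rreg_closed q c)
    finally show ?thesis by (simp add: case_prod_unfold)
  qed
  have ev_lhs: "evr M h (evl ?T g ?lhs) = Lact M h (Ract M (ract M (lact M p m) q) g)"
    if g: "g \<in> carrier H" for g h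
    by (simp add: evl_bicoact[OF n g] Lact_def)
  show ?thesis
  proof (intro iffI ballI)
    fix h g assume "?lhs = ?rhs" "h \<in> carrier H" "g \<in> carrier H"
    then show "Lact M h (Ract M (ract M (lact M p m) q) g) = ?sum h g"
      using ev_lhs[of g h] ev_rhs[of g h] by simp
  next
    assume eq: "\<forall>h\<in>carrier H. \<forall>g\<in>carrier H. Lact M h (Ract M (ract M (lact M p m) q) g) = ?sum h g"
    show "?lhs = ?rhs"
    proof (rule tensor_AVA_eqI[OF M bicoact_closed[OF n] rc])
      fix g h assume g: "g \<in> carrier H" and h: "h \<in> carrier H"
      show "evr M h (evl ?T g ?lhs) = evr M h (evl ?T g ?rhs)"
        unfolding ev_lhs[OF g] ev_rhs[OF g h] using eq g h by blast
    qed
  qed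
qed

end

text \<open>\<open>bicomodule_iff\<close> handles the coactions and
  \<open>hopf_condition_iff\<close> the last axiom. The case distinction supplies the linearity that
  the latter needs; without it both sides are false.\<close>

theorem hopf_bimodule_iff:
  fixes M :: "('k, 'h \<Rightarrow> 'k, 'm::ab_group_add) hopf_bimodule"
  shows "is_hopf_bimodule A M \<longleftrightarrow> is_bimodule A M \<and>
     lin M (tensor_space A M) (lcoact M) \<and> lin M (tensor_space M A) (rcoact M) \<and>
     lcoact M \<in> extensional (carrier M) \<and> rcoact M \<in> extensional (carrier M) \<and>
     two_sided M (Lact M) (Ract M) \<and> compat M (lact M) (ract M) (Lact M) (Ract M)"
proof (cases "is_bimodule A M \<and> lin M (tensor_space A M) (lcoact M) \<and> lin M (tensor_space M A) (rcoact M)")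
  case True
  then have "is_space M" "bilin A M M (lact M)" "bilin M A M (ract M)"
    "lin M (tensor_space A M) (lcoact M)" "lin M (tensor_space M A) (rcoact M)"
    by (auto simp: is_bimodule_def)
  note iff = hopf_condition_iff[OF this]
  have "(\<forall>p\<in>carrier A. \<forall>q\<in>carrier A. \<forall>m\<in>carrier M.
        bicoact A M (ract M (lact M p m) q) =
          sw3 A (\<lambda>p1 p2 p3. sw3 A (\<lambda>q1 q2 q3. bisw A M (\<lambda>a m0 b.
            tens A (tensor_space M A) (mult A (mult A p1 a) q1)
              (tens M A (ract M (lact M p2 m0) q2) (mult A (mult A p3 b) q3))) m) q) p) \<longleftrightarrow>
      compat M (lact M) (ract M) (Lact M) (Ract M)"
    unfolding compat_def by (intro ball_cong refl iff)
  then show ?thesis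
    unfolding is_hopf_bimodule_def bicomodule_iff using True by (auto simp: is_bimodule_def)
qed (auto simp: is_hopf_bimodule_def bicomodule_iff)

subsection \<open>The algebra \<open>Z\<close>\<close>

abbreviation "ZZ \<equiv> tensor_space A2 H2"

lemma spaces_Z [simp]: "is_space A2" "is_space H2" "is_space ZZ"
  by (intro is_space_tensor space_A space_H)+

lemma op_alg_simps: "carrier (op_alg A) = carrier A" "smul (op_alg A) = smul A"
  "mult (op_alg A) = (\<lambda>a b. mult A b a)" "one (op_alg A) = one A"
  by (simp_all add: op_alg_def)

lemma op_hopf_simps: "carrier (op_hopf H) = carrier H" "smul (op_hopf H) = smul H"
  "mult (op_hopf H) = (\<lambda>a b. mult H b a)" "one (op_hopf H) = one H"
  by (simp_all add: op_hopf_def)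

text \<open>Passing to an opposite algebra changes neither carrier nor scalars, so all tensor spaces
  occurring in \<open>Z\<close> reduce to \<open>A2\<close>, \<open>H2\<close> and
  \<open>ZZ\<close>.\<close>

lemma op_eqs:
  "tens A (op_alg A) = tens A A" "lift A (op_alg A) = lift A A" "tensor_space A (op_alg A) = A2"
  "tens H (op_hopf H) = tens H H" "lift H (op_hopf H) = lift H H" "tensor_space H (op_hopf H) = H2"
  by (intro tens_eq_space lift_eq_space tensor_space_eq_space op_alg_simps(1,2) op_hopf_simps(1,2) refl)+

lemma sw2_op_hopf: "sw2 (op_hopf H) = (sw2 H :: (_ \<Rightarrow> _ \<Rightarrow> 'c::ab_group_add) \<Rightarrow> _)"
proof -
  have "lift (op_hopf H) (op_hopf H) = (lift H H :: (_ \<Rightarrow> _ \<Rightarrow> 'c) \<Rightarrow> _)"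
    by (intro lift_eq_space op_hopf_simps(1,2))
  moreover have "comult (op_hopf H) = comult H" by (simp add: op_hopf_def)
  ultimately show ?thesis by (intro ext) (simp add: sw2_def)
qed

lemma Z_C_simps: "carrier (Z_C H) = carrier A2" "smul (Z_C H) = smul A2" "one (Z_C H) = tens A A (one A) (one A)"
  by (simp_all add: tensor_alg_def op_eqs op_alg_simps)

lemma Z_K_simps: "carrier (Z_K H) = carrier H2" "smul (Z_K H) = smul H2" "one (Z_K H) = tens H H (one H) (one H)"
  by (simp_all add: tensor_hopf_def op_eqs op_hopf_simps)

lemma Z_C_K_eqs: "tens (Z_C H) (Z_K H) = tens A2 H2" "lift (Z_C H) (Z_K H) = lift A2 H2"
  "tensor_space (Z_C H) (Z_K H) = ZZ"
  by (intro tens_eq_space lift_eq_space tensor_space_eq_space Z_C_simps Z_K_simps)+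

lemma Z_alg_simps: "carrier (Z_alg H) = carrier ZZ" "smul (Z_alg H) = smul ZZ"
  by (simp_all add: Z_alg_def diag_crossed_def Z_C_K_eqs)

lemma Z_elem: "Z_elem H p q h g = tens A2 H2 (tens A A p q) (tens H H h g)"
  by (simp add: Z_elem_def Z_C_K_eqs)

lemma one_Z: "one (Z_alg H) = Z_elem H (one A) (one A) (one H) (one H)"
  by (simp add: Z_alg_def diag_crossed_def Z_C_K_eqs Z_C_simps Z_K_simps Z_elem)

text \<open>The products of C and K with all multiplications taken in \<open>A\<close> and
  \<open>H\<close>: the opposite structure survives only as the reversed order in the second
  factor.\<close>

definition mC where "mC s t = lift A A (\<lambda>a b. lift A A (\<lambda>a' b'. tens A A (mult A a a') (mult A b' b)) t) s"
definition mK where "mK s t = lift H H (\<lambda>a b. lift H H (\<lambda>a' b'. tens H H (mult H a a') (mult H b' b)) t) s"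

lemma mult_Z_C: "mult (Z_C H) = mC"
  by (intro ext) (simp add: tensor_alg_def mC_def tensor_mult_def op_eqs op_alg_simps)

lemma mult_Z_K: "mult (Z_K H) = mK"
  by (intro ext) (simp add: tensor_hopf_def mK_def tensor_mult_def op_eqs op_hopf_simps)

lemma bilin_mC: "bilin A2 A2 A2 mC"
  unfolding mC_def by (intro lin_intros lin_A_intros space_A mult_A_closed; assumption)

lemma bilin_mK: "bilin H2 H2 H2 mK"
  unfolding mK_def by (intro lin_intros lin_A_intros space_H mult_H_closed; assumption)

lemma mC_tens:
  assumes "p \<in> carrier A" "q \<in> carrier A" "p' \<in> carrier A" "q' \<in> carrier A"
  shows "mC (tens A A p q) (tens A A p' q') = tens A A (mult A p p') (mult A q' q)"
proof -
  have "bilin A A A2 (\<lambda>a b. lift A A (\<lambda>a' b'. tens A A (mult A a a') (mult A b' b)) (tens A A p' q'))"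
    by (intro lin_intros lin_A_intros space_A mult_A_closed assms; assumption)
  moreover have "bilin A A A2 (\<lambda>a' b'. tens A A (mult A p a') (mult A b' q))"
    by (intro lin_intros lin_A_intros space_A mult_A_closed assms; assumption)
  ultimately show ?thesis
    unfolding mC_def using assms by (simp add: lift_tens[OF space_A space_A spaces_Z(1)])
qed

lemma mK_tens:
  assumes "p \<in> carrier H" "q \<in> carrier H" "p' \<in> carrier H" "q' \<in> carrier H"
  shows "mK (tens H H p q) (tens H H p' q') = tens H H (mult H p p') (mult H q' q)"
proof -
  have "bilin H H H2 (\<lambda>a b. lift H H (\<lambda>a' b'. tens H H (mult H a a') (mult H b' b)) (tens H H p' q'))"
    by (intro lin_intros lin_A_intros space_H mult_H_closed assms; assumption)
  moreover have "bilin H H H2 (\<lambda>a' b'. tens H H (mult H p a') (mult H b' q))"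
    by (intro lin_intros lin_A_intros space_H mult_H_closed assms; assumption)
  ultimately show ?thesis
    unfolding mK_def using assms by (simp add: lift_tens[OF space_H space_H spaces_Z(2)])
qed

section \<open>The antipode of K and the actions of K on C\<close>

abbreviation "Sinv \<equiv> inv_into (carrier H) (antipode H)"

lemma antipode_closed: "h \<in> carrier H \<Longrightarrow> antipode H h \<in> carrier H"
  by (rule lin_closed[OF lin_antipode])

lemma Sinv_closed: "h \<in> carrier H \<Longrightarrow> Sinv h \<in> carrier H"
  using bij by (metis bij_betw_imp_surj_on inv_into_into)

lemma antipode_Sinv: "h \<in> carrier H \<Longrightarrow> antipode H (Sinv h) = h"
  using bij by (metis bij_betw_imp_surj_on f_inv_into_f)

lemma Sinv_antipode: "h \<in> carrier H \<Longrightarrow> Sinv (antipode H h) = h"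
  using bij by (metis bij_betw_imp_inj_on inv_into_f_f)

lemma lin_Sinv: "lin H H Sinv"
proof (rule linI)
  have inj: "x = y" if "antipode H x = antipode H y" "x \<in> carrier H" "y \<in> carrier H" for x y
    using bij that by (auto simp: bij_betw_def inj_on_def)
  fix x y c assume x: "x \<in> carrier H"
  show "Sinv x \<in> carrier H" by (rule Sinv_closed[OF x])
  show "Sinv (smul H c x) = smul H c (Sinv x)"
    by (rule inj) (simp_all add: antipode_Sinv lin_smul[OF lin_antipode] Sinv_closed space_smul x)
  assume y: "y \<in> carrier H"
  show "Sinv (x + y) = Sinv x + Sinv y"
    by (rule inj) (simp_all add: antipode_Sinv lin_add[OF lin_antipode] Sinv_closed space_add x y)
qed

lemma antipode_Z_K: "antipode (Z_K H) = tmap H H H H (antipode H) Sinv"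
  by (simp add: tensor_hopf_def tmap_def op_eqs fun_eq_iff) (simp add: op_hopf_def)

definition SK where "SK = inv_into (carrier (Z_K H)) (antipode (Z_K H))"

text \<open>The antipode of K is S \<otimes> \<open>Sinv\<close>, and the two tensor maps are
  mutually inverse on \<open>H2\<close>, as pure tensors show. This identifies the set-theoretic
  inverse in the diagonal crossed product.\<close>

lemma SK:
  assumes x: "x \<in> carrier H2"
  shows "SK x = tmap H H H H Sinv (antipode H) x"
proof -
  let ?f = "tmap H H H H (antipode H) Sinv" and ?g = "tmap H H H H Sinv (antipode H)"
  note lf = lin_tmap[OF space_H space_H space_H space_H lin_antipode lin_Sinv]
  note lg = lin_tmap[OF space_H space_H space_H space_H lin_Sinv lin_antipode]
  note simps = tmap_tens[OF space_H space_H space_H space_H lin_antipode lin_Sinv]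
    tmap_tens[OF space_H space_H space_H space_H lin_Sinv lin_antipode]
    antipode_closed Sinv_closed antipode_Sinv Sinv_antipode
  have gf: "?g (?f x) = x" if "x \<in> carrier H2" for x
    by (rule tensor_ext[OF space_H space_H lin_comp[OF lg lf] lin_id _ that]) (simp add: simps)
  have fg: "?f (?g x) = x" if "x \<in> carrier H2" for x
    by (rule tensor_ext[OF space_H space_H lin_comp[OF lf lg] lin_id _ that]) (simp add: simps)
  show ?thesis
    unfolding SK_def antipode_Z_K Z_K_simps
    by (rule inv_into_f_eq[where f = ?f, OF inj_on_inverseI[where g = ?g, OF gf] lin_closed[OF lg x] fg[OF x]])
qed

lemma lin_SK: "lin H2 H2 SK"
  by (rule lin_cong[OF lin_tmap[OF space_H space_H space_H space_H lin_Sinv lin_antipode]]) (simp_all add: SK)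

lemma SK_tens: "h \<in> carrier H \<Longrightarrow> g \<in> carrier H \<Longrightarrow> SK (tens H H h g) = tens H H (Sinv h) (antipode H g)"
  by (simp add: SK tens_closed tmap_tens[OF space_H space_H space_H space_H lin_Sinv lin_antipode])

lemma bilin_Z_lact: "bilin H2 A2 A2 (Z_lact H)"
  unfolding Z_lact_def tmap_def id_def
  by (intro lin_intros lin_A_intros space_A space_H lreg_closed rreg_closed spaces_Z; assumption)

lemma Z_lact_tens:
  assumes "h \<in> carrier H" "g \<in> carrier H" "p \<in> carrier A" "q \<in> carrier A"
  shows "Z_lact H (tens H H h g) (tens A A p q) = tens A A (lreg H h (rreg H p g)) q"
proof -
  have 1: "bilin A A A2 (\<lambda>v w. tens A A (lift H H (\<lambda>h h'. rreg H (lreg H h v) h') (tens H H h g)) w)"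
    by (intro lin_intros lin_A_intros space_A space_H lreg_closed rreg_closed spaces_Z assms; assumption)
  have 2: "bilin H H A (\<lambda>h h'. rreg H (lreg H h p) h')"
    by (intro lin_intros lin_A_intros space_A space_H lreg_closed rreg_closed spaces_Z assms; assumption)
  have "rreg H (lreg H h p) g = lreg H h (rreg H p g)"
    by (rule A_eqI) (simp_all add: assms lreg rreg assoc_H)
  then show ?thesis
    unfolding Z_lact_def tmap_def id_def
    by (simp add: lift_tens[OF space_A space_A spaces_Z(1) 1] lift_tens[OF space_H space_H space_A 2] assms)
qed

lemma bilin_Z_ract: "bilin A2 H2 A2 (Z_ract H)"
  unfolding Z_ract_def tmap_def id_def
  by (intro lin_intros lin_A_intros lin_antipode lin_Sinv antipode_closed Sinv_closed
      space_A space_H lreg_closed rreg_closed spaces_Z; assumption)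

lemma Z_ract_tens:
  assumes "h \<in> carrier H" "g \<in> carrier H" "p \<in> carrier A" "q \<in> carrier A"
  shows "Z_ract H (tens A A p q) (tens H H h g) = tens A A p (lreg H (antipode H h) (rreg H q (Sinv g)))"
proof -
  have 1: "bilin A A A2 (\<lambda>v w. tens A A v (lift H H (\<lambda>h h'. rreg H (lreg H (antipode H h) w) (Sinv h')) (tens H H h g)))"
    by (intro lin_intros lin_A_intros lin_antipode lin_Sinv antipode_closed Sinv_closed
        space_A space_H lreg_closed rreg_closed spaces_Z assms; assumption)
  have 2: "bilin H H A (\<lambda>h h'. rreg H (lreg H (antipode H h) q) (Sinv h'))"
    by (intro lin_intros lin_A_intros lin_antipode lin_Sinv antipode_closed Sinv_closed
        space_A space_H lreg_closed rreg_closed spaces_Z assms; assumption)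
  have "rreg H (lreg H (antipode H h) q) (Sinv g) = lreg H (antipode H h) (rreg H q (Sinv g))"
    by (rule A_eqI) (simp_all add: assms lreg rreg assoc_H antipode_closed Sinv_closed)
  then show ?thesis
    unfolding Z_ract_def tmap_def id_def
    by (simp add: lift_tens[OF space_A space_A spaces_Z(1) 1] lift_tens[OF space_H space_H space_A 2] assms)
qed

section \<open>Iterated coproducts in K\<close>

lemma comult_Z_K: "comult (Z_K H) = lift H H (\<lambda>a b. sw2 H (\<lambda>a1 a2. sw2 H (\<lambda>b1 b2.
        tens H2 H2 (tens H H a1 b1) (tens H H a2 b2)) b) a)"
  by (simp add: tensor_hopf_def op_eqs sw2_op_hopf)

lemma bilin_comult_Z_K: "bilin H H (tensor_space H2 H2) (\<lambda>a b. sw2 H (\<lambda>a1 a2. sw2 H (\<lambda>b1 b2.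
        tens H2 H2 (tens H H a1 b1) (tens H H a2 b2)) b) a)"
  by (intro lin_intros lin_comult_H spaces_Z space_H; assumption)

lemma lin_eq_Z_K: "lin (Z_K H) = (lin H2 :: ('k, 'c::ab_group_add, 'y) space_scheme \<Rightarrow> _)"
  by (intro ext lin_eq_space[THEN fun_cong] Z_K_simps refl)

lemma bilin_eq_Z_K: "bilin (Z_K H) (Z_K H) = (bilin H2 H2 :: ('k, 'c::ab_group_add, 'y) space_scheme \<Rightarrow> _)"
  by (intro ext bilin_eq_space[THEN fun_cong] Z_K_simps refl)

lemma trilin_eq_Z_K: "trilin (Z_K H) = (trilin H2 :: ('k, 'c::ab_group_add, 'y) space_scheme \<Rightarrow> _)"
  by (intro ext) (simp add: trilin_def lin_eq_Z_K Z_K_simps)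

lemma tensor_Z_K: "tensor_space (Z_K H) (Z_K H) = tensor_space H2 H2" "lift (Z_K H) (Z_K H) = lift H2 H2"
  by (intro tensor_space_eq_space lift_eq_space Z_K_simps)+

lemma is_space_Z_K [simp]: "is_space (Z_K H)"
  using spaces_Z(2) by (simp add: is_space_def Z_K_simps)

lemma lin_comult_Z_K [simp]: "lin_comult (Z_K H)"
  unfolding lin_comult_def tensor_Z_K lin_eq_Z_K comult_Z_K
  using lin_lift[OF space_H space_H _ bilin_comult_Z_K] by (simp add: is_space_tensor)

text \<open>The sum runs over the representatives of h and g separately, not over one chosen for K
  itself, so that its indices are those of \<open>compat\<close>.\<close>

lemma sw2_Z_K:
  assumes X: "is_space X" and b: "bilin H2 H2 X \<beta>" and h: "h \<in> carrier H" and g: "g \<in> carrier H"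
  shows "sw2 (Z_K H) \<beta> (tens H H h g) = (\<Sum>i\<in>cop_index H h. \<Sum>k\<in>cop_index H g.
    \<beta> (tens H H (cop1 H h i) (cop1 H g k)) (tens H H (cop2 H h i) (cop2 H g k)))"
proof -
  have T: "is_space (tensor_space H2 H2)" by (simp add: is_space_tensor)
  have 1: "bilin H H (tensor_space H2 H2) (\<lambda>a1 a2. sw2 H (\<lambda>b1 b2. tens H2 H2 (tens H H a1 b1) (tens H H a2 b2)) g)"
    by (intro lin_intros lin_comult_H spaces_Z space_H g; assumption)
  have 2: "bilin H H (tensor_space H2 H2) (\<lambda>b1 b2. tens H2 H2 (tens H H a1 b1) (tens H H a2 b2))"
    if "a1 \<in> carrier H" "a2 \<in> carrier H" for a1 a2
    by (intro lin_intros lin_comult_H spaces_Z space_H that; assumption)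
  note L = lin_lift[OF spaces_Z(2) spaces_Z(2) X b]
  note c = cop_closed[OF lin_comult_H h] cop_closed[OF lin_comult_H g]
  have c1: "tens H2 H2 (tens H H (cop1 H h i) (cop1 H g k)) (tens H H (cop2 H h i) (cop2 H g k)) \<in> carrier (tensor_space H2 H2)"
    if "i \<in> cop_index H h" "k \<in> cop_index H g" for i k
    by (intro tens_closed spaces_Z space_H c that)
  have "sw2 (Z_K H) \<beta> (tens H H h g) = lift H2 H2 \<beta> (\<Sum>i\<in>cop_index H h. \<Sum>k\<in>cop_index H g.
    tens H2 H2 (tens H H (cop1 H h i) (cop1 H g k)) (tens H H (cop2 H h i) (cop2 H g k)))"
    unfolding sw2_def[of "Z_K H"] tensor_Z_K comult_Z_K
    using lift_tens[OF space_H space_H T bilin_comult_Z_K h g]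
    by (simp add: sw2_sum[OF lin_comult_H T 1 h] sw2_sum[OF lin_comult_H T 2 g] c)
  also have "\<dots> = (\<Sum>i\<in>cop_index H h. \<Sum>k\<in>cop_index H g.
    lift H2 H2 \<beta> (tens H2 H2 (tens H H (cop1 H h i) (cop1 H g k)) (tens H H (cop2 H h i) (cop2 H g k))))"
    by (subst lin_sum[OF T L], intro space_sum T c1, assumption+, intro sum.cong refl, subst lin_sum[OF T L])
      (auto intro: c1)
  also have "\<dots> = (\<Sum>i\<in>cop_index H h. \<Sum>k\<in>cop_index H g.
    \<beta> (tens H H (cop1 H h i) (cop1 H g k)) (tens H H (cop2 H h i) (cop2 H g k)))"
    by (intro sum.cong refl lift_tens[OF spaces_Z(2) spaces_Z(2) X b] tens_closed space_H c)
  finally show ?thesis .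
qed

lemma sum_cop_index3: "(\<Sum>s\<in>cop_index3 H h. f s) = (\<Sum>i\<in>cop_index H h. \<Sum>j\<in>cop_index H (cop2 H h i). f (i, j))"
  unfolding cop_index3_def by (subst sum.Sigma) (auto simp: cop_index_def)

lemma sw3_Z_K:
  assumes X: "is_space X" and \<gamma>: "trilin H2 X \<gamma>" and h: "h \<in> carrier H" and g: "g \<in> carrier H"
  shows "sw3 (Z_K H) \<gamma> (tens H H h g) = (\<Sum>(s, t)\<in>cop_index3 H h \<times> cop_index3 H g.
    \<gamma> (tens H H (cop31 H h s) (cop31 H g t)) (tens H H (cop32 H h s) (cop32 H g t)) (tens H H (cop33 H h s) (cop33 H g t)))"
proof -
  have 1: "bilin H2 H2 X (\<lambda>a b. sw2 (Z_K H) (\<gamma> a) b)"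
    using bilin_sw2[OF lin_comult_Z_K X, of \<gamma>] \<gamma> by (simp add: bilin_eq_Z_K trilin_eq_Z_K)
  note c = cop_closed[OF lin_comult_H h] cop_closed[OF lin_comult_H g]
  have "sw3 (Z_K H) \<gamma> (tens H H h g) = (\<Sum>i\<in>cop_index H h. \<Sum>k\<in>cop_index H g.
    sw2 (Z_K H) (\<gamma> (tens H H (cop1 H h i) (cop1 H g k))) (tens H H (cop2 H h i) (cop2 H g k)))"
    unfolding sw3_def by (rule sw2_Z_K[OF X 1 h g])
  also have "\<dots> = (\<Sum>i\<in>cop_index H h. \<Sum>k\<in>cop_index H g. \<Sum>j\<in>cop_index H (cop2 H h i). \<Sum>l\<in>cop_index H (cop2 H g k).
    \<gamma> (tens H H (cop31 H h (i, j)) (cop31 H g (k, l))) (tens H H (cop32 H h (i, j)) (cop32 H g (k, l)))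
      (tens H H (cop33 H h (i, j)) (cop33 H g (k, l))))"
    unfolding cop31_def cop32_def cop33_def fst_conv snd_conv
    by (intro sum.cong refl sw2_Z_K[OF X trilin_bilin[OF \<gamma>]] tens_closed space_H c)
  also have "\<dots> = (\<Sum>i\<in>cop_index H h. \<Sum>j\<in>cop_index H (cop2 H h i). \<Sum>k\<in>cop_index H g. \<Sum>l\<in>cop_index H (cop2 H g k).
    \<gamma> (tens H H (cop31 H h (i, j)) (cop31 H g (k, l))) (tens H H (cop32 H h (i, j)) (cop32 H g (k, l)))
      (tens H H (cop33 H h (i, j)) (cop33 H g (k, l))))"
    \<comment> \<open>Exchanging the sums over j and k collects the indices of h into (i, j) and
      those of g into (k, l).\<close>
    by (rule sum.cong[OF refl]) (rule sum.swap)
  finally show ?thesis by (simp add: sum.cartesian_product[symmetric] sum_cop_index3)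
qed

text \<open>The summand of the product in \<open>Z\<close>. The three coproduct legs come last, so
  that the partially applied \<open>Z_body c c' x'\<close> is the trilinear form fed to
  \<open>sw3\<close>.\<close>

definition Z_body where
  "Z_body c c' x' x1 x2 x3 = tens A2 H2 (mC c (Z_ract H (Z_lact H x1 c') (SK x3))) (mK x2 x')"

lemma mult_Z: "mult (Z_alg H) u v =
    lift A2 H2 (\<lambda>c x. lift A2 H2 (\<lambda>c' x'. sw3 (Z_K H) (Z_body c c' x') x) v) u"
  by (simp add: Z_alg_def diag_crossed_def Z_C_K_eqs mult_Z_C mult_Z_K SK_def[symmetric] Z_body_def[abs_def])

lemmas lin_Z_intros = bilin_comp_left[OF bilin_mC] bilin_comp_right[OF bilin_mC]
  bilin_comp_left[OF bilin_mK] bilin_comp_right[OF bilin_mK]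
  bilin_comp_left[OF bilin_Z_lact] bilin_comp_right[OF bilin_Z_lact]
  bilin_comp_left[OF bilin_Z_ract] bilin_comp_right[OF bilin_Z_ract]
  bilin_closed[OF bilin_mC] bilin_closed[OF bilin_mK]
  bilin_closed[OF bilin_Z_lact] bilin_closed[OF bilin_Z_ract]
  lin_SK lin_closed[OF lin_SK] spaces_Z

lemma trilin_Z_body:
  "c \<in> carrier A2 \<Longrightarrow> c' \<in> carrier A2 \<Longrightarrow> x' \<in> carrier H2 \<Longrightarrow> trilin H2 ZZ (Z_body c c' x')"
  unfolding Z_body_def by (intro trilinI lin_tens_left lin_tens_right lin_Z_intros lin_id)

lemma lin_Z_body:
  assumes x: "x1 \<in> carrier H2" "x2 \<in> carrier H2" "x3 \<in> carrier H2"
  shows "c' \<in> carrier A2 \<Longrightarrow> x' \<in> carrier H2 \<Longrightarrow> lin A2 ZZ (\<lambda>c. Z_body c c' x' x1 x2 x3)"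
    and "c \<in> carrier A2 \<Longrightarrow> x' \<in> carrier H2 \<Longrightarrow> lin A2 ZZ (\<lambda>c'. Z_body c c' x' x1 x2 x3)"
    and "c \<in> carrier A2 \<Longrightarrow> c' \<in> carrier A2 \<Longrightarrow> lin H2 ZZ (\<lambda>x'. Z_body c c' x' x1 x2 x3)"
  unfolding Z_body_def by (intro lin_tens_left lin_tens_right lin_Z_intros lin_id x; assumption)+

lemma lin_sw3_Z_body:
  "c \<in> carrier A2 \<Longrightarrow> c' \<in> carrier A2 \<Longrightarrow> x' \<in> carrier H2 \<Longrightarrow> lin H2 ZZ (\<lambda>x. sw3 (Z_K H) (Z_body c c' x') x)"
  using lin_sw3[OF lin_comult_Z_K spaces_Z(3) _ lin_id, unfolded trilin_eq_Z_K lin_eq_Z_K] trilin_Z_body by blast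

lemma lin_sw3_Z_body_param:
  assumes x: "x \<in> carrier H2"
  shows "c' \<in> carrier A2 \<Longrightarrow> x' \<in> carrier H2 \<Longrightarrow> lin A2 ZZ (\<lambda>c. sw3 (Z_K H) (Z_body c c' x') x)"
    and "c \<in> carrier A2 \<Longrightarrow> x' \<in> carrier H2 \<Longrightarrow> lin A2 ZZ (\<lambda>c'. sw3 (Z_K H) (Z_body c c' x') x)"
    and "c \<in> carrier A2 \<Longrightarrow> c' \<in> carrier A2 \<Longrightarrow> lin H2 ZZ (\<lambda>x'. sw3 (Z_K H) (Z_body c c' x') x)"
  by (rule lin_sw3_param[OF lin_comult_Z_K]; simp add: x Z_K_simps trilin_eq_Z_K trilin_Z_body lin_Z_body)+

lemma bilin_Z_inner: "c \<in> carrier A2 \<Longrightarrow> x \<in> carrier H2 \<Longrightarrow>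
    bilin A2 H2 ZZ (\<lambda>c' x'. sw3 (Z_K H) (Z_body c c' x') x)"
  by (intro bilinI lin_sw3_Z_body_param)

lemma bilin_Z_outer: "v \<in> carrier ZZ \<Longrightarrow>
    bilin A2 H2 ZZ (\<lambda>c x. lift A2 H2 (\<lambda>c' x'. sw3 (Z_K H) (Z_body c c' x') x) v)"
  by (intro bilinI lin_lift_param spaces_Z bilin_Z_inner lin_sw3_Z_body lin_sw3_Z_body_param)

lemma bilin_mult_Z: "bilin ZZ ZZ ZZ (mult (Z_alg H))"
  unfolding mult_Z
  by (intro bilinI lin_lift_param lin_lift[OF _ _ _ bilin_Z_outer] lin_lift[OF _ _ _ bilin_Z_inner]
      spaces_Z bilin_Z_outer)

lemma Z_elem_closed:
  "p \<in> carrier A \<Longrightarrow> q \<in> carrier A \<Longrightarrow> h \<in> carrier H \<Longrightarrow> g \<in> carrier H \<Longrightarrow> Z_elem H p q h g \<in> carrier ZZ"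
  unfolding Z_elem by (intro tens_closed space_A space_H spaces_Z)

text \<open>The antipodes cancel here: \<open>SK\<close> turns the third leg into
  \<open>Sinv\<close> h3 \<otimes> S(g3), to which the right action of K applies S and
  \<open>Sinv\<close> respectively. What remains is h3 \<rightharpoonup> q' \<leftharpoonup>
  g3.\<close>

lemma Z_elem_mult:
  assumes p: "p \<in> carrier A" "q \<in> carrier A" and h: "h \<in> carrier H" and g: "g \<in> carrier H"
    and p': "p' \<in> carrier A" "q' \<in> carrier A" and h': "h' \<in> carrier H" "g' \<in> carrier H"
  shows "mult (Z_alg H) (Z_elem H p q h g) (Z_elem H p' q' h' g') =
    (\<Sum>(s, t)\<in>cop_index3 H h \<times> cop_index3 H g.
       Z_elem H (mult A p (lreg H (cop31 H h s) (rreg H p' (cop31 H g t))))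
         (mult A (lreg H (cop33 H h s) (rreg H q' (cop33 H g t))) q)
         (mult H (cop32 H h s) h') (mult H g' (cop32 H g t)))"
proof -
  have cl: "tens A A p q \<in> carrier A2" "tens A A p' q' \<in> carrier A2" "tens H H h g \<in> carrier H2"
    "tens H H h' g' \<in> carrier H2"
    by (intro tens_closed space_A space_H assms)+
  have "mult (Z_alg H) (Z_elem H p q h g) (Z_elem H p' q' h' g') =
    sw3 (Z_K H) (Z_body (tens A A p q) (tens A A p' q') (tens H H h' g')) (tens H H h g)"
    unfolding mult_Z Z_elem using cl
    by (simp add: lift_tens[OF spaces_Z bilin_Z_outer] lift_tens[OF spaces_Z bilin_Z_inner] tens_closed)
  also have "\<dots> = (\<Sum>(s, t)\<in>cop_index3 H h \<times> cop_index3 H g.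
    Z_body (tens A A p q) (tens A A p' q') (tens H H h' g') (tens H H (cop31 H h s) (cop31 H g t))
      (tens H H (cop32 H h s) (cop32 H g t)) (tens H H (cop33 H h s) (cop33 H g t)))"
    by (rule sw3_Z_K[OF spaces_Z(3) trilin_Z_body h g]) (fact cl)+
  also have "\<dots> = (\<Sum>(s, t)\<in>cop_index3 H h \<times> cop_index3 H g.
       Z_elem H (mult A p (lreg H (cop31 H h s) (rreg H p' (cop31 H g t))))
         (mult A (lreg H (cop33 H h s) (rreg H q' (cop33 H g t))) q)
         (mult H (cop32 H h s) h') (mult H g' (cop32 H g t)))"
    using assms
    by (intro sum.cong refl)
      (auto simp: Z_body_def Z_elem Z_lact_tens Z_ract_tens SK_tens mC_tens mK_tens cop3_closed
        antipode_Sinv Sinv_antipode antipode_closed Sinv_closed)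
  finally show ?thesis .
qed

lemma lin_Z_elem:
  shows "lin U A f \<Longrightarrow> q \<in> carrier A \<Longrightarrow> h \<in> carrier H \<Longrightarrow> g \<in> carrier H \<Longrightarrow> lin U ZZ (\<lambda>u. Z_elem H (f u) q h g)"
    and "lin U A f \<Longrightarrow> p \<in> carrier A \<Longrightarrow> h \<in> carrier H \<Longrightarrow> g \<in> carrier H \<Longrightarrow> lin U ZZ (\<lambda>u. Z_elem H p (f u) h g)"
  unfolding Z_elem by (intro lin_tens_left lin_tens_right tens_closed spaces_Z space_A space_H; assumption)+

lemma lin_Z_elem_H:
  shows "lin U H f \<Longrightarrow> p \<in> carrier A \<Longrightarrow> q \<in> carrier A \<Longrightarrow> g \<in> carrier H \<Longrightarrow> lin U ZZ (\<lambda>u. Z_elem H p q (f u) g)"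
    and "lin U H f \<Longrightarrow> p \<in> carrier A \<Longrightarrow> q \<in> carrier A \<Longrightarrow> h \<in> carrier H \<Longrightarrow> lin U ZZ (\<lambda>u. Z_elem H p q h (f u))"
  unfolding Z_elem by (intro lin_tens_left lin_tens_right tens_closed spaces_Z space_A space_H; assumption)+

text \<open>Elements of the form \<open>Z_elem\<close> span \<open>ZZ\<close>, by one use of
  \<open>tensor_ext\<close> for each of the three tensor signs.\<close>

lemma Z_ext:
  assumes f: "lin ZZ X f" and g: "lin ZZ X f'"
    and eq: "\<And>p q h g. p \<in> carrier A \<Longrightarrow> q \<in> carrier A \<Longrightarrow> h \<in> carrier H \<Longrightarrow> g \<in> carrier H \<Longrightarrow>
      f (Z_elem H p q h g) = f' (Z_elem H p q h g)"
    and z: "z \<in> carrier ZZ"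
  shows "f z = f' z"
proof (rule tensor_ext[OF spaces_Z(1,2) f g _ z])
  fix c x assume c: "c \<in> carrier A2" and x: "x \<in> carrier H2"
  show "f (tens A2 H2 c x) = f' (tens A2 H2 c x)"
  proof (rule tensor_ext[OF space_A space_A _ _ _ c])
    show "lin A2 X (\<lambda>c. f (tens A2 H2 c x))" "lin A2 X (\<lambda>c. f' (tens A2 H2 c x))"
      by (intro lin_comp[OF f] lin_comp[OF g] lin_tens_left spaces_Z lin_id x)+
    fix p q assume p: "p \<in> carrier A" "q \<in> carrier A"
    show "f (tens A2 H2 (tens A A p q) x) = f' (tens A2 H2 (tens A A p q) x)"
    proof (rule tensor_ext[OF space_H space_H _ _ _ x])
      show "lin H2 X (\<lambda>x. f (tens A2 H2 (tens A A p q) x))" "lin H2 X (\<lambda>x. f' (tens A2 H2 (tens A A p q) x))"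
        by (intro lin_comp[OF f] lin_comp[OF g] lin_tens_right spaces_Z lin_id tens_closed space_A p)+
    qed (use eq p in \<open>simp add: Z_elem\<close>)
  qed
qed

text \<open>The iterated coproduct of 1 is 1 \<otimes> 1 \<otimes> 1 and 1 acts trivially on
  \<open>A\<close>, so the sums for g and then for h collapse. Elements of C therefore multiply from
  the left without any twist.\<close>

lemma Z_elem_mult_C:
  assumes "p \<in> carrier A" "q \<in> carrier A" "p' \<in> carrier A" "q' \<in> carrier A" "h \<in> carrier H" "g \<in> carrier H"
  shows "mult (Z_alg H) (Z_elem H p q (one H) (one H)) (Z_elem H p' q' h g) = Z_elem H (mult A p p') (mult A q' q) h g"
proof -
  let ?E = "\<lambda>h1 h2 h3 g1 g2 g3. Z_elem H (mult A p (lreg H h1 (rreg H p' g1)))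
         (mult A (lreg H h3 (rreg H q' g3)) q) (mult H h2 h) (mult H g g2)"
  have 1: "trilin H ZZ (\<lambda>g1 g2 g3. ?E h1 h2 h3 g1 g2 g3)"
    if "h1 \<in> carrier H" "h2 \<in> carrier H" "h3 \<in> carrier H" for h1 h2 h3
    using that by (intro trilinI lin_Z_elem lin_Z_elem_H lin_A_intros lin_id mult_A_closed mult_H_closed
        lreg_closed rreg_closed assms)
  have 2: "trilin H ZZ (\<lambda>h1 h2 h3. ?E h1 h2 h3 (one H) (one H) (one H))"
    by (intro trilinI lin_Z_elem lin_Z_elem_H lin_A_intros lin_id mult_A_closed mult_H_closed
        lreg_closed rreg_closed assms one_H)
  have "mult (Z_alg H) (Z_elem H p q (one H) (one H)) (Z_elem H p' q' h g) =
    (\<Sum>s\<in>cop_index3 H (one H). \<Sum>t\<in>cop_index3 H (one H). ?E (cop31 H (one H) s) (cop32 H (one H) s) (cop33 H (one H) s)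
       (cop31 H (one H) t) (cop32 H (one H) t) (cop33 H (one H) t))"
    using assms by (simp add: Z_elem_mult sum.cartesian_product)
  also have "\<dots> = (\<Sum>s\<in>cop_index3 H (one H). ?E (cop31 H (one H) s) (cop32 H (one H) s) (cop33 H (one H) s)
       (one H) (one H) (one H))"
    using sw3_sum[OF lin_comult_H spaces_Z(3) 1 one_H] sw3_one[OF spaces_Z(3) 1]
    by (intro sum.cong refl) (simp add: cop3_closed)
  also have "\<dots> = ?E (one H) (one H) (one H) (one H) (one H) (one H)"
    using sw3_sum[OF lin_comult_H spaces_Z(3) 2 one_H] sw3_one[OF spaces_Z(3) 2] by simp
  finally show ?thesis using assms by (simp add: lreg_one rreg_one)
qed

text \<open>The regular actions scale \<epsilon> by counits, and these remove the outer legs of h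
  and g. Elements of K therefore multiply from the right without any twist.\<close>

lemma Z_elem_mult_K:
  assumes "p \<in> carrier A" "q \<in> carrier A" and h: "h \<in> carrier H" and g: "g \<in> carrier H"
    and h': "h' \<in> carrier H" and g': "g' \<in> carrier H"
  shows "mult (Z_alg H) (Z_elem H p q h g) (Z_elem H (one A) (one A) h' g') = Z_elem H p q (mult H h h') (mult H g' g)"
proof -
  let ?F = "\<lambda>h2 g2. Z_elem H p q (mult H h2 h') (mult H g' g2)"
  let ?E = "\<lambda>h1 h2 h3 g1 g2 g3. smul ZZ (counit H h1 * counit H h3) (smul ZZ (counit H g1 * counit H g3) (?F h2 g2))"
  let ?e = "\<lambda>s t. ?E (cop31 H h s) (cop32 H h s) (cop33 H h s)
       (cop31 H g t) (cop32 H g t) (cop33 H g t)"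
  let ?c = "\<lambda>s. counit H (cop31 H h s) * counit H (cop33 H h s)"
  have F1: "lin H ZZ (\<lambda>h2. ?F h2 g2)" if "g2 \<in> carrier H" for g2
    by (intro lin_Z_elem lin_Z_elem_H lin_A_intros lin_id mult_H_closed assms that)
  have F2: "lin H ZZ (\<lambda>g2. ?F h2 g2)" if "h2 \<in> carrier H" for h2
    by (intro lin_Z_elem lin_Z_elem_H lin_A_intros lin_id mult_H_closed assms that)
  have t: "trilin H ZZ (\<lambda>h1 h2 h3. smul ZZ (counit H h1 * counit H h3) (f h2))" if f: "lin H ZZ f" for f
    by (intro trilinI lin_smul_left lin_smul_right lin_field_mult_left lin_field_mult_right lin_counit f spaces_Z lin_closed[OF f])
  have E: "Z_elem H (mult A p (lreg H h1 (rreg H (one A) g1))) (mult A (lreg H h3 (rreg H (one A) g3)) q)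
      (mult H h2 h') (mult H g' g2) = ?E h1 h2 h3 g1 g2 g3"
    if "h1 \<in> carrier H" "h2 \<in> carrier H" "h3 \<in> carrier H" "g1 \<in> carrier H" "g2 \<in> carrier H" "g3 \<in> carrier H"
    for h1 h2 h3 g1 g2 g3
    using that assms
    by (simp add: lreg_one_A rreg_one_A lin_smul[OF bilin_lin_right[OF bilin_lreg]]
        lin_smul[OF bilin_lin_right[OF bilin_mult_A]] lin_smul[OF bilin_lin_left[OF bilin_mult_A]]
        smul_smul lin_smul[OF lin_Z_elem(1)[OF lin_id]] lin_smul[OF lin_Z_elem(2)[OF lin_id]] space_smul mult_ac)
  have "mult (Z_alg H) (Z_elem H p q h g) (Z_elem H (one A) (one A) h' g') =
    (\<Sum>s\<in>cop_index3 H h. \<Sum>t\<in>cop_index3 H g. ?e s t)"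
    unfolding Z_elem_mult[OF assms(1,2) h g one_A_closed one_A_closed h' g'] sum.cartesian_product
    by (intro sum.cong refl) (auto intro!: E simp: cop3_closed h g)
  \<comment> \<open>The inner sum over the legs of g is collapsed first, with the counits of the
    legs of h carried along as a constant scalar.\<close>
  also have "\<dots> = (\<Sum>s\<in>cop_index3 H h. smul ZZ (?c s) (?F (cop32 H h s) g))"
  proof (intro sum.cong refl)
    fix s assume s: "s \<in> cop_index3 H h"
    note f = lin_smul_right[OF spaces_Z(3) F2[OF cop3_closed(2)[OF lin_comult_H h s]], of "?c s"]
    have "(\<Sum>t\<in>cop_index3 H g. ?e s t) =
      sw3 H (\<lambda>g1 g2 g3. smul ZZ (counit H g1 * counit H g3) (smul ZZ (?c s) (?F (cop32 H h s) g2))) g"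
      unfolding sw3_sum[OF lin_comult_H spaces_Z(3) t[OF f] g] by (simp add: smul_smul mult.commute)
    also have "\<dots> = smul ZZ (?c s) (?F (cop32 H h s) g)"
      by (rule sw3_counit[OF spaces_Z(3) f g])
    finally show "(\<Sum>t\<in>cop_index3 H g. ?e s t) = smul ZZ (?c s) (?F (cop32 H h s) g)" .
  qed
  also have "\<dots> = ?F h g"
    using sw3_sum[OF lin_comult_H spaces_Z(3) t[OF F1[OF g]] h] sw3_counit[OF spaces_Z(3) F1[OF g] h] by simp
  finally show ?thesis .
qed

subsection \<open>Left \<open>Z\<close>-modules\<close>

definition A_bimodule :: "('k, 'm::ab_group_add, 'x) space_scheme \<Rightarrow> (('h \<Rightarrow> 'k) \<Rightarrow> 'm \<Rightarrow> 'm) \<Rightarrow>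
    ('m \<Rightarrow> ('h \<Rightarrow> 'k) \<Rightarrow> 'm) \<Rightarrow> bool" where
  "A_bimodule V l r \<longleftrightarrow> bilin A V V l \<and> bilin V A V r \<and>
     (\<forall>m\<in>carrier V. l (one A) m = m \<and> r m (one A) = m) \<and>
     (\<forall>a\<in>carrier A. \<forall>b\<in>carrier A. \<forall>m\<in>carrier V.
        l (mult A a b) m = l a (l b m) \<and> r m (mult A a b) = r (r m a) b \<and> r (l a m) b = l a (r m b))"

text \<open>The common form of both kinds of objects. It takes bare maps, with neither coactions nor
  extensionality, so that it transfers freely between records on the same space.\<close>

definition Z_data :: "('k, 'm::ab_group_add, 'x) space_scheme \<Rightarrow> (('h \<Rightarrow> 'k) \<Rightarrow> 'm \<Rightarrow> 'm) \<Rightarrow>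
    ('m \<Rightarrow> ('h \<Rightarrow> 'k) \<Rightarrow> 'm) \<Rightarrow> ('h \<Rightarrow> 'm \<Rightarrow> 'm) \<Rightarrow> ('m \<Rightarrow> 'h \<Rightarrow> 'm) \<Rightarrow> bool" where
  "Z_data V l r L R \<longleftrightarrow> is_space V \<and> A_bimodule V l r \<and> two_sided V L R \<and> compat V l r L R"

lemma hopf_bimodule_iff_Z_data:
  fixes M :: "('k, 'h \<Rightarrow> 'k, 'm::ab_group_add) hopf_bimodule"
  shows "is_hopf_bimodule A M \<longleftrightarrow> Z_data M (lact M) (ract M) (Lact M) (Ract M) \<and>
     case_prod (lact M) \<in> extensional (carrier A \<times> carrier M) \<and>
     case_prod (ract M) \<in> extensional (carrier M \<times> carrier A) \<and>
     lin M (tensor_space A M) (lcoact M) \<and> lin M (tensor_space M A) (rcoact M) \<and>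
     lcoact M \<in> extensional (carrier M) \<and> rcoact M \<in> extensional (carrier M)"
  unfolding hopf_bimodule_iff is_bimodule_def Z_data_def A_bimodule_def by blast

lemma Z_data_eq_space:
  assumes "carrier V = carrier W" "smul V = smul W"
  shows "Z_data V = Z_data W"
proof (intro ext)
  fix l r L R
  have s: "is_space V = is_space W" using assms by (simp add: is_space_def)
  have b: "bilin A V V = bilin A W W" "bilin V A V = bilin W A W" "bilin H V V = bilin H W W" "bilin V H V = bilin W H W"
    by (intro bilin_eq_space assms refl)+
  show "Z_data V l r L R = Z_data W l r L R"
    unfolding Z_data_def A_bimodule_def two_sided_def compat_def s b assms(1) ..
qed

text \<open>The linear extension of p \<cdot> (h \<cdot> m \<cdot> g) \<cdot> q. The part from K
  acts first, in accordance with c \<bowtie> x = (c \<bowtie> 1)(1 \<bowtie> x).\<close>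

definition zact :: "(('h \<Rightarrow> 'k) \<Rightarrow> 'm \<Rightarrow> 'm) \<Rightarrow> ('m \<Rightarrow> ('h \<Rightarrow> 'k) \<Rightarrow> 'm) \<Rightarrow> ('h \<Rightarrow> 'm \<Rightarrow> 'm) \<Rightarrow> ('m \<Rightarrow> 'h \<Rightarrow> 'm) \<Rightarrow>
    ('k, ('k, 'h \<Rightarrow> 'k, 'h \<Rightarrow> 'k) tensor, ('k, 'h, 'h) tensor) tensor \<Rightarrow> 'm \<Rightarrow> 'm::ab_group_add" where
  "zact l r L R z m = lift A2 H2 (\<lambda>c x. lift A A (\<lambda>p q. lift H H (\<lambda>h g. r (l p (L h (R m g))) q) x) c) z"

context
  fixes V :: "('k, 'm::ab_group_add, 'x) space_scheme" and l r L R
  assumes Z: "Z_data V l r L R"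
begin

lemma Z_dataD:
  shows Z_space: "is_space V" and Zl: "bilin A V V l" and Zr: "bilin V A V r" and ZL: "bilin H V V L" and ZR: "bilin V H V R"
    and Z_one: "m \<in> carrier V \<Longrightarrow> l (one A) m = m" "m \<in> carrier V \<Longrightarrow> r m (one A) = m"
      "m \<in> carrier V \<Longrightarrow> L (one H) m = m" "m \<in> carrier V \<Longrightarrow> R m (one H) = m"
    and Z_assoc_l: "a \<in> carrier A \<Longrightarrow> b \<in> carrier A \<Longrightarrow> m \<in> carrier V \<Longrightarrow> l (mult A a b) m = l a (l b m)"
    and Z_assoc_r: "a \<in> carrier A \<Longrightarrow> b \<in> carrier A \<Longrightarrow> m \<in> carrier V \<Longrightarrow> r m (mult A a b) = r (r m a) b"
    and Z_lr: "a \<in> carrier A \<Longrightarrow> b \<in> carrier A \<Longrightarrow> m \<in> carrier V \<Longrightarrow> r (l a m) b = l a (r m b)"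
    and Z_assoc_L: "g \<in> carrier H \<Longrightarrow> h \<in> carrier H \<Longrightarrow> m \<in> carrier V \<Longrightarrow> L (mult H g h) m = L g (L h m)"
    and Z_assoc_R: "g \<in> carrier H \<Longrightarrow> h \<in> carrier H \<Longrightarrow> m \<in> carrier V \<Longrightarrow> R m (mult H g h) = R (R m g) h"
    and Z_LR: "g \<in> carrier H \<Longrightarrow> h \<in> carrier H \<Longrightarrow> m \<in> carrier V \<Longrightarrow> R (L h m) g = L h (R m g)"
    and Z_compat: "p \<in> carrier A \<Longrightarrow> q \<in> carrier A \<Longrightarrow> m \<in> carrier V \<Longrightarrow> h \<in> carrier H \<Longrightarrow> g \<in> carrier H \<Longrightarrow>
      L h (R (r (l p m) q) g) =
          (\<Sum>(s, t)\<in>cop_index3 H h \<times> cop_index3 H g.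
             r (l (lreg H (cop31 H h s) (rreg H p (cop31 H g t))) (L (cop32 H h s) (R m (cop32 H g t))))
               (lreg H (cop33 H h s) (rreg H q (cop33 H g t))))"
  using Z unfolding Z_data_def A_bimodule_def two_sided_def compat_def by blast+

lemmas Z_closed = bilin_closed[OF Zl] bilin_closed[OF Zr] bilin_closed[OF ZL] bilin_closed[OF ZR]

lemmas Z_lin = bilin_comp_left[OF Zl] bilin_comp_right[OF Zl] bilin_comp_left[OF Zr] bilin_comp_right[OF Zr]
  bilin_comp_left[OF ZL] bilin_comp_right[OF ZL] bilin_comp_left[OF ZR] bilin_comp_right[OF ZR]

lemma bilin_zact: "bilin ZZ V V (zact l r L R)"
  unfolding zact_def
  by (intro lin_intros Z_lin Z_closed Z_space space_A space_H spaces_Z; assumption)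

lemma zact_Z_elem:
  assumes "p \<in> carrier A" "q \<in> carrier A" "h \<in> carrier H" "g \<in> carrier H" "m \<in> carrier V"
  shows "zact l r L R (Z_elem H p q h g) m = r (l p (L h (R m g))) q"
proof -
  have 1: "bilin A2 H2 V (\<lambda>c x. lift A A (\<lambda>p q. lift H H (\<lambda>h g. r (l p (L h (R m g))) q) x) c)"
    by (intro lin_intros Z_lin Z_closed Z_space space_A space_H spaces_Z assms; assumption)
  have 2: "bilin A A V (\<lambda>p q. lift H H (\<lambda>h g. r (l p (L h (R m g))) q) (tens H H h g))"
    by (intro lin_intros Z_lin Z_closed Z_space space_A space_H spaces_Z assms; assumption)
  have 3: "bilin H H V (\<lambda>h g. r (l p (L h (R m g))) q)"
    by (intro lin_intros Z_lin Z_closed Z_space space_A space_H spaces_Z assms; assumption)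
  show ?thesis
    unfolding zact_def Z_elem using assms
    by (simp add: lift_tens[OF spaces_Z(1,2) Z_space 1] lift_tens[OF space_A space_A Z_space 2]
        lift_tens[OF space_H space_H Z_space 3] tens_closed)
qed

lemma zact_one: "m \<in> carrier V \<Longrightarrow> zact l r L R (one (Z_alg H)) m = m"
  by (simp add: one_Z zact_Z_elem Z_one)

text \<open>The bimodule laws bring every summand of the expanded product to a form in which p and q
  stand outside. The inner sum is then the right side of \<open>compat\<close> at the vector
  \<open>?n\<close>, the image of m under h' and g'.\<close>

lemma zact_mult_elem:
  assumes p: "p \<in> carrier A" "q \<in> carrier A" and h: "h \<in> carrier H" and g: "g \<in> carrier H"
    and p': "p' \<in> carrier A" "q' \<in> carrier A" and h': "h' \<in> carrier H" "g' \<in> carrier H" and m: "m \<in> carrier V"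
  shows "zact l r L R (mult (Z_alg H) (Z_elem H p q h g) (Z_elem H p' q' h' g')) m =
    zact l r L R (Z_elem H p q h g) (zact l r L R (Z_elem H p' q' h' g') m)"
proof -
  let ?I = "cop_index3 H h \<times> cop_index3 H g"
  let ?P = "\<lambda>s t. lreg H (cop31 H h s) (rreg H p' (cop31 H g t))"
  let ?Q = "\<lambda>s t. lreg H (cop33 H h s) (rreg H q' (cop33 H g t))"
  let ?n = "L h' (R m g')"
  let ?z = "\<lambda>s t. Z_elem H (mult A p (?P s t)) (mult A (?Q s t) q) (mult H (cop32 H h s) h') (mult H g' (cop32 H g t))"
  let ?y = "\<lambda>s t. r (l (?P s t) (L (cop32 H h s) (R ?n (cop32 H g t)))) (?Q s t)"
  have n: "?n \<in> carrier V" by (intro Z_closed h' m)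
  note c = cop3_closed[OF lin_comult_H h] cop3_closed[OF lin_comult_H g]
  have Zc: "?z s t \<in> carrier ZZ"
    if "s \<in> cop_index3 H h" "t \<in> cop_index3 H g" for s t
    using that assms by (intro Z_elem_closed mult_A_closed mult_H_closed lreg_closed rreg_closed c)
  have tc: "?y s t \<in> carrier V"
    if "s \<in> cop_index3 H h" "t \<in> cop_index3 H g" for s t
    using that assms by (intro Z_closed n mult_A_closed mult_H_closed lreg_closed rreg_closed c)
  have F: "lin V V (\<lambda>x. r (l p x) q)" by (intro Z_lin lin_id p)
  have "zact l r L R (mult (Z_alg H) (Z_elem H p q h g) (Z_elem H p' q' h' g')) m =
    (\<Sum>(s, t)\<in>?I. zact l r L R (?z s t) m)"
    unfolding Z_elem_mult[OF p h g p' h']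
    by (subst lin_sum[OF spaces_Z(3) bilin_lin_left[OF bilin_zact m]])
      (auto intro!: Zc sum.cong)
  also have "\<dots> = (\<Sum>(s, t)\<in>?I. r (l p (?y s t)) q)"
  proof (intro sum.cong refl, clarify)
    fix s t assume s: "s \<in> cop_index3 H h" and t: "t \<in> cop_index3 H g"
    note cs = c(1-3)[OF s] c(4-6)[OF t]
    have P: "?P s t \<in> carrier A" and Q: "?Q s t \<in> carrier A" using cs p' by simp_all
    have "zact l r L R (?z s t) m =
      r (l (mult A p (?P s t)) (L (mult H (cop32 H h s) h') (R m (mult H g' (cop32 H g t))))) (mult A (?Q s t) q)"
      using P Q cs by (intro zact_Z_elem mult_A_closed mult_H_closed p h' m)
    \<comment> \<open>The reversed products in the second tensor factors are those that right
      actions require: g' acts before the leg of g, and the twisted q' before q.\<close>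
    also have "\<dots> = r (r (l p (l (?P s t) (L (cop32 H h s) (R ?n (cop32 H g t))))) (?Q s t)) q"
      using P Q cs assms by (simp add: Z_assoc_l Z_assoc_r Z_assoc_L Z_assoc_R Z_LR Z_closed)
    also have "\<dots> = r (l p (?y s t)) q"
      using P Q cs assms by (simp add: Z_lr Z_closed)
    finally show "zact l r L R (?z s t) m =
      r (l p (?y s t)) q" .
  qed
  also have "\<dots> = r (l p (\<Sum>(s, t)\<in>?I. r (l (?P s t) (L (cop32 H h s) (R ?n (cop32 H g t)))) (?Q s t))) q"
    by (subst lin_sum[OF Z_space F]) (auto intro!: tc sum.cong)
  \<comment> \<open>This is \<open>compat\<close> read from right to left.\<close>
  also have "\<dots> = r (l p (L h (R (r (l p' ?n) q') g))) q"
    by (simp only: Z_compat[OF p' n h g])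
  also have "\<dots> = zact l r L R (Z_elem H p q h g) (zact l r L R (Z_elem H p' q' h' g') m)"
    using assms by (simp add: zact_Z_elem Z_closed)
  finally show ?thesis .
qed

lemma zact_mult:
  assumes a: "a \<in> carrier ZZ" and b: "b \<in> carrier ZZ" and m: "m \<in> carrier V"
  shows "zact l r L R (mult (Z_alg H) a b) m = zact l r L R a (zact l r L R b m)"
proof (rule Z_ext[OF _ _ _ a, where X = V])
  note lz = bilin_comp_left[OF bilin_zact] bilin_comp_right[OF bilin_zact]
    bilin_comp_left[OF bilin_mult_Z] bilin_comp_right[OF bilin_mult_Z] bilin_closed[OF bilin_zact]
  show "lin ZZ V (\<lambda>a. zact l r L R (mult (Z_alg H) a b) m)" "lin ZZ V (\<lambda>a. zact l r L R a (zact l r L R b m))"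
    by (intro lz lin_id b m)+
  fix p q h g assume e: "p \<in> carrier A" "q \<in> carrier A" "h \<in> carrier H" "g \<in> carrier H"
  show "zact l r L R (mult (Z_alg H) (Z_elem H p q h g) b) m = zact l r L R (Z_elem H p q h g) (zact l r L R b m)"
  proof (rule Z_ext[OF _ _ _ b, where X = V])
    show "lin ZZ V (\<lambda>b. zact l r L R (mult (Z_alg H) (Z_elem H p q h g) b) m)"
      "lin ZZ V (\<lambda>b. zact l r L R (Z_elem H p q h g) (zact l r L R b m))"
      by (intro lz lin_id Z_elem_closed m e)+
  qed (rule zact_mult_elem[OF e _ _ _ _ m])
qed

end

section \<open>From an action of Z to the four actions\<close>

context
  fixes N :: "('k, 'm::ab_group_add, 'x) space_scheme" and act
  assumes N: "is_space N" and b: "bilin ZZ N N act"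
    and one: "\<And>m. m \<in> carrier N \<Longrightarrow> act (one (Z_alg H)) m = m"
    and mult: "\<And>x y m. x \<in> carrier ZZ \<Longrightarrow> y \<in> carrier ZZ \<Longrightarrow> m \<in> carrier N \<Longrightarrow>
      act (mult (Z_alg H) x y) m = act x (act y m)"
begin

abbreviation (input) "\<epsilon> \<equiv> one A"
abbreviation (input) "I \<equiv> one H"

lemma act_mult_C:
  assumes "p \<in> carrier A" "q \<in> carrier A" "p' \<in> carrier A" "q' \<in> carrier A" "h \<in> carrier H" "g \<in> carrier H" "m \<in> carrier N"
  shows "act (Z_elem H p q I I) (act (Z_elem H p' q' h g) m) = act (Z_elem H (mult A p p') (mult A q' q) h g) m"
  using assms by (simp add: mult[symmetric] Z_elem_closed Z_elem_mult_C)

lemma act_mult_K: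
  assumes "p \<in> carrier A" "q \<in> carrier A" "h \<in> carrier H" "g \<in> carrier H" "h' \<in> carrier H" "g' \<in> carrier H" "m \<in> carrier N"
  shows "act (Z_elem H p q h g) (act (Z_elem H \<epsilon> \<epsilon> h' g') m) = act (Z_elem H p q (mult H h h') (mult H g' g)) m"
  using assms by (simp add: mult[symmetric] Z_elem_closed Z_elem_mult_K)

text \<open>The maps need only agree on carriers with the actions of the four kinds of generators,
  since the ones built below are undefined elsewhere. All laws except \<open>compat\<close> follow
  from products inside C or inside K or of the form (c \<bowtie> 1)(1 \<bowtie> x).\<close>

lemma module_Z_data:
  assumes l: "\<And>p m. p \<in> carrier A \<Longrightarrow> m \<in> carrier N \<Longrightarrow> l p m = act (Z_elem H p \<epsilon> I I) m"
    and r: "\<And>p m. p \<in> carrier A \<Longrightarrow> m \<in> carrier N \<Longrightarrow> r m p = act (Z_elem H \<epsilon> p I I) m"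
    and L: "\<And>h m. h \<in> carrier H \<Longrightarrow> m \<in> carrier N \<Longrightarrow> L h m = act (Z_elem H \<epsilon> \<epsilon> h I) m"
    and R: "\<And>h m. h \<in> carrier H \<Longrightarrow> m \<in> carrier N \<Longrightarrow> R m h = act (Z_elem H \<epsilon> \<epsilon> I h) m"
  shows "Z_data N l r L R"
    and "\<And>p q h g m. p \<in> carrier A \<Longrightarrow> q \<in> carrier A \<Longrightarrow> h \<in> carrier H \<Longrightarrow> g \<in> carrier H \<Longrightarrow> m \<in> carrier N \<Longrightarrow>
      act (Z_elem H p q h g) m = r (l p (L h (R m g))) q"
proof -
  have ac: "act (Z_elem H p q h g) m \<in> carrier N"
    if "p \<in> carrier A" "q \<in> carrier A" "h \<in> carrier H" "g \<in> carrier H" "m \<in> carrier N" for p q h g m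
    using that by (intro bilin_closed[OF b] Z_elem_closed)
  note lb = bilin_comp_left[OF b] bilin_comp_right[OF b] lin_Z_elem lin_Z_elem_H lin_id Z_elem_closed one_A_closed one_H
  have bl: "bilin A N N l"
    by (rule bilin_cong[where \<beta> = "\<lambda>p m. act (Z_elem H p \<epsilon> I I) m"]) (intro bilinI lb N space_A | simp add: l N)+
  have br: "bilin N A N r"
    by (rule bilin_cong[where \<beta> = "\<lambda>m p. act (Z_elem H \<epsilon> p I I) m"]) (intro bilinI lb N space_A | simp add: r N)+
  have bL: "bilin H N N L"
    by (rule bilin_cong[where \<beta> = "\<lambda>p m. act (Z_elem H \<epsilon> \<epsilon> p I) m"]) (intro bilinI lb N space_A | simp add: L N)+
  have bR: "bilin N H N R"
    by (rule bilin_cong[where \<beta> = "\<lambda>m p. act (Z_elem H \<epsilon> \<epsilon> I p) m"]) (intro bilinI lb N space_A | simp add: R N)+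
  have 1: "act (Z_elem H \<epsilon> \<epsilon> I I) m = m" if "m \<in> carrier N" for m
    using one[OF that] by (simp add: one_Z)
  \<comment> \<open>As rewrite rules these fuse successive generator actions into one
    \<open>Z_elem\<close>, except where an element of C is followed by one of K.\<close>
  note S = l r L R ac act_mult_C act_mult_K
  show E: "act (Z_elem H p q h g) m = r (l p (L h (R m g))) q"
    if "p \<in> carrier A" "q \<in> carrier A" "h \<in> carrier H" "g \<in> carrier H" "m \<in> carrier N" for p q h g m
    using that by (simp add: S)
  have cp: "L h (R (r (l p m) q) g) =
          (\<Sum>(s, t)\<in>cop_index3 H h \<times> cop_index3 H g.
             r (l (lreg H (cop31 H h s) (rreg H p (cop31 H g t))) (L (cop32 H h s) (R m (cop32 H g t))))
               (lreg H (cop33 H h s) (rreg H q (cop33 H g t))))" (is "_ = ?rhs")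
    if e: "p \<in> carrier A" "q \<in> carrier A" "m \<in> carrier N" "h \<in> carrier H" "g \<in> carrier H" for p q m h g
  proof -
    note c = cop3_closed[OF lin_comult_H e(4)] cop3_closed[OF lin_comult_H e(5)]
    let ?P = "\<lambda>s t. lreg H (cop31 H h s) (rreg H p (cop31 H g t))"
    let ?Q = "\<lambda>s t. lreg H (cop33 H h s) (rreg H q (cop33 H g t))"
    have Zc: "Z_elem H (?P s t) (?Q s t) (cop32 H h s) (cop32 H g t) \<in> carrier ZZ"
      if "s \<in> cop_index3 H h" "t \<in> cop_index3 H g" for s t
      using that e by (intro Z_elem_closed lreg_closed rreg_closed c)
    \<comment> \<open>An element of K multiplied onto one of C from the left is the only twisted
      product; expanding it by \<open>Z_elem_mult\<close> produces the commutation rule.\<close>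
    have "L h (R (r (l p m) q) g) = act (mult (Z_alg H) (Z_elem H \<epsilon> \<epsilon> h g) (Z_elem H p q I I)) m"
      using e by (simp add: S mult Z_elem_closed)
    also have "mult (Z_alg H) (Z_elem H \<epsilon> \<epsilon> h g) (Z_elem H p q I I) =
      (\<Sum>(s, t)\<in>cop_index3 H h \<times> cop_index3 H g. Z_elem H (?P s t) (?Q s t) (cop32 H h s) (cop32 H g t))"
      unfolding Z_elem_mult[OF one_A_closed one_A_closed e(4,5,1,2) one_H one_H]
      by (intro sum.cong refl) (auto simp: c e)
    also have "act \<dots> m = (\<Sum>(s, t)\<in>cop_index3 H h \<times> cop_index3 H g. act (Z_elem H (?P s t) (?Q s t) (cop32 H h s) (cop32 H g t)) m)"
      by (subst lin_sum[OF spaces_Z(3) bilin_lin_left[OF b e(3)]]) (auto intro!: Zc sum.cong)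
    also have "\<dots> = ?rhs"
      by (intro sum.cong refl) (auto intro!: E simp: c e)
    finally show ?thesis .
  qed
  show "Z_data N l r L R"
    unfolding Z_data_def A_bimodule_def two_sided_def compat_def
    by (intro conjI ballI N bl br bL bR cp; (assumption | simp add: S 1))
qed

end

subsection \<open>The two functors\<close>

definition to_module :: "('k, 'h \<Rightarrow> 'k, 'm::ab_group_add) hopf_bimodule \<Rightarrow>
    ('k, ('k, ('k, 'h \<Rightarrow> 'k, 'h \<Rightarrow> 'k) tensor, ('k, 'h, 'h) tensor) tensor, 'm) left_module" where
  "to_module M = \<lparr>carrier = carrier M, smul = smul M,
     act = (\<lambda>z m. if z \<in> carrier ZZ \<and> m \<in> carrier M then zact (lact M) (ract M) (Lact M) (Ract M) z m else undefined)\<rparr>"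

text \<open>A coaction is given by a tensor whose evaluations are the prescribed action of
  \<open>H\<close>; it exists by \<open>evl_exists\<close> or \<open>evr_exists\<close> and is
  unique by separation. The value \<open>undefined\<close> off the carriers provides the required
  extensionality.\<close>

definition to_bimodule :: "('k, ('k, ('k, 'h \<Rightarrow> 'k, 'h \<Rightarrow> 'k) tensor, ('k, 'h, 'h) tensor) tensor, 'm::ab_group_add) left_module \<Rightarrow>
    ('k, 'h \<Rightarrow> 'k, 'm) hopf_bimodule" where
  "to_bimodule N = \<lparr>carrier = carrier N, smul = smul N,
     lact = (\<lambda>p m. if p \<in> carrier A \<and> m \<in> carrier N then act N (Z_elem H p (one A) (one H) (one H)) m else undefined),
     ract = (\<lambda>m p. if p \<in> carrier A \<and> m \<in> carrier N then act N (Z_elem H (one A) p (one H) (one H)) m else undefined),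
     lcoact = (\<lambda>m. if m \<in> carrier N then SOME t. t \<in> carrier (tensor_space A N) \<and>
       (\<forall>g\<in>carrier H. evl N g t = act N (Z_elem H (one A) (one A) (one H) g) m) else undefined),
     rcoact = (\<lambda>m. if m \<in> carrier N then SOME t. t \<in> carrier (tensor_space N A) \<and>
       (\<forall>h\<in>carrier H. evr N h t = act N (Z_elem H (one A) (one A) h (one H)) m) else undefined)\<rparr>"

lemma to_module_simps [simp]: "carrier (to_module M) = carrier M" "smul (to_module M) = smul M"
  by (simp_all add: to_module_def)

lemma to_bimodule_simps [simp]: "carrier (to_bimodule N) = carrier N" "smul (to_bimodule N) = smul N"
  by (simp_all add: to_bimodule_def)

lemma is_left_module_Z_iff:
  "is_left_module (Z_alg H) N \<longleftrightarrow> is_space N \<and> bilin ZZ N N (act N) \<and>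
     case_prod (act N) \<in> extensional (carrier ZZ \<times> carrier N) \<and>
     (\<forall>m\<in>carrier N. act N (one (Z_alg H)) m = m) \<and>
     (\<forall>a\<in>carrier ZZ. \<forall>b\<in>carrier ZZ. \<forall>m\<in>carrier N. act N (mult (Z_alg H) a b) m = act N a (act N b m))"
proof -
  have "bilin (Z_alg H) N N = bilin ZZ N N"
    by (intro bilin_eq_space Z_alg_simps refl)
  then show ?thesis unfolding is_left_module_def by (simp add: Z_alg_simps)
qed

lemma one_Z_closed: "one (Z_alg H) \<in> carrier ZZ"
  unfolding one_Z by (intro Z_elem_closed one_A_closed one_H)

lemma act_to_module:
  "z \<in> carrier ZZ \<Longrightarrow> m \<in> carrier M \<Longrightarrow> act (to_module M) z m = zact (lact M) (ract M) (Lact M) (Ract M) z m"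
  by (simp add: to_module_def)

lemma to_module:
  assumes "is_hopf_bimodule A M"
  shows "is_left_module (Z_alg H) (to_module M)"
proof -
  have Z: "Z_data M (lact M) (ract M) (Lact M) (Ract M)"
    using assms by (simp add: hopf_bimodule_iff_Z_data)
  note M = Z_space[OF Z] and b = bilin_zact[OF Z]
  have "is_space (to_module M)" using M by (simp add: is_space_def)
  moreover have "bilin ZZ (to_module M) (to_module M) (act (to_module M))"
  proof -
    have "bilin ZZ M M (act (to_module M))"
      by (rule bilin_cong[OF b spaces_Z(3) M]) (simp add: act_to_module)
    moreover have "bilin ZZ (to_module M) (to_module M) = bilin ZZ M M"
      by (intro bilin_eq_space to_module_simps refl)
    ultimately show ?thesis by simp
  qed
  moreover have "case_prod (act (to_module M)) \<in> extensional (carrier ZZ \<times> carrier M)"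
    by (auto simp: to_module_def extensional_def)
  ultimately show ?thesis
    unfolding is_left_module_Z_iff
    by (auto simp: act_to_module one_Z_closed zact_one[OF Z] bilin_closed[OF bilin_mult_Z] bilin_closed[OF b] zact_mult[OF Z])
qed

context
  fixes N :: "('k, ('k, ('k, 'h \<Rightarrow> 'k, 'h \<Rightarrow> 'k) tensor, ('k, 'h, 'h) tensor) tensor, 'm::ab_group_add) left_module"
  assumes N: "is_left_module (Z_alg H) N"
begin

lemma module_facts: "is_space N" "bilin ZZ N N (act N)"
  "m \<in> carrier N \<Longrightarrow> act N (one (Z_alg H)) m = m"
  "a \<in> carrier ZZ \<Longrightarrow> b \<in> carrier ZZ \<Longrightarrow> m \<in> carrier N \<Longrightarrow> act N (mult (Z_alg H) a b) m = act N a (act N b m)"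
  using N by (auto simp: is_left_module_Z_iff)

lemma evl_to_bimodule: "evl (to_bimodule N) = evl N" "evr (to_bimodule N) = evr N"
  "tensor_space A (to_bimodule N) = tensor_space A N" "tensor_space (to_bimodule N) A = tensor_space N A"
proof -
  have *: "lift A (to_bimodule N) = (lift A N :: (_ \<Rightarrow> _ \<Rightarrow> 'm) \<Rightarrow> _)" "lift (to_bimodule N) A = (lift N A :: (_ \<Rightarrow> _ \<Rightarrow> 'm) \<Rightarrow> _)"
    by (intro lift_eq_space to_bimodule_simps refl)+
  then show "evl (to_bimodule N) = evl N" "evr (to_bimodule N) = evr N"
    by (simp_all add: fun_eq_iff evl_def slice_left_def evr_def slice_right_def)
  show "tensor_space A (to_bimodule N) = tensor_space A N" "tensor_space (to_bimodule N) A = tensor_space N A"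
    by (intro tensor_space_eq_space to_bimodule_simps refl)+
qed

lemma lcoact_to_bimodule:
  assumes m: "m \<in> carrier N"
  shows "lcoact (to_bimodule N) m \<in> carrier (tensor_space A N)"
    and "g \<in> carrier H \<Longrightarrow> evl N g (lcoact (to_bimodule N) m) = act N (Z_elem H (one A) (one A) (one H) g) m"
proof -
  have "lin H N (\<lambda>g. act N (Z_elem H (one A) (one A) (one H) g) m)"
    by (intro bilin_comp_left[OF module_facts(2)] lin_Z_elem_H lin_id one_A_closed one_H m)
  then obtain t where "t \<in> carrier (tensor_space A N) \<and>
       (\<forall>g\<in>carrier H. evl N g t = act N (Z_elem H (one A) (one A) (one H) g) m)"
    using evl_exists[OF module_facts(1)] by metis
  from someI[of "\<lambda>t. t \<in> carrier (tensor_space A N) \<and>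
       (\<forall>g\<in>carrier H. evl N g t = act N (Z_elem H (one A) (one A) (one H) g) m)", OF this] m
  have *: "lcoact (to_bimodule N) m \<in> carrier (tensor_space A N) \<and>
       (\<forall>g\<in>carrier H. evl N g (lcoact (to_bimodule N) m) = act N (Z_elem H (one A) (one A) (one H) g) m)"
    by (simp add: to_bimodule_def)
  then show "lcoact (to_bimodule N) m \<in> carrier (tensor_space A N)"
    "g \<in> carrier H \<Longrightarrow> evl N g (lcoact (to_bimodule N) m) = act N (Z_elem H (one A) (one A) (one H) g) m"
    by blast+
qed

lemma rcoact_to_bimodule:
  assumes m: "m \<in> carrier N"
  shows "rcoact (to_bimodule N) m \<in> carrier (tensor_space N A)"
    and "h \<in> carrier H \<Longrightarrow> evr N h (rcoact (to_bimodule N) m) = act N (Z_elem H (one A) (one A) h (one H)) m"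
proof -
  have "lin H N (\<lambda>h. act N (Z_elem H (one A) (one A) h (one H)) m)"
    by (intro bilin_comp_left[OF module_facts(2)] lin_Z_elem_H lin_id one_A_closed one_H m)
  then obtain t where "t \<in> carrier (tensor_space N A) \<and>
       (\<forall>h\<in>carrier H. evr N h t = act N (Z_elem H (one A) (one A) h (one H)) m)"
    using evr_exists[OF module_facts(1)] by metis
  from someI[of "\<lambda>t. t \<in> carrier (tensor_space N A) \<and>
       (\<forall>h\<in>carrier H. evr N h t = act N (Z_elem H (one A) (one A) h (one H)) m)", OF this] m
  have *: "rcoact (to_bimodule N) m \<in> carrier (tensor_space N A) \<and>
       (\<forall>h\<in>carrier H. evr N h (rcoact (to_bimodule N) m) = act N (Z_elem H (one A) (one A) h (one H)) m)"
    by (simp add: to_bimodule_def)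
  then show "rcoact (to_bimodule N) m \<in> carrier (tensor_space N A)"
    "h \<in> carrier H \<Longrightarrow> evr N h (rcoact (to_bimodule N) m) = act N (Z_elem H (one A) (one A) h (one H)) m"
    by blast+
qed

lemma acts_to_bimodule:
  "p \<in> carrier A \<Longrightarrow> m \<in> carrier N \<Longrightarrow> lact (to_bimodule N) p m = act N (Z_elem H p (one A) (one H) (one H)) m"
  "p \<in> carrier A \<Longrightarrow> m \<in> carrier N \<Longrightarrow> ract (to_bimodule N) m p = act N (Z_elem H (one A) p (one H) (one H)) m"
  "h \<in> carrier H \<Longrightarrow> m \<in> carrier N \<Longrightarrow> Lact (to_bimodule N) h m = act N (Z_elem H (one A) (one A) h (one H)) m"
  "h \<in> carrier H \<Longrightarrow> m \<in> carrier N \<Longrightarrow> Ract (to_bimodule N) m h = act N (Z_elem H (one A) (one A) (one H) h) m"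
  by (simp add: to_bimodule_def, simp add: to_bimodule_def)
    (simp_all add: Lact_def Ract_def evl_to_bimodule lcoact_to_bimodule rcoact_to_bimodule)

lemma Z_data_to_bimodule: "Z_data N (lact (to_bimodule N)) (ract (to_bimodule N)) (Lact (to_bimodule N)) (Ract (to_bimodule N))"
  by (rule module_Z_data(1)[OF module_facts acts_to_bimodule])

text \<open>The values are obtained by choice, but their evaluations are prescribed and linear in
  the argument. Since evaluations separate tensors, the chosen map is linear.\<close>

lemma lin_lcoact_to_bimodule: "lin N (tensor_space A N) (lcoact (to_bimodule N))"
proof (rule linI)
  note S = module_facts(1)
  note T = is_space_tensor[OF space_A S]
  fix x y c assume x: "x \<in> carrier N"
  have l: "lin N N (\<lambda>x. act N (Z_elem H (one A) (one A) (one H) g) x)" if "g \<in> carrier H" for g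
    by (intro bilin_lin_right[OF module_facts(2)] Z_elem_closed one_A_closed one_H that)
  show "lcoact (to_bimodule N) x \<in> carrier (tensor_space A N)" by (rule lcoact_to_bimodule[OF x])
  show "lcoact (to_bimodule N) (smul N c x) = smul (tensor_space A N) c (lcoact (to_bimodule N) x)"
    by (rule evl_eqI[OF S])
      (simp_all add: S T lcoact_to_bimodule x space_smul lin_smul[OF lin_evl] lin_smul[OF l])
  assume y: "y \<in> carrier N"
  show "lcoact (to_bimodule N) (x + y) = lcoact (to_bimodule N) x + lcoact (to_bimodule N) y"
    by (rule evl_eqI[OF S])
      (simp_all only: S T lcoact_to_bimodule x y space_add[OF S] space_add[OF T] lin_add[OF lin_evl[OF S]] lin_add[OF l])
qed

lemma lin_rcoact_to_bimodule: "lin N (tensor_space N A) (rcoact (to_bimodule N))"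
proof (rule linI)
  note S = module_facts(1)
  note T = is_space_tensor[OF S space_A]
  fix x y c assume x: "x \<in> carrier N"
  have l: "lin N N (\<lambda>x. act N (Z_elem H (one A) (one A) g (one H)) x)" if "g \<in> carrier H" for g
    by (intro bilin_lin_right[OF module_facts(2)] Z_elem_closed one_A_closed one_H that)
  show "rcoact (to_bimodule N) x \<in> carrier (tensor_space N A)" by (rule rcoact_to_bimodule[OF x])
  show "rcoact (to_bimodule N) (smul N c x) = smul (tensor_space N A) c (rcoact (to_bimodule N) x)"
    by (rule evr_eqI[OF S])
      (simp_all add: S T rcoact_to_bimodule x space_smul lin_smul[OF lin_evr] lin_smul[OF l])
  assume y: "y \<in> carrier N"
  show "rcoact (to_bimodule N) (x + y) = rcoact (to_bimodule N) x + rcoact (to_bimodule N) y"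
    by (rule evr_eqI[OF S])
      (simp_all only: S T rcoact_to_bimodule x y space_add[OF S] space_add[OF T] lin_add[OF lin_evr[OF S]] lin_add[OF l])
qed

lemma to_bimodule: "is_hopf_bimodule A (to_bimodule N)"
proof -
  have "lin (to_bimodule N) (tensor_space A N) = lin N (tensor_space A N)"
    "lin (to_bimodule N) (tensor_space N A) = lin N (tensor_space N A)"
    by (intro lin_eq_space to_bimodule_simps refl)+
  moreover have "Z_data (to_bimodule N) = Z_data N" by (intro Z_data_eq_space to_bimodule_simps)
  ultimately show ?thesis
    unfolding hopf_bimodule_iff_Z_data evl_to_bimodule
    using Z_data_to_bimodule lin_lcoact_to_bimodule lin_rcoact_to_bimodule
    by (auto simp: extensional_def) (auto simp: to_bimodule_def)
qed

text \<open>On carriers the two actions agree on every \<open>Z_elem\<close> and hence on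
  \<open>ZZ\<close>; off them both are \<open>undefined\<close>. This gives equality of records, as
  a bijection on objects requires.\<close>

lemma to_module_to_bimodule: "to_module (to_bimodule N) = N"
proof -
  let ?M = "to_bimodule N"
  note Z = Z_data_to_bimodule
  have e: "case_prod (act N) \<in> extensional (carrier ZZ \<times> carrier N)"
    using N by (simp add: is_left_module_Z_iff)
  have "act (to_module ?M) z m = act N z m" for z m
  proof (cases "z \<in> carrier ZZ \<and> m \<in> carrier N")
    case True
    then have z: "z \<in> carrier ZZ" and m: "m \<in> carrier N" by auto
    have "zact (lact ?M) (ract ?M) (Lact ?M) (Ract ?M) z m = act N z m"
      by (rule Z_ext[OF bilin_lin_left[OF bilin_zact[OF Z] m] bilin_lin_left[OF module_facts(2) m] _ z])
        (simp add: zact_Z_elem[OF Z] m module_Z_data(2)[OF module_facts acts_to_bimodule])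
    then show ?thesis using z m by (simp add: act_to_module)
  next
    case False
    then have "act N z m = undefined" using e by (auto simp: extensional_def)
    then show ?thesis using False by (auto simp: to_module_def)
  qed
  then have "act (to_module ?M) = act N" by (intro ext)
  then show ?thesis by (intro left_module.equality) simp_all
qed

end

text \<open>Setting all but one of p, q, h, g to the unit recovers each of the four actions. A
  rebuilt coaction has the same evaluations as the original one and therefore equals it.\<close>

lemma to_bimodule_to_module:
  fixes M :: "('k, 'h \<Rightarrow> 'k, 'm::ab_group_add) hopf_bimodule"
  assumes M: "is_hopf_bimodule A M"
  shows "to_bimodule (to_module M) = M"
proof -
  note N = to_module[OF M]
  let ?N = "to_module M"
  have Z: "Z_data M (lact M) (ract M) (Lact M) (Ract M)"
    and el: "case_prod (lact M) \<in> extensional (carrier A \<times> carrier M)"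
    and er: "case_prod (ract M) \<in> extensional (carrier M \<times> carrier A)"
    and ll: "lin M (tensor_space A M) (lcoact M)" and lr: "lin M (tensor_space M A) (rcoact M)"
    and ecl: "lcoact M \<in> extensional (carrier M)" and ecr: "rcoact M \<in> extensional (carrier M)"
    using M by (auto simp: hopf_bimodule_iff_Z_data)
  note S = Z_space[OF Z]
  have ev: "evl ?N = evl M" "evr ?N = evr M"
    and T: "tensor_space A ?N = tensor_space A M" "tensor_space ?N A = tensor_space M A"
  proof -
    have *: "lift A ?N = (lift A M :: (_ \<Rightarrow> _ \<Rightarrow> 'm) \<Rightarrow> _)" "lift ?N A = (lift M A :: (_ \<Rightarrow> _ \<Rightarrow> 'm) \<Rightarrow> _)"
      by (intro lift_eq_space to_module_simps refl)+
    then show "evl ?N = evl M" "evr ?N = evr M"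
      by (simp_all add: fun_eq_iff evl_def slice_left_def evr_def slice_right_def)
    show "tensor_space A ?N = tensor_space A M" "tensor_space ?N A = tensor_space M A"
      by (intro tensor_space_eq_space to_module_simps refl)+
  qed
  have a: "act ?N (Z_elem H p q h g) m = ract M (lact M p (Lact M h (Ract M m g))) q"
    if "p \<in> carrier A" "q \<in> carrier A" "h \<in> carrier H" "g \<in> carrier H" "m \<in> carrier M" for p q h g m
    using that by (simp add: act_to_module Z_elem_closed zact_Z_elem[OF Z])
  have "lact (to_bimodule ?N) p m = lact M p m" for p m
  proof (cases "p \<in> carrier A \<and> m \<in> carrier M")
    case True
    then show ?thesis by (simp add: acts_to_bimodule[OF N] a Z_one[OF Z] Z_closed[OF Z])
  next
    case False
    then have "lact M p m = undefined" using el by (auto simp: extensional_def)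
    then show ?thesis using False by (auto simp: to_bimodule_def)
  qed
  then have 1: "lact (to_bimodule ?N) = lact M" by (intro ext)
  have "ract (to_bimodule ?N) m p = ract M m p" for p m
  proof (cases "p \<in> carrier A \<and> m \<in> carrier M")
    case True
    then show ?thesis by (simp add: acts_to_bimodule[OF N] a Z_one[OF Z] Z_closed[OF Z])
  next
    case False
    then have "ract M m p = undefined" using er by (auto simp: extensional_def)
    then show ?thesis using False by (auto simp: to_bimodule_def)
  qed
  then have 2: "ract (to_bimodule ?N) = ract M" by (intro ext)
  have "lcoact (to_bimodule ?N) m = lcoact M m" for m
  proof (cases "m \<in> carrier M")
    case True
    then have m: "m \<in> carrier ?N" by simp
    show ?thesis
    proof (rule evl_eqI[OF S])
      show "lcoact (to_bimodule ?N) m \<in> carrier (tensor_space A M)"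
        using lcoact_to_bimodule(1)[OF N m] by (simp add: T)
      show "lcoact M m \<in> carrier (tensor_space A M)" by (rule lin_closed[OF ll True])
      fix g assume g: "g \<in> carrier H"
      show "evl M g (lcoact (to_bimodule ?N) m) = evl M g (lcoact M m)"
        using lcoact_to_bimodule(2)[OF N m g] True g
        by (simp add: ev a Z_one[OF Z] Z_closed[OF Z]) (simp add: Ract_def)
    qed
  next
    case False
    then have "lcoact M m = undefined" using ecl by (auto simp: extensional_def)
    then show ?thesis using False by (auto simp: to_bimodule_def)
  qed
  then have 3: "lcoact (to_bimodule ?N) = lcoact M" by (rule ext)
  have "rcoact (to_bimodule ?N) m = rcoact M m" for m
  proof (cases "m \<in> carrier M")
    case True
    then have m: "m \<in> carrier ?N" by simp
    show ?thesis
    proof (rule evr_eqI[OF S])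
      show "rcoact (to_bimodule ?N) m \<in> carrier (tensor_space M A)"
        using rcoact_to_bimodule(1)[OF N m] by (simp add: T)
      show "rcoact M m \<in> carrier (tensor_space M A)" by (rule lin_closed[OF lr True])
      fix g assume g: "g \<in> carrier H"
      show "evr M g (rcoact (to_bimodule ?N) m) = evr M g (rcoact M m)"
        using rcoact_to_bimodule(2)[OF N m g] True g
        by (simp add: ev a Z_one[OF Z] Z_closed[OF Z]) (simp add: Lact_def)
    qed
  next
    case False
    then have "rcoact M m = undefined" using ecr by (auto simp: extensional_def)
    then show ?thesis using False by (auto simp: to_bimodule_def)
  qed
  then have 4: "rcoact (to_bimodule ?N) = rcoact M" by (rule ext)
  show ?thesis by (intro hopf_bimodule.equality) (simp_all add: 1 2 3 4)
qed

end

subsection \<open>Morphisms\<close>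

lemma is_category_left_module_cat:
  assumes "\<And>M :: ('k::field, 'a::ab_group_add, 'm::ab_group_add) left_module. is_left_module Z M \<Longrightarrow>
    bilin Z M M (act M)"
  shows "is_category (left_module_cat Z :: (('k, 'a, 'm) left_module, 'm \<Rightarrow> 'm) category)"
proof -
  have c: "act M z m \<in> carrier M" "is_space M" if "is_left_module Z M" "z \<in> carrier Z" "m \<in> carrier M"
    for M :: "('k, 'a, 'm) left_module" and z m
    using that by (auto simp: is_left_module_def intro: bilin_closed)
  show ?thesis
    unfolding is_category_def left_module_cat_def category.simps
  proof (intro conjI ballI; (unfold mem_Collect_eq)?)
    fix M :: "('k, 'a, 'm) left_module" assume "is_left_module Z M"
    then show "restrict id (carrier M) \<in> left_module_hom Z M M"
      unfolding left_module_hom_def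
      by (auto simp: lin_def c) (auto simp: is_left_module_def space_add space_smul)
  next
    fix L M N :: "('k, 'a, 'm) left_module" and f g
    assume "is_left_module Z L" and "f \<in> left_module_hom Z L M" and "g \<in> left_module_hom Z M N"
    then show "compose (carrier L) g f \<in> left_module_hom Z L N"
      unfolding left_module_hom_def
      by (auto simp: lin_def compose_def c) (auto simp: is_left_module_def space_add space_smul)
  next
    fix M N :: "('k, 'a, 'm) left_module" and f
    assume "f \<in> left_module_hom Z M N"
    then show "compose (carrier M) f (restrict id (carrier M)) = f"
      "compose (carrier M) (restrict id (carrier N)) f = f"
      unfolding left_module_hom_def by (auto simp: lin_def compose_def extensional_def fun_eq_iff)
  next
    fix K L M N :: "('k, 'a, 'm) left_module" and f g h
    assume "f \<in> left_module_hom Z K L"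
    then show "compose (carrier K) h (compose (carrier K) g f) = compose (carrier K) (compose (carrier L) h g) f"
      unfolding left_module_hom_def by (auto simp: lin_def compose_def fun_eq_iff)
  qed
qed

context fd_hopf
begin

text \<open>The common form of morphisms: bicolinearity over \<open>A\<close> and linearity over
  \<open>Z\<close> will both be reduced to commuting with the four actions.\<close>

definition two_sided_hom :: "('k, 'h \<Rightarrow> 'k, 'm::ab_group_add) hopf_bimodule \<Rightarrow>
    ('k, 'h \<Rightarrow> 'k, 'm) hopf_bimodule \<Rightarrow> ('m \<Rightarrow> 'm) \<Rightarrow> bool" where
  "two_sided_hom M N f \<longleftrightarrow> f \<in> extensional (carrier M) \<and> lin M N f \<and>
     (\<forall>p\<in>carrier A. \<forall>m\<in>carrier M. f (lact M p m) = lact N p (f m) \<and> f (ract M m p) = ract N (f m) p) \<and>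
     (\<forall>h\<in>carrier H. \<forall>m\<in>carrier M. f (Lact M h m) = Lact N h (f m) \<and> f (Ract M m h) = Ract N (f m) h)"

context
  fixes M N :: "('k, 'h \<Rightarrow> 'k, 'm::ab_group_add) hopf_bimodule"
  assumes M: "is_hopf_bimodule A M" and N: "is_hopf_bimodule A N"
begin

text \<open>Colinearity is an equation in A \<otimes> N or N \<otimes> A; evaluating it at the
  points of \<open>H\<close> gives compatibility with the associated action and loses
  nothing.\<close>

lemma hopf_bimodule_hom_iff: "f \<in> hopf_bimodule_hom A M N \<longleftrightarrow> two_sided_hom M N f"
proof (cases "lin M N f")
  case True
  note f = True
  have SM: "is_space M" and SN: "is_space N"
    and lM: "lin M (tensor_space A M) (lcoact M)" and rM: "lin M (tensor_space M A) (rcoact M)"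
    and lN: "lin N (tensor_space A N) (lcoact N)" and rN: "lin N (tensor_space N A) (rcoact N)"
    using M N by (auto simp: hopf_bimodule_iff_Z_data Z_data_def)
  have 1: "lcoact N (f m) = tmap A M A N id f (lcoact M m) \<longleftrightarrow> (\<forall>h\<in>carrier H. f (Ract M m h) = Ract N (f m) h)"
    if m: "m \<in> carrier M" for m
  proof -
    have e: "evl N h (tmap A M A N id f (lcoact M m)) = f (Ract M m h)" if "h \<in> carrier H" for h
      unfolding Ract_def by (rule evl_tmap[OF SM SN f that lin_closed[OF lM m]])
    show ?thesis
    proof
      assume "lcoact N (f m) = tmap A M A N id f (lcoact M m)"
      then show "\<forall>h\<in>carrier H. f (Ract M m h) = Ract N (f m) h" using e by (auto simp: Ract_def)
    next
      assume "\<forall>h\<in>carrier H. f (Ract M m h) = Ract N (f m) h"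
      then show "lcoact N (f m) = tmap A M A N id f (lcoact M m)"
        by (intro evl_eqI[OF SN] lin_closed[OF lN] lin_closed[OF f] m
            lin_closed[OF lin_tmap[OF space_A SM space_A SN lin_identity f]] lin_closed[OF lM])
          (simp add: e, simp add: Ract_def)
    qed
  qed
  have 2: "rcoact N (f m) = tmap M A N A f id (rcoact M m) \<longleftrightarrow> (\<forall>h\<in>carrier H. f (Lact M h m) = Lact N h (f m))"
    if m: "m \<in> carrier M" for m
  proof -
    have e: "evr N h (tmap M A N A f id (rcoact M m)) = f (Lact M h m)" if "h \<in> carrier H" for h
      unfolding Lact_def by (rule evr_tmap[OF SM SN f that lin_closed[OF rM m]])
    show ?thesis
    proof
      assume "rcoact N (f m) = tmap M A N A f id (rcoact M m)"
      then show "\<forall>h\<in>carrier H. f (Lact M h m) = Lact N h (f m)" using e by (auto simp: Lact_def)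
    next
      assume "\<forall>h\<in>carrier H. f (Lact M h m) = Lact N h (f m)"
      then show "rcoact N (f m) = tmap M A N A f id (rcoact M m)"
        by (intro evr_eqI[OF SN] lin_closed[OF rN] lin_closed[OF f] m
            lin_closed[OF lin_tmap[OF SM space_A SN space_A f lin_identity]] lin_closed[OF rM])
          (simp add: e, simp add: Lact_def)
    qed
  qed
  show ?thesis
    unfolding hopf_bimodule_hom_def two_sided_hom_def using f 1 2 by auto
qed (simp add: hopf_bimodule_hom_def two_sided_hom_def)

text \<open>Linearity over \<open>Z\<close> specialises to each of the four actions. Conversely,
  compatibility with these gives it on every \<open>Z_elem\<close>, and \<open>Z_ext\<close> extends
  it to all of \<open>ZZ\<close>.\<close>

lemma left_module_hom_iff: "f \<in> left_module_hom (Z_alg H) (to_module M) (to_module N) \<longleftrightarrow> two_sided_hom M N f"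
proof -
  have lin_eq: "lin (to_module M) (to_module N) = lin M N"
    by (intro lin_eq_space to_module_simps)
  show ?thesis
  proof (cases "lin M N f")
    case True
    note f = True
    have ZM: "Z_data M (lact M) (ract M) (Lact M) (Ract M)" and ZN: "Z_data N (lact N) (ract N) (Lact N) (Ract N)"
      using M N by (auto simp: hopf_bimodule_iff_Z_data)
    note cM = Z_closed[OF ZM] and cN = Z_closed[OF ZN]
    note fc = lin_closed[OF f]
    have a: "act (to_module M) (Z_elem H p q h g) m = ract M (lact M p (Lact M h (Ract M m g))) q"
      and b: "act (to_module N) (Z_elem H p q h g) (f m) = ract N (lact N p (Lact N h (Ract N (f m) g))) q"
      if "p \<in> carrier A" "q \<in> carrier A" "h \<in> carrier H" "g \<in> carrier H" "m \<in> carrier M" for p q h g m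
      using that by (simp_all add: act_to_module Z_elem_closed zact_Z_elem[OF ZM] zact_Z_elem[OF ZN] fc)
    have "(\<forall>z\<in>carrier ZZ. \<forall>m\<in>carrier M. f (act (to_module M) z m) = act (to_module N) z (f m)) \<longleftrightarrow>
       (\<forall>p\<in>carrier A. \<forall>m\<in>carrier M. f (lact M p m) = lact N p (f m) \<and> f (ract M m p) = ract N (f m) p) \<and>
       (\<forall>h\<in>carrier H. \<forall>m\<in>carrier M. f (Lact M h m) = Lact N h (f m) \<and> f (Ract M m h) = Ract N (f m) h)" (is "?l \<longleftrightarrow> ?r")
    proof
      assume ?l
      then have e: "f (ract M (lact M p (Lact M h (Ract M m g))) q) = ract N (lact N p (Lact N h (Ract N (f m) g))) q"
        if "p \<in> carrier A" "q \<in> carrier A" "h \<in> carrier H" "g \<in> carrier H" "m \<in> carrier M" for p q h g m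
        using a[OF that] b[OF that] that Z_elem_closed[OF that(1-4)] by metis
      \<comment> \<open>Three of the four arguments are set to units, which isolates one action at a
        time.\<close>
      have "f (lact M p m) = lact N p (f m)" "f (ract M m p) = ract N (f m) p" if "p \<in> carrier A" "m \<in> carrier M" for p m
        using e[of p "one A" "one H" "one H" m] e[of "one A" p "one H" "one H" m] that
        by (simp_all add: Z_one[OF ZM] Z_one[OF ZN] cM cN fc)
      moreover have "f (Lact M h m) = Lact N h (f m)" "f (Ract M m h) = Ract N (f m) h" if "h \<in> carrier H" "m \<in> carrier M" for h m
        using e[of "one A" "one A" h "one H" m] e[of "one A" "one A" "one H" h m] that
        by (simp_all add: Z_one[OF ZM] Z_one[OF ZN] cM cN fc)
      ultimately show ?r by blast
    next
      assume r: ?r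
      show ?l
      proof (intro ballI)
        fix z m assume z: "z \<in> carrier ZZ" and m: "m \<in> carrier M"
        have "f (zact (lact M) (ract M) (Lact M) (Ract M) z m) = zact (lact N) (ract N) (Lact N) (Ract N) z (f m)"
        proof (rule Z_ext[OF lin_comp[OF f bilin_lin_left[OF bilin_zact[OF ZM] m]]
              bilin_lin_left[OF bilin_zact[OF ZN] fc[OF m]] _ z])
          fix p q h g assume "p \<in> carrier A" "q \<in> carrier A" "h \<in> carrier H" "g \<in> carrier H"
          then show "f (zact (lact M) (ract M) (Lact M) (Ract M) (Z_elem H p q h g) m) =
              zact (lact N) (ract N) (Lact N) (Ract N) (Z_elem H p q h g) (f m)"
            using r m by (simp add: zact_Z_elem[OF ZM] zact_Z_elem[OF ZN] fc cM)
        qed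
        then show "f (act (to_module M) z m) = act (to_module N) z (f m)"
          by (simp add: act_to_module z m fc)
      qed
    qed
    then show ?thesis
      unfolding left_module_hom_def two_sided_hom_def using f by (simp add: Z_alg_simps lin_eq)
  qed (simp add: left_module_hom_def two_sided_hom_def lin_eq)
qed

end

text \<open>Under \<open>to_module\<close> the hom-sets, identities and composition coincide
  literally, so the functor is the identity on morphisms; \<open>to_bimodule\<close> supplies the
  inverse on objects.\<close>

lemma category_iso_to_module:
  "category_iso (hopf_bimodule_cat A :: (('k, 'h \<Rightarrow> 'k, 'm::ab_group_add) hopf_bimodule, 'm \<Rightarrow> 'm) category)
    (left_module_cat (Z_alg H)) to_module (\<lambda>_ _ f. f)"
proof -
  let ?C = "hopf_bimodule_cat A :: (('k, 'h \<Rightarrow> 'k, 'm) hopf_bimodule, 'm \<Rightarrow> 'm) category"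
  let ?D = "left_module_cat (Z_alg H) :: (_, 'm \<Rightarrow> 'm) category"
  have D: "is_category ?D"
    by (rule is_category_left_module_cat) (simp add: is_left_module_def)
  have obj: "M \<in> Obj ?C \<longleftrightarrow> is_hopf_bimodule A M" "N \<in> Obj ?D \<longleftrightarrow> is_left_module (Z_alg H) N" for M N
    by (simp_all add: hopf_bimodule_cat_def left_module_cat_def)
  have hom: "Hom ?C M N = Hom ?D (to_module M) (to_module N)" if "M \<in> Obj ?C" "N \<in> Obj ?C" for M N
    using hopf_bimodule_hom_iff[of M N] left_module_hom_iff[of M N] that
    by (auto simp: obj) (auto simp: hopf_bimodule_cat_def left_module_cat_def)
  have idm: "Idm ?C M = Idm ?D (to_module M)" for M
    by (simp add: hopf_bimodule_cat_def left_module_cat_def)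
  have comp: "Comp ?C L M N = Comp ?D (to_module L) (to_module M) (to_module N)" for L M N
    by (simp add: hopf_bimodule_cat_def left_module_cat_def)
  have ob: "to_module M \<in> Obj ?D" if "M \<in> Obj ?C" for M
    using that to_module by (simp add: obj)
  \<comment> \<open>The category axioms for Hopf bimodules are pulled back from those for modules
    along these equalities.\<close>
  have C: "is_category ?C"
    unfolding is_category_def
    using D[unfolded is_category_def] ob by (simp add: hom idm comp)
  have "bij_betw to_module (Obj ?C) (Obj ?D)"
    by (rule bij_betw_byWitness[where f' = to_bimodule])
      (auto simp: obj to_bimodule_to_module to_module_to_bimodule to_module to_bimodule)
  then show ?thesis
    unfolding category_iso_def using C D by (simp add: hom idm comp bij_betw_def)
qed

text \<open>An instance of \<open>bisw_eval\<close>: the linear map m0 \<mapsto> p \<cdot> m0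
  \<cdot> q is applied to h \<cdot> (m \<cdot> g), and evaluation of the coaction legs is rewritten
  as plain application.\<close>

lemma act_to_module_Z_elem:
  assumes M: "is_hopf_bimodule A M" and e: "p \<in> carrier A" "q \<in> carrier A" "h \<in> carrier H" "g \<in> carrier H" "m \<in> carrier M"
  shows "act (to_module M) (Z_elem H p q h g) m =
    bisw A M (\<lambda>a m0 b. smul M (a g * b h) (ract M (lact M p m0) q)) m"
proof -
  have Z: "Z_data M (lact M) (ract M) (Lact M) (Ract M)"
    and l: "lin M (tensor_space A M) (lcoact M)" and r: "lin M (tensor_space M A) (rcoact M)"
    using M by (auto simp: hopf_bimodule_iff_Z_data)
  have f: "lin M M (\<lambda>m0. ract M (lact M p m0) q)" by (intro Z_lin[OF Z] lin_id e)
  show ?thesis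
    using bisw_eval[OF Z_space[OF Z] Zl[OF Z] Zr[OF Z] l r Z_space[OF Z] f e(4,3,5)] e
    by (simp add: act_to_module Z_elem_closed zact_Z_elem[OF Z]) (simp add: ev_def)
qed

end

theorem mainTheorem4:
  fixes H :: "('k::field, 'h::ab_group_add) hopf"
  assumes "hopf_algebra H" and "finite_dim H"
    and "bij_betw (antipode H) (carrier H) (carrier H)"
  shows "\<exists>(Fo :: ('k, 'h \<Rightarrow> 'k, 'm::ab_group_add) hopf_bimodule \<Rightarrow> ('k, _, 'm) left_module) Fm.
    category_iso (hopf_bimodule_cat (dual_hopf H)) (left_module_cat (Z_alg H)) Fo Fm \<and>
    (\<forall>M \<in> Obj (hopf_bimodule_cat (dual_hopf H)).
       carrier (Fo M) = carrier M \<and> smul (Fo M) = smul M \<and>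
       (\<forall>p \<in> carrier (dual_hopf H). \<forall>q \<in> carrier (dual_hopf H). \<forall>h \<in> carrier H. \<forall>g \<in> carrier H.
          \<forall>m \<in> carrier M.
            act (Fo M) (Z_elem H p q h g) m =
              bisw (dual_hopf H) M (\<lambda>a m0 b. smul M (a g * b h) (ract M (lact M p m0) q)) m)) \<and>
    (\<forall>M \<in> Obj (hopf_bimodule_cat (dual_hopf H)). \<forall>N \<in> Obj (hopf_bimodule_cat (dual_hopf H)).
       \<forall>f \<in> Hom (hopf_bimodule_cat (dual_hopf H)) M N. Fm M N f = f)"
proof -
  interpret fd_hopf H by unfold_locales (fact assms)+
  have obj: "Obj (hopf_bimodule_cat A) = Collect (is_hopf_bimodule A)"
    by (simp add: hopf_bimodule_cat_def)
  show ?thesis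
    by (rule exI[of _ to_module], rule exI[of _ "\<lambda>_ _ f. f"])
      (simp add: category_iso_to_module obj act_to_module_Z_elem)
qed

end
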